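(* Let $d,m\in\mathbb{N}$, $d\le m$. Let $A=\bigcup_{i=1}^{l}A_i$ be an infinite subset of $\mathbb{R}^m$, where each set $A_i$ is a compact set contained in some $d$-dimensional $C^1$-manifold embedded in $\mathbb{R}^m$, and $\mathcal{H}_d(A_i\cap A_j)=0$ for $1\le i<j\le l$. Then $$\lim_{N\to\infty}\frac{M^d_N(A)}{N\ln N}=\frac{\beta_d}{\mathcal{H}_d(A)},$$ where, if $\mathcal{H}_d(A)=0$, the limit is understood to be $\infty$. Furthermore, under the additional assumption that $\mathcal{H}_d(A)>0$, if $\omega_N=\{x_{i,N}\}_{i=1}^{N}$, $N\in\mathbb{N}$, is a sequence of asymptotically optimal configurations for the $N$-point $d$-polarization problem on $A$, then in the weak$^*$ topology of measures $$\frac1N\sum_{i=1}^{N}\delta_{x_{i,N}}\stackrel{*}{\longrightarrow}\frac{\mathcal{H}_d(\cdot)|_A}{\mathcal{H}_d(A)},\qquad N\to\infty.$$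
   Context: $\mathcal{H}_d$ is the $d$-dimensional Hausdorff measure in $\mathbb{R}^m$, normalized so that an isometric copy of the $d$-dimensional unit cube embedded in $\mathbb{R}^m$ has measure $1$; $\beta_d$ is the volume of the unit ball in $\mathbb{R}^d$; $\delta_x$ is the unit point mass at $x$. An $N$-point configuration $\omega_N=\{x_1,\dots,x_N\}$ on $A$ is a multiset of $N$ not necessarily distinct points of $A$ (cardinalities are counted with multiplicity). For $s>0$ and an infinite compact set $A\subset\mathbb{R}^m$, $$M^s(\omega_N;A):=\min_{y\in A}\sum_{i=1}^N\frac{1}{|y-x_i|^s},\qquad M^s_N(A):=\max_{\omega_N\subset A,\ \#\omega_N=N}M^s(\omega_N;A),$$ with the convention that $1/0=+\infty$ (the minimum and the maximum are attained). A sequence $\{\omega_N\}_{N=1}^\infty$ of $N$-point configurations on $A$ is asymptotically optimal for the $N$-point $d$-polarization problem on $A$ if $\lim_{N\to\infty}M^d(\omega_N;A)/M^d_N(A)=1$. A set $W\subset\mathbb{R}^m$ is a $d$-dimensional $C^1$-manifold embedded in $\mathbb{R}^m$ ($d\le m$) if every point $y\in W$ has an open neighborhood $V$ relative to $W$ that is homeomorphic to an open set $U\subset\mathbb{R}^d$, with the homeomorphism $f:U\to V$ being a $C^1$ mapping (into $\mathbb{R}^m$) whose $m\times d$ Jacobian matrix has rank $d$ at every point of $U$. Borel probability measures $\mu_n$ in $\mathbb{R}^m$ converge weak$^*$ to a Borel probability measure $\mu$ (written $\mu_n\stackrel{*}{\longrightarrow}\mu$) if $\int f\,d\mu_n\to\int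 f\,d\mu$ for every continuous $f:\mathbb{R}^m\to\mathbb{R}$. *)

theory Defs
  imports "HOL-Probability.Probability"
begin

(* Unnormalized d-dimensional Hausdorff outer measure.  The covering sets are required to be
   bounded because the library sets diameter S = 0 for unbounded S. *)
definition hausdorff_pre :: "nat \<Rightarrow> real \<Rightarrow> 'a::metric_space set \<Rightarrow> ennreal" where
  "hausdorff_pre d \<delta> E =
     (INF U \<in> {U :: nat \<Rightarrow> 'a set. E \<subseteq> (\<Union>i. U i) \<and> (\<forall>i. bounded (U i) \<and> diameter (U i) \<le> \<delta>)}.
        \<Sum>i. ennreal (diameter (U i) ^ d))"

definition hausdorff_outer :: "nat \<Rightarrow> 'a::metric_space set \<Rightarrow> ennreal" where
  "hausdorff_outer d E = (SUP \<delta> \<in> {0<..}. hausdorff_pre d \<delta> E)"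

(* The Borel measure H_d on R^m, d = CARD('d), normalized by the unit cube of R^d.  Coverings by
   arbitrary subsets make hausdorff_outer invariant under isometric embeddings, so every isometric
   copy of that cube in R^m has measure 1.  Since hausdorff_outer is a metric outer measure, it is
   countably additive on the Borel sets, as measure_of requires. *)
definition hausdorff_measure :: "'d::finite itself \<Rightarrow> (real^'m) measure" where
  "hausdorff_measure _ =
     measure_of UNIV (sets borel)
       (\<lambda>E. hausdorff_outer CARD('d) E / hausdorff_outer CARD('d) (cbox 0 One :: (real^'d) set))"

definition configuration :: "nat \<Rightarrow> 'a set \<Rightarrow> 'a multiset \<Rightarrow> bool" where
  "configuration N A \<omega> \<longleftrightarrow> set_mset \<omega> \<subseteq> A \<and> size \<omega> = N"

(* Division in ennreal satisfies 1 / 0 = \<infinity>. *)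
definition polarization :: "real \<Rightarrow> 'a::metric_space multiset \<Rightarrow> 'a set \<Rightarrow> ennreal" where
  "polarization s \<omega> A = (INF y\<in>A. \<Sum>x\<in>#\<omega>. 1 / ennreal (dist y x powr s))"

definition max_polarization :: "real \<Rightarrow> nat \<Rightarrow> 'a::metric_space set \<Rightarrow> ennreal" where
  "max_polarization s N A = (SUP \<omega> \<in> {\<omega>. configuration N A \<omega>}. polarization s \<omega> A)"

definition asymptotically_optimal ::
    "real \<Rightarrow> 'a::metric_space set \<Rightarrow> (nat \<Rightarrow> 'a multiset) \<Rightarrow> bool" where
  "asymptotically_optimal s A \<omega> \<longleftrightarrow>
     (\<forall>N\<ge>1. configuration N A (\<omega> N)) \<and>
     (\<lambda>N. polarization s (\<omega> N) A / max_polarization s N A) \<longlonglongrightarrow> 1"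

(* J x is the m x d Jacobian matrix of the local parametrization f at x. *)
definition C1_manifold :: "'d::finite itself \<Rightarrow> (real^'m) set \<Rightarrow> bool" where
  "C1_manifold _ W \<longleftrightarrow>
     (\<forall>y\<in>W. \<exists>V (U :: (real^'d) set) f g (J :: real^'d \<Rightarrow> real^'d^'m).
        openin (top_of_set W) V \<and> y \<in> V \<and> open U \<and> homeomorphism U V f g \<and>
        (\<forall>x\<in>U. (f has_derivative (\<lambda>h. J x *v h)) (at x)) \<and> continuous_on U J \<and>
        (\<forall>x\<in>U. rank (J x) = CARD('d)))"

(* (1/N) times the sum of the point masses at the N points, counted with multiplicity. *)
definition normalized_counting_measure :: "(real^'m) multiset \<Rightarrow> (real^'m) measure" where
  "normalized_counting_measure \<omega> =
     measure_of UNIV (sets borel) (\<lambda>E. (\<Sum>x\<in>#\<omega>. emeasure (return borel x) E) / of_nat (size \<omega>))"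

(* The test functions are not assumed bounded.  Used below only for measures concentrated on one
   compact set, for which every continuous function is integrable. *)
definition weak_star_conv :: "(nat \<Rightarrow> (real^'m) measure) \<Rightarrow> (real^'m) measure \<Rightarrow> bool" where
  "weak_star_conv \<mu> \<nu> \<longleftrightarrow>
     (\<forall>f :: real^'m \<Rightarrow> real. continuous_on UNIV f \<longrightarrow>
        (\<lambda>n. \<integral>x. f x \<partial>(\<mu> n)) \<longlonglongrightarrow> (\<integral>x. f x \<partial>\<nu>))"

end

theory Submission imports Defs begin

text \<open>
  Lower bound: if a configuration almost minimizes the Riesz energy
  \<open>E = \<Sum>\<^sub>i \<Sum>\<^sub>j\<^sub>\<noteq>\<^sub>i |x\<^sub>i - x\<^sub>j|\<^bsup>-d\<^esup>\<close> over \<open>A\<close>, no point can be improved by moving it to \<open>y \<in> A\<close>; hence the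
  potential at every \<open>y\<close> is at least about \<open>E / N\<close>. In \<open>\<real>\<^sup>d\<close> the kernel \<open>|x|\<^bsup>-d\<^esup>\<close> is an integral over the
  scales \<open>r\<close> of the volumes of \<open>B(0, r) \<inter> B(x, r)\<close>, and Cauchy--Schwarz at each scale between \<open>N\<^bsup>-1/d\<^esup>\<close>
  and a constant gives \<open>E \<ge> (1 - o(1)) \<beta>\<^sub>d N\<^sup>2 ln N / V\<close> for points in a compact set of volume less than
  \<open>V\<close>. Tangent projections are almost isometries, so \<open>A\<close> splits into finitely many compact pieces
  to which this applies.

  Upper bound: averaging the potential over a compact \<open>K \<subseteq> A \<inter> G\<close> with \<open>H\<^sub>d(K \<inter> B(x, t)) \<le> (1 + \<delta>) \<beta>\<^sub>d t\<^sup>d\<close>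
  for small \<open>t\<close>, minus the balls of radius \<open>r N\<^bsup>-1/d\<^esup>\<close> around the points, bounds the polarization times
  \<open>H\<^sub>d(K)\<close> by about \<open>\<beta>\<^sub>d ln N\<close> times the number of points in the open set \<open>G\<close>. With \<open>G = \<real>\<^sup>m\<close> this is the
  matching bound; for asymptotically optimal configurations it shows that \<open>G\<close> contains asymptotically at
  least its share of the points, which is weak-star convergence by the portmanteau argument.
\<close>

section \<open>Hausdorff measure\<close>

text \<open>Both bounds produce the same constant because each scale t between N^(-1/d) and a
  constant contributes with density dt / t, and d times the logarithmic length of that window is ln
  N up to a constant. The lower end of the window is forced. Below it the diagonal terms i = j of
  the energy bound would exceed O(N^2), and above it the removed balls of the averaging bound would
  take more than a prescribed share of the measure. No information on how the points spread over the
  pieces is needed: by Cauchy--Schwarz the sum of n_k^2 / v_k is at least N^2 / V, where V bounds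
  the total volume of the projected pieces. This total must come close to H_d(A) and not merely
  dominate it, which is where the null intersections enter. Projections distort measure by factors
  (1 + e)^d, so the estimates carry slack parameters that are sent to 0 only when the bounds are
  combined.\<close>

lemma hausdorff_pre_le:
  assumes "E \<subseteq> (\<Union>i. U i)" "\<And>i. bounded (U i)" "\<And>i. diameter (U i) \<le> \<delta>"
  shows "hausdorff_pre d \<delta> E \<le> (\<Sum>i::nat. ennreal (diameter (U i) ^ d))"
  unfolding hausdorff_pre_def by (rule INF_lower) (use assms in auto)

lemma hausdorff_pre_greatest:
  assumes "\<And>U :: nat \<Rightarrow> 'a::metric_space set. E \<subseteq> (\<Union>i. U i) \<Longrightarrow> (\<And>i. bounded (U i)) \<Longrightarrow>
     (\<And>i. diameter (U i) \<le> \<delta>) \<Longrightarrow> z \<le> (\<Sum>i::nat. ennreal (diameter (U i) ^ d))"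
  shows "z \<le> hausdorff_pre d \<delta> E"
  unfolding hausdorff_pre_def by (rule INF_greatest, rule assms) auto

lemma hausdorff_pre_mono: "E \<subseteq> F \<Longrightarrow> hausdorff_pre d \<delta> E \<le> hausdorff_pre d \<delta> F"
  by (rule hausdorff_pre_greatest, rule hausdorff_pre_le) auto

lemma hausdorff_pre_antimono: "\<delta> \<le> \<delta>' \<Longrightarrow> hausdorff_pre d \<delta>' E \<le> hausdorff_pre d \<delta> E"
  by (rule hausdorff_pre_greatest, rule hausdorff_pre_le) (auto intro: order_trans)

text \<open>Near-optimal coverings of the sets \<open>E n\<close>, with excess e / 2^(n+1), are
  merged into a single sequence through the pairing \<open>prod_decode\<close>.\<close>

lemma hausdorff_pre_UN:
  fixes E :: "nat \<Rightarrow> 'a::metric_space set"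
  shows "hausdorff_pre d \<delta> (\<Union>n. E n) \<le> (\<Sum>n. hausdorff_pre d \<delta> (E n))"
proof (rule ennreal_le_epsilon)
  fix e :: real assume e: "0 < e" and fin: "(\<Sum>n. hausdorff_pre d \<delta> (E n)) < top"
  have less: "hausdorff_pre d \<delta> (E n) < hausdorff_pre d \<delta> (E n) + e * (1/2)^Suc n" for n
    using e fin by (auto simp add: less_top dest!: ennreal_suminf_lessD)
  have "\<exists>U. E n \<subseteq> (\<Union>i. U i) \<and> (\<forall>i. bounded (U i) \<and> diameter (U i) \<le> \<delta>) \<and>
      (\<Sum>i::nat. ennreal (diameter (U i) ^ d)) < hausdorff_pre d \<delta> (E n) + e * (1/2)^Suc n" for n
    using less[of n] unfolding hausdorff_pre_def[of d \<delta> "E n"] INF_less_iff by blast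
  then obtain U where U: "\<And>n. E n \<subseteq> (\<Union>i. U n i)" "\<And>n i. bounded (U n i)"
      "\<And>n i. diameter (U n i) \<le> \<delta>"
      "\<And>n. (\<Sum>i::nat. ennreal (diameter (U n i) ^ d)) \<le> hausdorff_pre d \<delta> (E n) + e * (1/2)^Suc n"
    by (metis less_imp_le)
  define C where "C = case_prod U o prod_decode"
  have "(\<Union>n. E n) \<subseteq> (\<Union>i. C i)"
  proof safe
    fix x n assume "x \<in> E n"
    then obtain i where "x \<in> U n i" using U(1) by blast
    then have "x \<in> C (prod_encode (n, i))" by (simp add: C_def)
    then show "x \<in> (\<Union>i. C i)" by blast
  qed
  then have "hausdorff_pre d \<delta> (\<Union>n. E n) \<le> (\<Sum>i. ennreal (diameter (C i) ^ d))"
    by (rule hausdorff_pre_le) (auto simp: C_def U split: prod.splits)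
  also have "\<dots> = (\<Sum>i. (\<lambda>(n, i). ennreal (diameter (U n i) ^ d)) (prod_decode i))"
    by (simp add: C_def case_prod_beta)
  also have "\<dots> = (\<Sum>n. \<Sum>i. ennreal (diameter (U n i) ^ d))"
    by (rule suminf_ennreal_2dimen) simp
  also have "\<dots> \<le> (\<Sum>n. hausdorff_pre d \<delta> (E n) + e * (1/2)^Suc n)"
    by (intro suminf_le allI U) auto
  also have "\<dots> = (\<Sum>n. hausdorff_pre d \<delta> (E n)) + (\<Sum>n. ennreal e * ennreal ((1/2) ^ Suc n))"
    using \<open>0 < e\<close> by (subst suminf_add[symmetric])
                     (auto simp del: ennreal_suminf_cmult simp add: ennreal_mult[symmetric])
  also have "\<dots> = (\<Sum>n. hausdorff_pre d \<delta> (E n)) + e"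
    unfolding ennreal_suminf_cmult
    by (subst suminf_ennreal_eq[OF zero_le_power power_half_series]) auto
  finally show "hausdorff_pre d \<delta> (\<Union>n. E n) \<le> (\<Sum>n. hausdorff_pre d \<delta> (E n)) + e" .
qed

lemma hausdorff_pre_le_outer: "\<delta> > 0 \<Longrightarrow> hausdorff_pre d \<delta> E \<le> hausdorff_outer d E"
  unfolding hausdorff_outer_def by (rule SUP_upper) auto

lemma hausdorff_outer_mono: "E \<subseteq> F \<Longrightarrow> hausdorff_outer d E \<le> hausdorff_outer d F"
  unfolding hausdorff_outer_def by (rule SUP_mono) (use hausdorff_pre_mono in blast)

lemma hausdorff_outer_empty: "d > 0 \<Longrightarrow> hausdorff_outer d ({} :: 'a::metric_space set) = 0"
proof -
  assume "d > 0"
  then have "hausdorff_pre d \<delta> ({} :: 'a::metric_space set) \<le> 0" if "\<delta> > 0" for \<delta>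
    using hausdorff_pre_le[of "{} :: 'a set" "\<lambda>_. {}" \<delta> d] that by (simp add: zero_power)
  then have "hausdorff_outer d ({} :: 'a::metric_space set) \<le> 0"
    unfolding hausdorff_outer_def by (intro SUP_least) auto
  then show ?thesis by (rule antisym) simp
qed

lemma hausdorff_outer_UN:
  fixes E :: "nat \<Rightarrow> 'a::metric_space set"
  shows "hausdorff_outer d (\<Union>n. E n) \<le> (\<Sum>n. hausdorff_outer d (E n))"
proof -
  have "hausdorff_pre d \<delta> (\<Union>n. E n) \<le> (\<Sum>n. hausdorff_outer d (E n))" if "\<delta> > 0" for \<delta>
    by (rule order_trans[OF hausdorff_pre_UN])
      (intro suminf_le hausdorff_pre_le_outer that, auto)
  then show ?thesis
    unfolding hausdorff_outer_def[of d "\<Union>n. E n"] by (auto intro: SUP_least)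
qed

lemma hausdorff_outer_space:
  "d > 0 \<Longrightarrow> outer_measure_space (Pow UNIV) (hausdorff_outer d :: 'a::metric_space set \<Rightarrow> _)"
  by (auto simp: outer_measure_space_def positive_def increasing_def countably_subadditive_def
      hausdorff_outer_empty intro: hausdorff_outer_mono hausdorff_outer_UN)

lemma hausdorff_outer_Un:
  assumes "d > 0"
  shows "hausdorff_outer d (E \<union> F) \<le> hausdorff_outer d E + hausdorff_outer d F"
proof -
  have "subadditive (Pow UNIV) (hausdorff_outer d :: 'a set \<Rightarrow> _)"
    using hausdorff_outer_space[OF assms]
    unfolding outer_measure_space_def
    by (metis algebra_Pow ring_of_sets.countably_subadditive_subadditive algebra.axioms(1))
  \<comment> \<open>the library rule only covers disjoint unions\<close>
  then have "hausdorff_outer d (E \<union> (F - E)) \<le> hausdorff_outer d E + hausdorff_outer d (F - E)"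
    by (rule subadditiveD) auto
  also have "\<dots> \<le> hausdorff_outer d E + hausdorff_outer d F"
    by (intro add_left_mono hausdorff_outer_mono) auto
  finally show ?thesis by simp
qed

section \<open>Metric outer measure and Caratheodory's criterion\<close>

text \<open>A covering set of diameter below \<eta> cannot meet both E and F, so a fine covering of
  the union splits into a covering of E and one of F.\<close>

lemma hausdorff_outer_metric:
  fixes E F :: "'a::metric_space set"
  assumes d: "d > 0" and \<eta>: "\<eta> > 0" and sep: "\<And>x y. x \<in> E \<Longrightarrow> y \<in> F \<Longrightarrow> \<eta> \<le> dist x y"
  shows "hausdorff_outer d E + hausdorff_outer d F \<le> hausdorff_outer d (E \<union> F)"
proof -
  have small: "hausdorff_pre d \<delta> E + hausdorff_pre d \<delta> F \<le> hausdorff_pre d \<delta> (E \<union> F)"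
    if \<delta>: "0 < \<delta>" "\<delta> < \<eta>" for \<delta>
  proof (rule hausdorff_pre_greatest)
    fix U :: "nat \<Rightarrow> 'a set"
    assume U: "E \<union> F \<subseteq> (\<Union>i. U i)" "\<And>i. bounded (U i)" "\<And>i. diameter (U i) \<le> \<delta>"
    \<comment> \<open>Discarded sets are replaced by the empty set, which costs nothing: its
      diameter is 0, and 0 ^ d = 0 because d > 0.\<close>
    define V where "V = (\<lambda>S i. if U i \<inter> S = {} then {} else U i)"
    have cov: "hausdorff_pre d \<delta> S \<le> (\<Sum>i. ennreal (diameter (V S i) ^ d))" if "S \<subseteq> E \<union> F" for S
    proof (rule hausdorff_pre_le)
      show "S \<subseteq> (\<Union>i. V S i)" using that U(1) by (fastforce simp: V_def)
    qed (use U \<delta> in \<open>auto simp: V_def\<close>)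
    have "hausdorff_pre d \<delta> E + hausdorff_pre d \<delta> F
        \<le> (\<Sum>i. ennreal (diameter (V E i) ^ d)) + (\<Sum>i. ennreal (diameter (V F i) ^ d))"
      by (intro add_mono cov) auto
    also have "\<dots> = (\<Sum>i. ennreal (diameter (V E i) ^ d) + ennreal (diameter (V F i) ^ d))"
      by (rule suminf_add) auto
    also have "\<dots> \<le> (\<Sum>i. ennreal (diameter (U i) ^ d))"
    proof (intro suminf_le allI)
      fix i
      have "U i \<inter> E = {} \<or> U i \<inter> F = {}"
      proof (rule ccontr)
        assume "\<not> ?thesis"
        then obtain x y where "x \<in> U i" "x \<in> E" "y \<in> U i" "y \<in> F" by blast
        then have "\<eta> \<le> diameter (U i)"
          using sep diameter_bounded_bound[OF U(2)] order_trans by blast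
        then show False using U(3)[of i] \<delta> by linarith
      qed
      then show "ennreal (diameter (V E i) ^ d) + ennreal (diameter (V F i) ^ d)
          \<le> ennreal (diameter (U i) ^ d)"
        using d by (auto simp: V_def zero_power)
    qed auto
    finally show "hausdorff_pre d \<delta> E + hausdorff_pre d \<delta> F \<le> (\<Sum>i. ennreal (diameter (U i) ^ d))" .
  qed
  \<comment> \<open>The two suprema run over independent scales a and b; both are lowered to a
    common one.\<close>
  have "hausdorff_pre d a E + hausdorff_pre d b F \<le> hausdorff_outer d (E \<union> F)"
    if "a > 0" "b > 0" for a b
  proof -
    define \<delta> where "\<delta> = min (min a b) (\<eta>/2)"
    have \<delta>: "0 < \<delta>" "\<delta> < \<eta>" "\<delta> \<le> a" "\<delta> \<le> b" using that \<eta> by (auto simp: \<delta>_def)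
    have "hausdorff_pre d a E + hausdorff_pre d b F \<le> hausdorff_pre d \<delta> E + hausdorff_pre d \<delta> F"
      by (intro add_mono hausdorff_pre_antimono \<delta>)
    also have "\<dots> \<le> hausdorff_outer d (E \<union> F)"
      using small[OF \<delta>(1,2)] hausdorff_pre_le_outer[OF \<delta>(1)] order_trans by blast
    finally show ?thesis .
  qed
  then have "hausdorff_pre d a E + hausdorff_outer d F \<le> hausdorff_outer d (E \<union> F)" if "a > 0" for a
    unfolding hausdorff_outer_def[of d F] using that
    by (subst ennreal_SUP_add_right) (auto intro: SUP_least)
  then show ?thesis
    unfolding hausdorff_outer_def[of d E]
    by (subst ennreal_SUP_add_left[symmetric]) (auto intro: SUP_least)
qed

text \<open>The gap may depend on n, as it must for the shells of the next proof, which come closer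
  and closer to each other.\<close>

lemma hausdorff_outer_metric_sum:
  fixes S :: "nat \<Rightarrow> 'a::metric_space set"
  assumes d: "d > 0"
    and sep: "\<And>n. \<exists>\<eta>>0. \<forall>j<n. \<forall>x\<in>S j. \<forall>y\<in>S n. \<eta> \<le> dist x y"
  shows "(\<Sum>j<n. hausdorff_outer d (S j)) \<le> hausdorff_outer d (\<Union>j<n. S j)"
proof (induction n)
  case 0 then show ?case by simp
next
  case (Suc n)
  obtain \<eta> where \<eta>: "\<eta> > 0" "\<And>j x y. j < n \<Longrightarrow> x \<in> S j \<Longrightarrow> y \<in> S n \<Longrightarrow> \<eta> \<le> dist x y"
    using sep[of n] by blast
  have "(\<Sum>j<Suc n. hausdorff_outer d (S j)) \<le> hausdorff_outer d (\<Union>j<n. S j) + hausdorff_outer d (S n)"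
    using Suc by (simp add: add_right_mono)
  also have "\<dots> \<le> hausdorff_outer d ((\<Union>j<n. S j) \<union> S n)"
    by (rule hausdorff_outer_metric[OF d \<eta>(1)]) (use \<eta>(2) in auto)
  also have "(\<Union>j<n. S j) \<union> S n = (\<Union>j<Suc n. S j)"
    by (auto simp: lessThan_Suc)
  finally show ?case .
qed

text \<open>\<open>Y n\<close> collects the points of X at distance at least 1 / (n + 1) from C, so
  it is additive with the part of X in C. What is missing from X - C is covered by the shells
  \<open>D k\<close>. Shells of equal parity are separated, so the measures of all shells add up to
  at most twice that of X. The tail of this convergent series, which bounds the missing part,
  therefore tends to 0.\<close>

lemma hausdorff_outer_closed_split:
  fixes C X :: "'a::metric_space set"
  assumes d: "d > 0" and C: "closed C"
  shows "hausdorff_outer d (C \<inter> X) + hausdorff_outer d (X - C) \<le> hausdorff_outer d X"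
proof (cases "C = {} \<or> hausdorff_outer d X = top")
  \<comment> \<open>The empty set is treated apart because \<open>infdist x {} = 0\<close> by
    convention; infinite measure would spoil the convergence of the series.\<close>
  case True
  then show ?thesis by (auto simp: hausdorff_outer_empty d)
next
  case False
  then have ne: "C \<noteq> {}" and fin: "hausdorff_outer d X < top" by (auto simp: less_top)
  let ?h = "hausdorff_outer d :: 'a set \<Rightarrow> ennreal"
  define Y where "Y n = {x \<in> X. 1 / real (Suc n) \<le> infdist x C}" for n
  define D where "D n = Y (Suc n) - Y n" for n
  have sepD: "1 / real (Suc n) - 1 / real (Suc k) \<le> dist x y" if "x \<in> Y n" "y \<notin> Y k" "y \<in> X" for x y n k
    using that infdist_triangle[of x C y] by (auto simp: Y_def)
  have half: "(\<Sum>j<n. ?h (D (2 * j + p))) \<le> ?h X" for p n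
  proof -
    have "(\<Sum>j<n. ?h (D (2 * j + p))) \<le> ?h (\<Union>j<n. D (2 * j + p))"
    proof (rule hausdorff_outer_metric_sum[OF d])
      fix n
      show "\<exists>\<eta>>0. \<forall>j<n. \<forall>x\<in>D (2 * j + p). \<forall>y\<in>D (2 * n + p). \<eta> \<le> dist x y"
      proof (intro exI conjI allI impI ballI)
        \<comment> \<open>For n = 0 there is no earlier shell and any positive gap will do;
          \<open>?e\<close> itself would be -1 when n = p = 0, since 1 / 0 = 0.\<close>
        let ?e = "1 / real (2 * n + p) - 1 / real (Suc (2 * n + p))"
        have "1 / real (Suc k) < 1 / real k" if "k > 0" for k
          using that by (intro divide_strict_left_mono) auto
        from this[of "2 * n + p"] show "(if n = 0 then 1 else ?e) > 0" by auto
        fix j x y assume j: "j < n" and x: "x \<in> D (2 * j + p)" and y: "y \<in> D (2 * n + p)"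
        have "1 / real (Suc (Suc (2 * j + p))) - 1 / real (Suc (2 * n + p)) \<le> dist x y"
          using x y by (intro sepD) (auto simp: D_def Y_def)
        moreover have "1 / real (2 * n + p) \<le> 1 / real (Suc (Suc (2 * j + p)))"
          using j by (intro divide_left_mono) auto
        ultimately show "(if n = 0 then 1 else ?e) \<le> dist x y" using j by simp
      qed
    qed
    also have "\<dots> \<le> ?h X" by (rule hausdorff_outer_mono) (auto simp: D_def Y_def)
    finally show ?thesis .
  qed
  have all: "(\<Sum>k<n. ?h (D k)) \<le> 2 * ?h X" for n
  proof -
    have "(\<Sum>k<n. ?h (D k)) \<le> (\<Sum>k<2*n. ?h (D k))" by (rule sum_mono2) auto
    also have "\<dots> = (\<Sum>j<n. ?h (D (2 * j + 0))) + (\<Sum>j<n. ?h (D (2 * j + 1)))"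
      by (induction n) (auto simp: algebra_simps)
    also have "\<dots> \<le> ?h X + ?h X" by (intro add_mono half)
    finally show ?thesis by (simp add: mult_2)
  qed
  then have "(\<Sum>k. ?h (D k)) \<le> 2 * ?h X"
    by (intro suminf_le_const summableI) auto
  also have "\<dots> < top" using fin by (simp add: ennreal_mult_less_top)
  finally have sfin: "(\<Sum>k. ?h (D k)) < top" .
  define r where "r k = enn2real (?h (D k))" for k
  have r: "?h (D k) = ennreal (r k)" "r k \<ge> 0" for k
    using ennreal_suminf_lessD[OF sfin, of k] by (auto simp: r_def)
  have sr: "summable r" using sfin r by (simp add: summable_suminf_not_top)
  have cover: "X - C \<subseteq> Y n \<union> (\<Union>k. D (k + n))" for n
  proof
    fix x assume x: "x \<in> X - C"
    then have "infdist x C > 0"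
      using C ne in_closed_iff_infdist_zero[of C x] infdist_nonneg[of x C] by (auto simp: order_less_le)
    then obtain m where "1 / real (Suc m) < infdist x C"
      using nat_approx_posE by (metis)
    then have m: "x \<in> Y m" using x by (auto simp: Y_def)
    define k where "k = (LEAST k. x \<in> Y k)"
    have k: "x \<in> Y k" "\<And>j. j < k \<Longrightarrow> x \<notin> Y j"
      unfolding k_def using m LeastI not_less_Least by (metis, blast)
    show "x \<in> Y n \<union> (\<Union>k. D (k + n))"
    proof (cases "k \<le> n")
      case True
      then have "1 / real (Suc n) \<le> 1 / real (Suc k)" by (intro divide_left_mono) auto
      then have "x \<in> Y n" using k(1) by (auto simp: Y_def)
      then show ?thesis by blast
    next
      case False
      then have "x \<in> D ((k - 1 - n) + n)"
        using k by (auto simp: D_def)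
      then show ?thesis by blast
    qed
  qed
  show ?thesis
  proof (rule ennreal_le_epsilon)
    fix e :: real assume e: "0 < e"
    obtain n where n: "norm (\<Sum>i. r (i + n)) < e"
      using suminf_exist_split[OF e sr] by blast
    have "?h (X - C) \<le> ?h (Y n) + ?h (\<Union>k. D (k + n))"
      using hausdorff_outer_mono[OF cover] hausdorff_outer_Un[OF d] order_trans by blast
    also have "\<dots> \<le> ?h (Y n) + (\<Sum>k. ?h (D (k + n)))"
      by (intro add_left_mono hausdorff_outer_UN)
    also have "(\<Sum>k. ?h (D (k + n))) = ennreal (\<Sum>k. r (k + n))"
      unfolding r(1) by (rule suminf_ennreal2) (use r(2) sr in \<open>auto simp: summable_iff_shift\<close>)
    also have "\<dots> \<le> ennreal e" using n by (intro ennreal_leI) auto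
    finally have 1: "?h (X - C) \<le> ?h (Y n) + e" by (simp add: add_left_mono)
    have "?h (C \<inter> X) + ?h (Y n) \<le> ?h ((C \<inter> X) \<union> Y n)"
    proof (rule hausdorff_outer_metric[OF d])
      show "1 / real (Suc n) > 0" by simp
      fix x y assume "x \<in> C \<inter> X" "y \<in> Y n"
      then show "1 / real (Suc n) \<le> dist x y"
        using infdist_le[of x C y] by (auto simp: Y_def dist_commute)
    qed
    also have "\<dots> \<le> ?h X" by (rule hausdorff_outer_mono) (auto simp: Y_def)
    finally show "?h (C \<inter> X) + ?h (X - C) \<le> ?h X + e"
      using add_left_mono[OF 1, of "?h (C \<inter> X)"] by (metis (no_types, lifting) add.assoc add_right_mono order_trans)
  qed
qed

lemma hausdorff_outer_borel_measure_space:
  assumes d: "d > 0"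
  shows "measure_space UNIV (sets borel) (hausdorff_outer d :: 'a::metric_space set \<Rightarrow> _)"
proof -
  let ?L = "lambda_system UNIV (Pow UNIV) (hausdorff_outer d :: 'a set \<Rightarrow> _)"
  have ms: "measure_space UNIV ?L (hausdorff_outer d)"
    by (rule sigma_algebra.caratheodory_lemma[OF sigma_algebra_Pow hausdorff_outer_space[OF d]])
  then interpret L: sigma_algebra UNIV ?L by (simp add: measure_space_def)
  have "C \<in> ?L" if "closed C" for C
  proof -
    have "hausdorff_outer d (C \<inter> X) + hausdorff_outer d ((UNIV - C) \<inter> X) = hausdorff_outer d X" for X
    proof (rule antisym)
      have "(UNIV - C) \<inter> X = X - C" "X = C \<inter> X \<union> (X - C)" by auto
      then show "hausdorff_outer d (C \<inter> X) + hausdorff_outer d ((UNIV - C) \<inter> X) \<le> hausdorff_outer d X"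
        and "hausdorff_outer d X \<le> hausdorff_outer d (C \<inter> X) + hausdorff_outer d ((UNIV - C) \<inter> X)"
        using hausdorff_outer_closed_split[OF d that, of X] hausdorff_outer_Un[OF d, of "C \<inter> X" "X - C"]
        by auto
    qed
    then show ?thesis by (simp add: lambda_system_def)
  qed
  then have "sigma_sets UNIV (Collect closed) \<subseteq> ?L"
    by (intro L.sigma_sets_subset) auto
  then have sub: "sets borel \<subseteq> ?L" by (simp add: borel_eq_closed)
  show ?thesis
    using ms sub unfolding measure_space_def
    by (auto simp: positive_def countably_additive_def sets.sigma_algebra_axioms[of borel, simplified])
qed

section \<open>Lipschitz images and the normalizing constant\<close>

lemma hausdorff_outer_lipschitz_image:
  fixes f :: "'a::metric_space \<Rightarrow> 'b::metric_space"
  assumes L: "L > 0" and f: "\<And>x y. x \<in> E \<Longrightarrow> y \<in> E \<Longrightarrow> dist (f x) (f y) \<le> L * dist x y"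
  shows "hausdorff_outer d (f ` E) \<le> ennreal (L ^ d) * hausdorff_outer d E"
proof -
  have "hausdorff_pre d \<delta> (f ` E) \<le> ennreal (L ^ d) * hausdorff_outer d E" if \<delta>: "\<delta> > 0" for \<delta>
  proof -
    have "hausdorff_pre d \<delta> (f ` E) / ennreal (L ^ d) \<le> hausdorff_pre d (\<delta> / L) E"
    proof (rule hausdorff_pre_greatest)
      fix U :: "nat \<Rightarrow> 'a set"
      assume U: "E \<subseteq> (\<Union>i. U i)" "\<And>i. bounded (U i)" "\<And>i. diameter (U i) \<le> \<delta> / L"
      \<comment> \<open>The Lipschitz bound is known only on E, so the covering sets are cut down to
        E before taking images.\<close>
      define V where "V i = f ` (U i \<inter> E)" for i
      have bnd: "dist (f x) (f y) \<le> L * diameter (U i)" if "x \<in> U i \<inter> E" "y \<in> U i \<inter> E" for x y i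
      proof -
        have "dist (f x) (f y) \<le> L * dist x y" using that by (intro f) auto
        also have "\<dots> \<le> L * diameter (U i)"
          using that L diameter_bounded_bound[OF U(2)[of i], of x y] by auto
        finally show ?thesis .
      qed
      have b: "bounded (V i)" for i
      proof (cases "V i = {}")
        case False
        then obtain x where "x \<in> U i \<inter> E" by (auto simp: V_def)
        then have "\<forall>y\<in>V i. dist (f x) y \<le> L * diameter (U i)"
          using bnd by (auto simp: V_def)
        then show ?thesis unfolding bounded_def by blast
      qed auto
      have diam: "diameter (V i) \<le> L * diameter (U i)" for i
      proof (rule ccontr)
        assume "\<not> ?thesis"
        moreover have "0 \<le> L * diameter (U i)" using L diameter_ge_0[OF U(2)] by simp
        moreover define t where "t = (L * diameter (U i) + diameter (V i)) / 2"
        ultimately have t: "0 < t" "t < diameter (V i)" "L * diameter (U i) < t" by auto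
        obtain x y where "x \<in> V i" "y \<in> V i" "t < dist x y"
          using diameter_lower_bounded[OF b t(1,2)] by blast
        then obtain x' y' where "x' \<in> U i \<inter> E" "y' \<in> U i \<inter> E" "t < dist (f x') (f y')"
          by (auto simp: V_def)
        then show False using bnd[of x' i y'] t(3) by linarith
      qed
      have "hausdorff_pre d \<delta> (f ` E) \<le> (\<Sum>i. ennreal (diameter (V i) ^ d))"
      proof (rule hausdorff_pre_le[OF _ b])
        show "f ` E \<subseteq> (\<Union>i. V i)" using U(1) by (fastforce simp: V_def)
        fix i
        have "L * diameter (U i) \<le> \<delta>" using U(3)[of i] L by (simp add: field_simps)
        then show "diameter (V i) \<le> \<delta>" using diam[of i] by linarith
      qed
      also have "\<dots> \<le> (\<Sum>i. ennreal (L ^ d) * ennreal (diameter (U i) ^ d))"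
      proof (intro suminf_le allI)
        fix i
        have "diameter (V i) ^ d \<le> (L * diameter (U i)) ^ d"
          by (intro power_mono diam diameter_ge_0 b)
        then show "ennreal (diameter (V i) ^ d) \<le> ennreal (L ^ d) * ennreal (diameter (U i) ^ d)"
          using L diameter_ge_0[OF U(2)] by (simp add: power_mult_distrib ennreal_leI flip: ennreal_mult)
      qed auto
      also have "\<dots> = ennreal (L ^ d) * (\<Sum>i. ennreal (diameter (U i) ^ d))" by simp
      finally show "hausdorff_pre d \<delta> (f ` E) / ennreal (L ^ d) \<le> (\<Sum>i. ennreal (diameter (U i) ^ d))"
        using L by (intro divide_le_posI_ennreal) (auto simp: mult.commute)
    qed
    also have "\<dots> \<le> hausdorff_outer d E"
      using L \<delta> by (intro hausdorff_pre_le_outer) auto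
    finally have *: "hausdorff_pre d \<delta> (f ` E) / ennreal (L ^ d) \<le> hausdorff_outer d E" .
    have "hausdorff_pre d \<delta> (f ` E) = hausdorff_pre d \<delta> (f ` E) * ennreal (L ^ d) / ennreal (L ^ d)"
      using L by (intro ennreal_mult_divide_eq[symmetric]) auto
    also have "\<dots> = ennreal (L ^ d) * (hausdorff_pre d \<delta> (f ` E) / ennreal (L ^ d))"
      by (simp add: ennreal_times_divide mult.commute)
    also have "\<dots> \<le> ennreal (L ^ d) * hausdorff_outer d E"
      by (intro mult_left_mono *) simp
    finally show ?thesis .
  qed
  then show ?thesis
    unfolding hausdorff_outer_def[of d "f ` E"] by (auto intro: SUP_least)
qed


definition hausdorff_unit :: "'d::finite itself \<Rightarrow> ennreal" where
  "hausdorff_unit _ = hausdorff_outer CARD('d) (cbox 0 One :: (real^'d) set)"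

lemma hausdorff_unit_eq:
  "hausdorff_outer CARD('d::finite) (cbox 0 One :: (real^'d) set) = hausdorff_unit TYPE('d)"
  by (simp add: hausdorff_unit_def)

lemma card_UNIV_pos [simp]: "0 < CARD('d::finite)"
  by (simp add: card_gt_0_iff)

text \<open>A nonempty set of diameter r lies in the ball of radius r around any of its points.
  Comparing volumes, every covering of the unit cube has a sum of at least 1 divided by the volume
  of the unit ball.\<close>

lemma hausdorff_unit_pos: "hausdorff_unit TYPE('d::finite) > 0"
proof -
  let ?Q = "cbox 0 One :: (real^'d) set"
  define \<beta> where "\<beta> = ennreal (unit_ball_vol (real CARD('d)))"
  have \<beta>: "\<beta> \<noteq> 0" "\<beta> \<noteq> top" by (auto simp: \<beta>_def unit_ball_vol_pos less_imp_neq[symmetric])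
  have "1 / \<beta> \<le> hausdorff_pre CARD('d) 1 ?Q"
  proof (rule hausdorff_pre_greatest)
    fix U :: "nat \<Rightarrow> (real^'d) set"
    assume U: "?Q \<subseteq> (\<Union>i. U i)" "\<And>i. bounded (U i)" "\<And>i. diameter (U i) \<le> 1"
    define W where "W i = (if U i = {} then {} else cball (SOME x. x \<in> U i) (diameter (U i)))" for i
    have W: "U i \<subseteq> W i" for i
      using diameter_bounded_bound[OF U(2)[of i]] some_in_eq[of "U i"] by (auto simp: W_def)
    have "1 = emeasure lborel ?Q" by (simp add: emeasure_lborel_cbox_eq)
    also have "\<dots> \<le> emeasure lborel (\<Union>i. W i)"
    proof (intro emeasure_mono)
      show "?Q \<subseteq> (\<Union>i. W i)" using U(1) W by blast
    qed (auto simp: W_def)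
    also have "\<dots> \<le> (\<Sum>i. emeasure lborel (W i))"
      by (intro emeasure_subadditive_countably) (auto simp: W_def)
    also have "\<dots> \<le> (\<Sum>i. \<beta> * ennreal (diameter (U i) ^ CARD('d)))"
      by (intro suminf_le allI)
        (auto simp: W_def \<beta>_def emeasure_cball diameter_ge_0 U ennreal_mult)
    finally have "1 \<le> (\<Sum>i. ennreal (diameter (U i) ^ CARD('d))) * \<beta>"
      by (simp add: mult.commute)
    then show "1 / \<beta> \<le> (\<Sum>i. ennreal (diameter (U i) ^ CARD('d)))"
      using \<beta> by (intro divide_le_posI_ennreal) (auto simp: mult.commute less_top zero_less_iff_neq_zero)
  qed
  also have "\<dots> \<le> hausdorff_unit TYPE('d)"
    unfolding hausdorff_unit_def by (rule hausdorff_pre_le_outer) simp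
  finally show ?thesis
    using \<beta> by (metis ennreal_divide_eq_0_iff le_zero_eq not_gr_zero zero_neq_one)
qed

text \<open>The grid of side 1 / n covers the cube by (n + 1)^d cells. The l1 norm bounds their
  diameters by d / n, so the covering sum is at most ((n + 1) d / n)^d, whatever the scale.\<close>

lemma hausdorff_unit_finite: "hausdorff_unit TYPE('d::finite) < top"
proof -
  let ?Q = "cbox 0 One :: (real^'d) set"
  let ?d = "CARD('d)"
  have "hausdorff_pre ?d \<delta> ?Q \<le> ennreal ((2 * real ?d) ^ ?d)" if \<delta>: "\<delta> > 0" for \<delta>
  proof -
    obtain m where m: "real ?d / \<delta> < real m" using reals_Archimedean2 by blast
    define n where "n = Suc m"
    have n: "n > 0" "real ?d / real n \<le> \<delta>"
      using m \<delta> by (auto simp: n_def field_simps intro: order_trans less_imp_le add_increasing)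
    \<comment> \<open>The indices run up to n inclusive because a coordinate equal to 1 has floor
      index n.\<close>
    define F where "F = (UNIV :: 'd set) \<rightarrow>\<^sub>E {..n}"
    define cell where "cell k = {x :: real^'d. \<forall>i. real (k i) \<le> real n * x $ i \<and> real n * x $ i \<le> real (k i) + 1}"
      for k :: "'d \<Rightarrow> nat"
    have F: "finite F" "card F = (n + 1) ^ ?d"
      by (auto simp: F_def finite_PiE card_PiE)
    obtain h where h: "bij_betw h {..<card F} F"
      using ex_bij_betw_nat_finite[OF F(1)] by (auto simp: atLeast0LessThan)
    define U where "U j = (if j < card F then cell (h j) else {})" for j
    have cdist: "norm (x - y) \<le> real ?d / real n" if "x \<in> cell k" "y \<in> cell k" for x y k
    proof -
      have "\<bar>(x - y) $ i\<bar> \<le> 1 / real n" for i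
      proof -
        have "real (k i) \<le> real n * x $ i" "real n * x $ i \<le> real (k i) + 1"
             "real (k i) \<le> real n * y $ i" "real n * y $ i \<le> real (k i) + 1"
          using that by (auto simp: cell_def)
        then have "\<bar>real n * (x $ i - y $ i)\<bar> \<le> 1"
          by (auto simp: algebra_simps abs_le_iff)
        then have "real n * \<bar>x $ i - y $ i\<bar> \<le> 1" by (simp add: abs_mult)
        then show ?thesis using n(1) by (simp add: pos_le_divide_eq mult.commute)
      qed
      then have "(\<Sum>i\<in>UNIV. \<bar>(x - y) $ i\<bar>) \<le> (\<Sum>i\<in>(UNIV::'d set). 1 / real n)"
        by (intro sum_mono) auto
      with norm_le_l1_cart[of "x - y"] show ?thesis by simp
    qed
    have cb: "bounded (cell k)" for k
    proof (cases "cell k = {}")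
      case False
      then obtain x where "x \<in> cell k" by blast
      then have "\<forall>y\<in>cell k. dist x y \<le> real ?d / real n" using cdist by (auto simp: dist_norm)
      then show ?thesis unfolding bounded_def by blast
    qed auto
    have cd: "diameter (cell k) \<le> real ?d / real n" for k
      by (rule diameter_le) (auto intro: cdist)
    have "hausdorff_pre ?d \<delta> ?Q \<le> (\<Sum>j. ennreal (diameter (U j) ^ ?d))"
    proof (rule hausdorff_pre_le)
      show "?Q \<subseteq> (\<Union>j. U j)"
      proof
        fix x assume x: "x \<in> ?Q"
        then have x01: "0 \<le> x $ i" "x $ i \<le> 1" for i
        proof -
          have "0 \<le> x \<bullet> axis i 1 \<and> x \<bullet> axis i 1 \<le> 1"
            using x unfolding mem_box by (force simp: axis_in_Basis_iff)
          then show "0 \<le> x $ i" "x $ i \<le> 1" by (auto simp: inner_axis)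
        qed
        define k where "k i = nat \<lfloor>real n * x $ i\<rfloor>" for i
        have k: "k \<in> F"
        proof -
          have "k i \<le> n" for i
          proof -
            have "real n * x $ i \<le> real n" using x01[of i] by (simp add: mult_left_le)
            then show ?thesis unfolding k_def by linarith
          qed
          then show ?thesis by (auto simp: F_def)
        qed
        have "x \<in> cell k"
          using x01 by (auto simp: cell_def k_def)
        moreover obtain j where "j < card F" "h j = k"
          using h k unfolding bij_betw_def by (metis imageE lessThan_iff)
        ultimately show "x \<in> (\<Union>j. U j)" by (auto simp: U_def)
      qed
      show "bounded (U i)" "diameter (U i) \<le> \<delta>" for i
        using cb cd n(2) \<delta> by (auto simp: U_def intro: order_trans)
    qed
    also have "\<dots> = (\<Sum>j<card F. ennreal (diameter (U j) ^ ?d))"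
      by (rule suminf_finite) (auto simp: U_def zero_power)
    also have "\<dots> \<le> (\<Sum>j<card F. ennreal ((real ?d / real n) ^ ?d))"
      by (intro sum_mono ennreal_leI power_mono) (auto simp: U_def cd diameter_ge_0 cb)
    also have "\<dots> = ennreal (real (card F) * (real ?d / real n) ^ ?d)"
      by (simp add: ennreal_mult ennreal_of_nat_eq_real_of_nat)
    also have "real (card F) * (real ?d / real n) ^ ?d = (real (n + 1) * (real ?d / real n)) ^ ?d"
      by (simp only: F(2) of_nat_power power_mult_distrib)
    also have "\<dots> \<le> (2 * real ?d) ^ ?d"
    proof (rule power_mono)
      have "real (n + 1) * (real ?d / real n) \<le> (2 * real n) * (real ?d / real n)"
        using n(1) by (intro mult_right_mono) auto
      then show "real (n + 1) * (real ?d / real n) \<le> 2 * real ?d" using n(1) by simp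
    qed auto
    finally show ?thesis by (simp add: ennreal_leI)
  qed
  then have "hausdorff_unit TYPE('d) \<le> ennreal ((2 * real ?d) ^ ?d)"
    unfolding hausdorff_unit_def hausdorff_outer_def by (auto intro: SUP_least)
  then show ?thesis using ennreal_less_top le_less_trans by blast
qed

section \<open>The normalized measure and its agreement with Lebesgue measure\<close>

lemma sets_hausdorff_measure [simp, measurable_cong]:
  "sets (hausdorff_measure TYPE('d::finite) :: (real^'m) measure) = sets borel"
  unfolding hausdorff_measure_def using sets.sigma_sets_eq[of "borel :: (real^'m) measure"] by simp

lemma space_hausdorff_measure [simp]:
  "space (hausdorff_measure TYPE('d::finite) :: (real^'m) measure) = UNIV"
  unfolding hausdorff_measure_def by simp

lemma emeasure_hausdorff_measure:
  fixes E :: "(real^'m) set"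
  assumes "E \<in> sets borel"
  shows "emeasure (hausdorff_measure TYPE('d::finite)) E = hausdorff_outer CARD('d) E / hausdorff_unit TYPE('d)"
proof -
  have ms: "measure_space UNIV (sets borel) (hausdorff_outer CARD('d) :: (real^'m) set \<Rightarrow> _)"
    by (rule hausdorff_outer_borel_measure_space) simp
  show ?thesis
    unfolding hausdorff_measure_def hausdorff_unit_eq
  proof (rule emeasure_measure_of_sigma)
    show "sigma_algebra UNIV (sets (borel :: (real^'m) measure))"
      using ms by (simp add: measure_space_def)
    show "positive (sets borel) (\<lambda>E :: (real^'m) set. hausdorff_outer CARD('d) E / hausdorff_unit TYPE('d))"
      using ms by (simp add: measure_space_def positive_def)
    show "countably_additive (sets borel) (\<lambda>E :: (real^'m) set. hausdorff_outer CARD('d) E / hausdorff_unit TYPE('d))"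
      using ms by (simp add: measure_space_def countably_additive_def)
  qed (fact assms)
qed

lemma hausdorff_outer_bounded_finite:
  fixes E :: "(real^'d::finite) set"
  assumes "bounded E"
  shows "hausdorff_outer CARD('d) E < top"
proof -
  obtain b where b: "b > 0" "\<And>x. x \<in> E \<Longrightarrow> norm x \<le> b"
    using assms bounded_pos by blast
  let ?Q = "cbox 0 One :: (real^'d) set"
  define f where "f x = (2 * b) *\<^sub>R x - b *\<^sub>R One" for x :: "real^'d"
  have "E \<subseteq> f ` ?Q"
  proof
    fix x assume x: "x \<in> E"
    define y where "y = (1 / (2 * b)) *\<^sub>R (x + b *\<^sub>R One)"
    have "y \<in> ?Q"
    proof -
      have "0 \<le> y \<bullet> i \<and> y \<bullet> i \<le> 1" if i: "i \<in> Basis" for i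
        using Basis_le_norm[OF i, of x] b(2)[OF x] b(1) i
        by (auto simp: y_def inner_add_left field_simps abs_le_iff)
      then show ?thesis by (simp add: mem_box)
    qed
    moreover have "x = f y" using b(1) by (simp add: f_def y_def)
    ultimately show "x \<in> f ` ?Q" by blast
  qed
  then have "hausdorff_outer CARD('d) E \<le> hausdorff_outer CARD('d) (f ` ?Q)"
    by (rule hausdorff_outer_mono)
  also have "\<dots> \<le> ennreal ((2 * b) ^ CARD('d)) * hausdorff_outer CARD('d) ?Q"
    by (rule hausdorff_outer_lipschitz_image)
      (use b(1) in \<open>auto simp: f_def dist_norm simp flip: scaleR_diff_right\<close>)
  also have "\<dots> < top"
    using hausdorff_unit_finite[where 'd='d] by (simp add: hausdorff_unit_def ennreal_mult_less_top)
  finally show ?thesis .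
qed

lemma hausdorff_outer_translation:
  fixes E :: "'a::real_normed_vector set"
  shows "hausdorff_outer d ((+) a ` E) = hausdorff_outer d E"
proof (rule antisym)
  have le: "hausdorff_outer d ((+) a ` E) \<le> hausdorff_outer d E" for a and E :: "'a set"
    using hausdorff_outer_lipschitz_image[of 1 E "(+) a" d] by simp
  show "hausdorff_outer d ((+) a ` E) \<le> hausdorff_outer d E" by (rule le)
  show "hausdorff_outer d E \<le> hausdorff_outer d ((+) a ` E)"
    using le[of "- a" "(+) a ` E"] by (simp add: image_image)
qed

lemma sigma_finite_hausdorff_measure:
  "sigma_finite_measure (hausdorff_measure TYPE('d::finite) :: (real^'d) measure)"
proof
  let ?A = "range (\<lambda>n. cball 0 (real n) :: (real^'d) set)"
  have "(\<Union>n. cball 0 (real n) :: (real^'d) set) = UNIV"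
    using real_arch_simple by auto
  moreover have "emeasure (hausdorff_measure TYPE('d)) (cball 0 (real n) :: (real^'d) set) \<noteq> \<infinity>" for n
    using hausdorff_outer_bounded_finite[of "cball 0 (real n) :: (real^'d) set"] hausdorff_unit_pos[where 'd='d]
    by (auto simp: emeasure_hausdorff_measure ennreal_divide_eq_top_iff)
  ultimately show "\<exists>A. countable A \<and> A \<subseteq> sets (hausdorff_measure TYPE('d) :: (real^'d) measure) \<and>
      \<Union>A = space (hausdorff_measure TYPE('d) :: (real^'d) measure) \<and>
      (\<forall>a\<in>A. emeasure (hausdorff_measure TYPE('d)) a \<noteq> \<infinity>)"
    by (intro exI[of _ ?A]) auto
qed

text \<open>A translation invariant \<open>\<sigma>\<close>-finite Borel measure \<open>M\<close> giving the unit cube \<open>Q\<close> measure 1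
  is Lebesgue measure: compute \<open>\<integral>\<integral> 1\<^sub>E(x) 1\<^sub>Q(x + y) dM(x) dy\<close> in both orders.\<close>

lemma emeasure_hausdorff_measure_eq_lborel:
  fixes E :: "(real^'d::finite) set"
  assumes E [measurable]: "E \<in> sets borel"
  shows "emeasure (hausdorff_measure TYPE('d)) E = emeasure lborel E"
proof -
  let ?M = "hausdorff_measure TYPE('d) :: (real^'d) measure"
  define Q where "Q = (cbox 0 One :: (real^'d) set)"
  have Q[measurable]: "Q \<in> sets borel" by (simp add: Q_def)
  interpret M: sigma_finite_measure ?M by (rule sigma_finite_hausdorff_measure)
  interpret P: pair_sigma_finite ?M lborel by unfold_locales
  have MQ: "emeasure ?M Q = 1"
    using hausdorff_unit_pos[where 'd='d] hausdorff_unit_finite[where 'd='d]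
    by (simp add: Q_def emeasure_hausdorff_measure less_top ennreal_divide_self hausdorff_unit_eq)
  have LQ: "emeasure lborel Q = 1" by (simp add: Q_def emeasure_lborel_cbox_eq)
  have Mtrans: "emeasure ?M ((+) a ` S) = emeasure ?M S" if "S \<in> sets borel" for a S
  proof -
    have "(+) a ` S = (\<lambda>x. x - a) -` S \<inter> space borel" by (auto simp: image_iff) (metis add.commute diff_add_cancel)
    also have "\<dots> \<in> sets borel" by (rule measurable_sets[OF _ that]) measurable
    finally show ?thesis using that by (simp add: emeasure_hausdorff_measure hausdorff_outer_translation)
  qed
  have 1: "emeasure lborel ((\<lambda>y. x + y) -` Q) = 1" for x
    using LQ by (subst (asm) lborel_distr_plus[of x, symmetric]) (simp add: emeasure_distr)
  have 2: "emeasure lborel ((\<lambda>y. x - y) -` E) = emeasure lborel E" for x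
  proof -
    have eq: "(lborel :: (real^'d) measure) = distr lborel borel (\<lambda>y. x - y)"
      using lborel_affine[of "-1" x] by (simp add: density_1)
    show ?thesis by (subst (2) eq) (simp add: emeasure_distr)
  qed
  have "emeasure ?M E = (\<integral>\<^sup>+x. indicator E x * emeasure lborel ((\<lambda>y. x + y) -` Q) \<partial>?M)"
    by (simp add: 1)
  also have "\<dots> = (\<integral>\<^sup>+x. indicator E x * (\<integral>\<^sup>+y. indicator Q (x + y) \<partial>lborel) \<partial>?M)"
  proof (intro nn_integral_cong)
    fix x :: "real^'d"
    have "(\<lambda>y. x + y) -` Q \<inter> space borel \<in> sets borel"
      by (rule measurable_sets[OF _ Q]) measurable
    then have "emeasure lborel ((\<lambda>y. x + y) -` Q) = (\<integral>\<^sup>+y. indicator ((\<lambda>y. x + y) -` Q) y \<partial>lborel)"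
      by simp
    then show "indicator E x * emeasure lborel ((\<lambda>y. x + y) -` Q) = indicator E x * (\<integral>\<^sup>+y. indicator Q (x + y) \<partial>lborel)"
      by (simp add: indicator_def)
  qed
  also have "\<dots> = (\<integral>\<^sup>+x. (\<integral>\<^sup>+y. indicator E x * indicator Q (x + y) \<partial>lborel) \<partial>?M)"
    by (simp add: nn_integral_cmult)
  also have "\<dots> = (\<integral>\<^sup>+y. (\<integral>\<^sup>+x. indicator E x * indicator Q (x + y) \<partial>?M) \<partial>lborel)"
    by (rule P.Fubini'[symmetric]) measurable
  \<comment> \<open>Translation invariance of \<open>?M\<close> moves the shift from Q to E;
    integrating over y first then yields the volume of E times the mass of Q.\<close>
  also have "\<dots> = (\<integral>\<^sup>+y. (\<integral>\<^sup>+x. indicator E (x - y) * indicator Q x \<partial>?M) \<partial>lborel)"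
  proof (rule nn_integral_cong)
    fix y :: "real^'d"
    have "(\<integral>\<^sup>+x. indicator E x * indicator Q (x + y) \<partial>?M) = (\<integral>\<^sup>+x. indicator {x \<in> space borel. x \<in> E \<and> x + y \<in> Q} x \<partial>?M)"
      by (intro nn_integral_cong) (auto split: split_indicator)
    also have "\<dots> = emeasure ?M {x \<in> space borel. x \<in> E \<and> x + y \<in> Q}"
      by (intro nn_integral_indicator) simp
    also have "\<dots> = emeasure ?M ((+) y ` {x \<in> space borel. x \<in> E \<and> x + y \<in> Q})"
      by (rule Mtrans[symmetric]) simp
    also have "(+) y ` {x \<in> space borel. x \<in> E \<and> x + y \<in> Q} = {x \<in> space borel. x - y \<in> E \<and> x \<in> Q}"
      by (auto simp: image_iff add.commute) (metis add.commute diff_add_cancel)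
    also have "emeasure ?M \<dots> = (\<integral>\<^sup>+x. indicator {x \<in> space borel. x - y \<in> E \<and> x \<in> Q} x \<partial>?M)"
      by (intro nn_integral_indicator[symmetric]) simp
    also have "\<dots> = (\<integral>\<^sup>+x. indicator E (x - y) * indicator Q x \<partial>?M)"
      by (intro nn_integral_cong) (auto split: split_indicator)
    finally show "(\<integral>\<^sup>+x. indicator E x * indicator Q (x + y) \<partial>?M) = (\<integral>\<^sup>+x. indicator E (x - y) * indicator Q x \<partial>?M)" .
  qed
  also have "\<dots> = (\<integral>\<^sup>+x. (\<integral>\<^sup>+y. indicator E (x - y) * indicator Q x \<partial>lborel) \<partial>?M)"
    by (rule P.Fubini') measurable
  also have "\<dots> = (\<integral>\<^sup>+x. emeasure lborel ((\<lambda>y. x - y) -` E) * indicator Q x \<partial>?M)"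
  proof (intro nn_integral_cong)
    fix x :: "real^'d"
    have "(\<lambda>y. x - y) -` E \<inter> space borel \<in> sets borel"
      by (rule measurable_sets[OF _ E]) measurable
    then have "emeasure lborel ((\<lambda>y. x - y) -` E) = (\<integral>\<^sup>+y. indicator ((\<lambda>y. x - y) -` E) y \<partial>lborel)"
      by simp
    then show "(\<integral>\<^sup>+y. indicator E (x - y) * indicator Q x \<partial>lborel) = emeasure lborel ((\<lambda>y. x - y) -` E) * indicator Q x"
      by (simp add: indicator_def nn_integral_multc)
  qed
  also have "\<dots> = emeasure lborel E"
    by (simp add: 2 nn_integral_cmult MQ)
  finally show ?thesis .
qed

section \<open>Energy of point configurations in Euclidean space\<close>

lemma cball_borel [measurable]: "cball (a :: 'a::metric_space) r \<in> sets borel"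
  by simp

text \<open>Polar coordinates for radial functions: both measures give a half-line
  \<open>{..a}\<close> the volume of the ball of radius a, which is the integral of its derivative
  in the radius.\<close>

lemma distr_norm_lborel:
  "distr lborel borel (norm :: real^'d::finite \<Rightarrow> real) =
     density lborel (\<lambda>u. ennreal (real CARD('d) * unit_ball_vol CARD('d) * u ^ (CARD('d) - 1)) * indicator {0..} u)"
    (is "?M = ?N")
proof (rule measure_eqI_generator_eq)
  let ?\<beta> = "unit_ball_vol CARD('d)"
  show "Int_stable (range (\<lambda>a::real. {..a}))" by (auto simp: Int_stable_def)
  show "range (\<lambda>a::real. {..a}) \<subseteq> Pow UNIV" by auto
  show "sets ?M = sigma_sets UNIV (range (\<lambda>a::real. {..a}))"
    by (simp add: borel_eq_atMost)
  show "sets ?N = sigma_sets UNIV (range (\<lambda>a::real. {..a}))"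
    by (simp add: borel_eq_atMost)
  show "range (\<lambda>n. {..real n}) \<subseteq> range (\<lambda>a::real. {..a})" by auto
  show "(\<Union>n. {..real n}) = UNIV" using real_arch_simple by auto
  have M: "emeasure ?M {..a} = (if a < 0 then 0 else ennreal (?\<beta> * a ^ CARD('d)))" for a
  proof -
    have "emeasure ?M {..a} = emeasure lborel (norm -` {..a} :: (real^'d) set)"
      by (simp add: emeasure_distr)
    also have "norm -` {..a} = (cball 0 a :: (real^'d) set)" by auto
    finally show ?thesis by (auto simp: emeasure_cball)
  qed
  show "emeasure ?M {..real n} \<noteq> \<infinity>" for n by (simp add: M)
  fix X assume "X \<in> range (\<lambda>a::real. {..a})"
  then obtain a where X: "X = {..a}" by auto
  have "emeasure ?N {..a} = (\<integral>\<^sup>+u. ennreal (real CARD('d) * ?\<beta> * u ^ (CARD('d) - 1)) * indicator {0..a} u \<partial>lborel)"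
    by (subst emeasure_density) (auto intro!: nn_integral_cong split: split_indicator)
  also have "\<dots> = (if a < 0 then 0 else ennreal (?\<beta> * a ^ CARD('d)))"
  proof (cases "a < 0")
    case False
    have "(\<integral>\<^sup>+u. ennreal (real CARD('d) * ?\<beta> * u ^ (CARD('d) - 1)) * indicator {0..a} u \<partial>lborel)
        = ennreal (?\<beta> * a ^ CARD('d) - ?\<beta> * 0 ^ CARD('d))"
      using False by (intro nn_integral_FTC_Icc) (auto intro!: derivative_eq_intros)
    then show ?thesis using False by (simp add: zero_power)
  qed auto
  finally show "emeasure ?M X = emeasure ?N X" by (simp add: X M)
qed

lemma nn_integral_norm:
  fixes g :: "real \<Rightarrow> ennreal"
  assumes [measurable]: "g \<in> borel_measurable borel"
  shows "(\<integral>\<^sup>+x. g (norm (x :: real^'d::finite)) \<partial>lborel) =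
    (\<integral>\<^sup>+u. ennreal (real CARD('d) * unit_ball_vol CARD('d) * u ^ (CARD('d) - 1)) * indicator {0..} u * g u \<partial>lborel)"
proof -
  have "(\<integral>\<^sup>+x. g (norm (x :: real^'d)) \<partial>lborel) = (\<integral>\<^sup>+u. g u \<partial>distr lborel borel (norm :: real^'d \<Rightarrow> real))"
    by (simp add: nn_integral_distr)
  then show ?thesis by (simp add: distr_norm_lborel nn_integral_density)
qed

section \<open>Ball overlaps and the Riesz kernel\<close>

text \<open>The Lipschitz bound is applied to g and to its inverse.\<close>

lemma hausdorff_outer_similarity:
  assumes "r > 0" and g: "\<And>x y. dist (g x) (g y) = r * dist x y"
  shows "hausdorff_outer d (g ` S) = ennreal (r ^ d) * hausdorff_outer d S"
proof (rule antisym)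
  show "hausdorff_outer d (g ` S) \<le> ennreal (r ^ d) * hausdorff_outer d S"
    by (rule hausdorff_outer_lipschitz_image) (use assms in auto)
  have inj: "inj g"
    using assms by (intro injI) (metis dist_eq_0_iff mult_eq_0_iff less_irrefl)
  have "hausdorff_outer d (inv g ` g ` S) \<le> ennreal ((1 / r) ^ d) * hausdorff_outer d (g ` S)"
    by (rule hausdorff_outer_lipschitz_image) (use assms inj in auto)
  then have "ennreal (r ^ d) * hausdorff_outer d S \<le> ennreal (r ^ d) * (ennreal ((1 / r) ^ d) * hausdorff_outer d (g ` S))"
    using inj by (intro mult_left_mono) (auto simp: image_image)
  also have "\<dots> = ennreal (r ^ d * (1 / r) ^ d) * hausdorff_outer d (g ` S)"
    using assms(1) by (simp add: ennreal_mult mult.assoc)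
  also have "r ^ d * (1 / r) ^ d = 1"
    using assms(1) by (simp flip: power_mult_distrib)
  finally show "ennreal (r ^ d) * hausdorff_outer d S \<le> hausdorff_outer d (g ` S)" by simp
qed

text \<open>The identification with Hausdorff measure gives the scaling from distances alone, with
  no need to know that g is affine or to compute a determinant.\<close>

lemma emeasure_lborel_similarity:
  fixes g :: "real^'d::finite \<Rightarrow> real^'d"
  assumes "r > 0" and g: "\<And>x y. dist (g x) (g y) = r * dist x y"
    and "S \<in> sets borel" "g ` S \<in> sets borel"
  shows "emeasure lborel (g ` S) = ennreal (r ^ CARD('d)) * emeasure lborel S"
  using assms hausdorff_outer_similarity[of r g "CARD('d)" S]
  by (simp flip: emeasure_hausdorff_measure_eq_lborel
      add: emeasure_hausdorff_measure ennreal_times_divide)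

definition ball_overlap :: "real \<Rightarrow> real^'d::finite \<Rightarrow> real^'d \<Rightarrow> ennreal" where
  "ball_overlap r a b = emeasure lborel (cball a r \<inter> cball b r)"

text \<open>By similarity invariance \<^const>\<open>ball_overlap\<close> is determined by its values for unit balls at
  distance \<open>u\<close>, for which a fixed direction can be used.\<close>

definition unit_overlap :: "'d::finite itself \<Rightarrow> real \<Rightarrow> ennreal" where
  "unit_overlap _ u = ball_overlap 1 (0 :: real^'d) (u *\<^sub>R axis undefined 1)"

lemma ball_overlap_eq:
  fixes a b :: "real^'d::finite"
  assumes r: "r > 0"
  shows "ball_overlap r a b = ennreal (r ^ CARD('d)) * unit_overlap TYPE('d) (dist a b / r)"
proof -
  define e where "e = (dist a b / r) *\<^sub>R (axis undefined 1 :: real^'d)"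
  have "norm e = norm ((1 / r) *\<^sub>R (b - a))"
    using r by (simp add: e_def dist_norm norm_minus_commute)
  then obtain f where f: "orthogonal_transformation f" "f e = (1 / r) *\<^sub>R (b - a)"
    using orthogonal_transformation_exists by blast
  \<comment> \<open>A rotation, then a scaling and a translation: g takes 0 to a, e to b, and unit
    balls to balls of radius r.\<close>
  define g where "g x = a + r *\<^sub>R f x" for x
  have lin: "linear f" using f(1) orthogonal_transformation_linear by blast
  have g0: "dist (g x) (g y) = r * dist x y" for x y
    using r f(1) by (simp add: g_def dist_norm orthogonal_transformation_norm
        flip: linear_diff[OF lin] scaleR_diff_right)
  have surj: "surj g"
  proof (rule surjI)
    fix y
    have "f (inv f z) = z" for z using orthogonal_transformation_surj[OF f(1)] by (simp add: surj_f_inv_f)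
    then show "g (inv f ((1 / r) *\<^sub>R (y - a))) = y" using r by (simp add: g_def)
  qed
  have inj: "inj g"
    using g0 r by (intro injI) (metis dist_eq_0_iff mult_eq_0_iff less_irrefl)
  have cb: "g ` cball x 1 = cball (g x) r" for x
  proof (intro set_eqI iffI)
    fix y assume "y \<in> cball (g x) r"
    moreover obtain z where "y = g z" using surj by blast
    ultimately show "y \<in> g ` cball x 1" using r by (auto simp: g0)
  qed (use r in \<open>auto simp: g0\<close>)
  have "g 0 = a" "g e = b" using r f(2) lin by (auto simp: g_def linear_0)
  then have im: "g ` (cball 0 1 \<inter> cball e 1) = cball a r \<inter> cball b r"
    by (simp add: image_Int[OF inj] cb)
  have "ball_overlap r a b = ennreal (r ^ CARD('d)) * emeasure lborel (cball 0 1 \<inter> cball e 1)"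
    unfolding ball_overlap_def im[symmetric]
    by (rule emeasure_lborel_similarity[OF r g0]) (auto simp: im)
  then show ?thesis by (simp add: unit_overlap_def ball_overlap_def e_def)
qed

lemma ball_overlap_nn_integral:
  "ball_overlap 1 0 (x :: real^'d::finite) = (\<integral>\<^sup>+y. indicator (cball 0 1) y * indicator (cball 0 1) (y - x) \<partial>lborel)"
proof -
  have "ball_overlap 1 0 x = (\<integral>\<^sup>+y. indicator (cball 0 1 \<inter> cball x 1) y \<partial>lborel)"
    by (simp add: ball_overlap_def)
  also have "\<dots> = (\<integral>\<^sup>+y. indicator (cball 0 1) y * indicator (cball 0 1) (y - x) \<partial>lborel)"
    by (intro nn_integral_cong) (auto simp: dist_norm norm_minus_commute split: split_indicator)
  finally show ?thesis .
qed

lemma borel_measurable_unit_overlap [measurable]: "unit_overlap TYPE('d::finite) \<in> borel_measurable borel"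
  unfolding unit_overlap_def[abs_def] ball_overlap_nn_integral by measurable

text \<open>The overlap is the convolution of two indicators of the unit ball, so its integral is
  the product of their integrals.\<close>

lemma nn_integral_ball_overlap:
  "(\<integral>\<^sup>+x. ball_overlap 1 0 (x :: real^'d::finite) \<partial>lborel) = ennreal (unit_ball_vol CARD('d) * unit_ball_vol CARD('d))"
proof -
  have "(\<integral>\<^sup>+x. ball_overlap 1 0 (x :: real^'d) \<partial>lborel) =
     (\<integral>\<^sup>+x. (\<integral>\<^sup>+y. indicator (cball 0 1) y * indicator (cball 0 1) (y - x) \<partial>lborel) \<partial>(lborel :: (real^'d) measure))"
    by (simp only: ball_overlap_nn_integral)
  also have "\<dots> = (\<integral>\<^sup>+y. (\<integral>\<^sup>+x. indicator (cball 0 1) y * indicator (cball 0 1) (y - x) \<partial>(lborel :: (real^'d) measure)) \<partial>lborel)"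
    by (rule lborel_pair.Fubini') measurable
  also have "\<dots> = (\<integral>\<^sup>+y. indicator (cball 0 1) y * ennreal (unit_ball_vol CARD('d)) \<partial>(lborel :: (real^'d) measure))"
  proof (rule nn_integral_cong)
    fix y :: "real^'d"
    have "(\<integral>\<^sup>+x. indicator (cball 0 1) y * indicator (cball 0 1) (y - x) \<partial>lborel) =
       indicator (cball 0 1) y * (\<integral>\<^sup>+x. indicator (cball y 1) x \<partial>lborel)"
    proof -
      have "indicator (cball 0 1) (y - x) = (indicator (cball y 1) x :: ennreal)" for x
        by (auto simp: dist_norm norm_minus_commute split: split_indicator)
      then show ?thesis by (subst nn_integral_cmult) (auto simp del: nn_integral_indicator)
    qed
    then show "(\<integral>\<^sup>+x. indicator (cball 0 1) y * indicator (cball 0 1) (y - x) \<partial>lborel) =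
      indicator (cball 0 1) y * ennreal (unit_ball_vol CARD('d))"
      by (simp add: emeasure_cball)
  qed
  also have "\<dots> = ennreal (unit_ball_vol CARD('d) * unit_ball_vol CARD('d))"
    by (simp add: nn_integral_multc emeasure_cball ennreal_mult)
  finally show ?thesis .
qed

text \<open>The preceding integral in polar coordinates, divided by the surface constant. This value
  becomes the factor between the kernel |x|^(-d) and the superposition of overlaps.\<close>

lemma nn_integral_unit_overlap:
  "(\<integral>\<^sup>+u. ennreal (u ^ (CARD('d) - 1)) * indicator {0..} u * unit_overlap TYPE('d::finite) u \<partial>lborel)
     = ennreal (unit_ball_vol CARD('d) / CARD('d))"
proof -
  let ?C = "\<integral>\<^sup>+u. ennreal (u ^ (CARD('d) - 1)) * indicator {0..} u * unit_overlap TYPE('d) u \<partial>lborel"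
  let ?\<beta> = "unit_ball_vol CARD('d)"
  have "ennreal (?\<beta> * ?\<beta>) = (\<integral>\<^sup>+x. unit_overlap TYPE('d) (norm (x :: real^'d)) \<partial>lborel)"
    by (simp add: ball_overlap_eq flip: nn_integral_ball_overlap)
  also have "\<dots> = (\<integral>\<^sup>+u. ennreal (real CARD('d) * ?\<beta> * u ^ (CARD('d) - 1)) * indicator {0..} u
      * unit_overlap TYPE('d) u \<partial>lborel)"
    by (rule nn_integral_norm) measurable
  also have "\<dots> = (\<integral>\<^sup>+u. ennreal (real CARD('d) * ?\<beta>) * (ennreal (u ^ (CARD('d) - 1)) * indicator {0..} u
      * unit_overlap TYPE('d) u) \<partial>lborel)"
    by (intro nn_integral_cong) (auto simp: ennreal_mult mult.assoc split: split_indicator)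
  also have "\<dots> = ennreal (real CARD('d) * ?\<beta>) * ?C"
    by (rule nn_integral_cmult) measurable
  finally have eq: "ennreal (real CARD('d) * ?\<beta>) * ?C = ennreal (?\<beta> * ?\<beta>)" ..
  also have "\<dots> = ennreal (real CARD('d) * ?\<beta>) * ennreal (?\<beta> / real CARD('d))"
    by (simp flip: ennreal_mult)
  finally show ?thesis
    by (subst (asm) ennreal_mult_cancel_left) (auto simp: less_imp_neq[symmetric] unit_ball_vol_pos ennreal_mult ennreal_mult_eq_top_iff)
qed

text \<open>The variable is v = 1 / r for the scale r. The overlap supplies a factor v^(-d), so the
  weight v^(2d-1) leaves v^(d-1) times a function of t v, where t is the distance. The substitution
  u = t v shows that the integral \<open>Z\<close> over all v \<ge> 0 is exactly t^(-d) times the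
  constant above; truncation only decreases it.\<close>

lemma truncated_riesz_le:
  fixes a b :: "real^'d::finite"
  assumes "0 < p" "a \<noteq> b"
  shows "(\<integral>\<^sup>+v. ennreal (v ^ (2 * CARD('d) - 1)) * ball_overlap (1 / v) a b * indicator {p..q} v \<partial>lborel)
    \<le> ennreal (unit_ball_vol CARD('d) / CARD('d)) * (1 / ennreal (dist a b ^ CARD('d)))" (is "?I \<le> _")
proof -
  let ?d = "CARD('d)" and ?h = "\<lambda>u. ennreal (u ^ (CARD('d) - 1)) * indicator {0..} u * unit_overlap TYPE('d) u"
  define t where "t = dist a b"
  have t: "t > 0" using assms by (simp add: t_def)
  have td: "t ^ ?d = t * t ^ (?d - 1)" by (metis card_UNIV_pos power_eq_if not_gr_zero)
  define Z where "Z = (\<integral>\<^sup>+v. ennreal (v ^ (?d - 1)) * indicator {0..} v * unit_overlap TYPE('d) (t * v) \<partial>lborel)"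
  have "?I \<le> Z"
    unfolding Z_def
  proof (intro nn_integral_mono)
    fix v :: real
    show "ennreal (v ^ (2 * ?d - 1)) * ball_overlap (1 / v) a b * indicator {p..q} v
       \<le> ennreal (v ^ (?d - 1)) * indicator {0..} v * unit_overlap TYPE('d) (t * v)"
    proof (cases "v \<in> {p..q}")
      case True
      then have v: "v > 0" using assms(1) by auto
      have "v ^ (2 * ?d - 1) = v ^ (?d - 1) * v ^ ?d"
        using card_UNIV_pos[where 'd='d] by (subst power_add[symmetric]) (intro arg_cong2[where f=power], auto)
      then have "v ^ (2 * ?d - 1) * (1 / v) ^ ?d = v ^ (?d - 1)"
        using v by (simp add: power_divide)
      then have "ennreal (v ^ (2 * ?d - 1)) * ennreal ((1 / v) ^ ?d) = ennreal (v ^ (?d - 1))"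
        using v by (simp flip: ennreal_mult)
      then show ?thesis using v True by (simp add: ball_overlap_eq t_def mult.assoc[symmetric] mult.commute[of v])
    qed auto
  qed
  moreover have "ennreal (t ^ ?d) * Z = ennreal (unit_ball_vol ?d / ?d)"
  proof -
    have "ennreal (unit_ball_vol ?d / ?d) = (\<integral>\<^sup>+u. ?h u \<partial>lborel)" by (rule nn_integral_unit_overlap[symmetric])
    also have "\<dots> = ennreal \<bar>t\<bar> * (\<integral>\<^sup>+v. ?h (0 + t * v) \<partial>lborel)"
      using t by (intro nn_integral_real_affine) auto
    also have "(\<integral>\<^sup>+v. ?h (0 + t * v) \<partial>lborel) = (\<integral>\<^sup>+v. ennreal (t ^ (?d - 1)) *
        (ennreal (v ^ (?d - 1)) * indicator {0..} v * unit_overlap TYPE('d) (t * v)) \<partial>lborel)"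
      using t by (intro nn_integral_cong)
        (auto simp: power_mult_distrib ennreal_mult mult.assoc zero_le_mult_iff split: split_indicator)
    also have "\<dots> = ennreal (t ^ (?d - 1)) * Z"
      unfolding Z_def by (rule nn_integral_cmult) measurable
    finally show ?thesis using t by (simp add: td ennreal_mult mult.assoc)
  qed
  then have "Z = ennreal (unit_ball_vol ?d / ?d) * (1 / ennreal (t ^ ?d))"
    using t by (metis (no_types) ennreal_mult_divide_eq ennreal_times_divide mult.commute mult.right_neutral ennreal_eq_0_iff
        ennreal_neq_top not_le zero_less_power)
  ultimately show ?thesis by (simp add: t_def)
qed

text \<open>Meant for a = b, where the kernel is infinite: cutting off scales below 1 / q keeps the
  diagonal terms finite. The overlap is bounded by the volume of one ball.\<close>

lemma truncated_riesz_diag_le: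
  fixes a b :: "real^'d::finite"
  assumes "0 < p" "p \<le> q"
  shows "(\<integral>\<^sup>+v. ennreal (v ^ (2 * CARD('d) - 1)) * ball_overlap (1 / v) a b * indicator {p..q} v \<partial>lborel)
    \<le> ennreal (unit_ball_vol CARD('d) / CARD('d) * q ^ CARD('d))" (is "?I \<le> _")
proof -
  let ?d = "CARD('d)" and ?\<beta> = "unit_ball_vol CARD('d)"
  have "?I
      \<le> (\<integral>\<^sup>+v. ennreal (?\<beta> * v ^ (?d - 1)) * indicator {0..q} v \<partial>lborel)"
  proof (intro nn_integral_mono)
    fix v :: real
    show "ennreal (v ^ (2 * ?d - 1)) * ball_overlap (1 / v) a b * indicator {p..q} v
       \<le> ennreal (?\<beta> * v ^ (?d - 1)) * indicator {0..q} v"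
    proof (cases "v \<in> {p..q}")
      case True
      then have v: "v > 0" using assms(1) by auto
      have "v ^ (2 * ?d - 1) = v ^ (?d - 1) * v ^ ?d"
        using card_UNIV_pos[where 'd='d] by (subst power_add[symmetric]) (intro arg_cong2[where f=power], auto)
      then have eq: "v ^ (2 * ?d - 1) * (?\<beta> * (1 / v) ^ ?d) = ?\<beta> * v ^ (?d - 1)"
        using v by (simp add: power_divide)
      have "ball_overlap (1 / v) a b \<le> emeasure lborel (cball a (1 / v))"
        unfolding ball_overlap_def by (intro emeasure_mono) auto
      also have "\<dots> = ennreal (?\<beta> * (1 / v) ^ ?d)" using v by (simp add: emeasure_cball)
      finally have "ennreal (v ^ (2 * ?d - 1)) * ball_overlap (1 / v) a b
         \<le> ennreal (v ^ (2 * ?d - 1)) * ennreal (?\<beta> * (1 / v) ^ ?d)" by (intro mult_left_mono) auto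
      also have "\<dots> = ennreal (v ^ (2 * ?d - 1) * (?\<beta> * (1 / v) ^ ?d))"
        using v by (intro ennreal_mult[symmetric]) auto
      finally show ?thesis using v True unfolding eq by simp
    qed auto
  qed
  also have "\<dots> = ennreal (?\<beta> / ?d * q ^ ?d - ?\<beta> / ?d * 0 ^ ?d)"
    using assms by (intro nn_integral_FTC_Icc) (auto intro!: derivative_eq_intros)
  finally show ?thesis by (simp add: zero_power)
qed

text \<open>The Riesz kernel dominates a superposition over scales of the positive definite kernels
  \<^const>\<open>ball_overlap\<close>; at each scale the Cauchy--Schwarz inequality bounds the energy from below.\<close>

lemma euclidean_energy_lower_bound:
  fixes a :: "'i \<Rightarrow> real^'d::finite"
  assumes I: "finite I" and pq: "0 < p" "p \<le> q"
    and S: "S \<in> sets borel" "emeasure lborel S \<le> ennreal V" "\<And>i. i \<in> I \<Longrightarrow> cball (a i) (1 / p) \<subseteq> S"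
    and V: "V > 0"
  shows "ennreal ((real (card I))\<^sup>2 * (real CARD('d) * unit_ball_vol CARD('d) * ln (q / p)) / V)
    \<le> (\<Sum>i\<in>I. \<Sum>j\<in>I - {i}. 1 / ennreal (dist (a i) (a j) ^ CARD('d))) + ennreal (real (card I) * q ^ CARD('d))"
proof -
  let ?d = "CARD('d)" and ?\<beta> = "unit_ball_vol CARD('d)" and ?n = "real (card I)"
  let ?T = "\<lambda>i j. \<integral>\<^sup>+v. ennreal (v ^ (2 * ?d - 1)) * ball_overlap (1 / v) (a i) (a j) * indicator {p..q} v \<partial>lborel"
  have \<beta>: "?\<beta> > 0" by simp
  have scale: "ennreal ((?n * ?\<beta> * (1 / v) ^ ?d)\<^sup>2) \<le> ennreal V * (\<Sum>i\<in>I. \<Sum>j\<in>I. ball_overlap (1 / v) (a i) (a j))"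
    if v: "v \<in> {p..q}" for v
  proof -
    have v0: "v > 0" using v pq by auto
    \<comment> \<open>f counts the balls that contain x. Its integral is the sum of their volumes,
      the integral of its square is the sum of all overlaps, and it vanishes off S, whose volume is
      at most V.\<close>
    define f where "f x = (\<Sum>i\<in>I. indicator (cball (a i) (1 / v)) x :: ennreal)" for x
    have [measurable]: "f \<in> borel_measurable lborel" unfolding f_def by measurable
    have fS: "f x * indicator S x = f x" for x
    proof (cases "x \<in> S")
      case False
      have "1 / v \<le> 1 / p" using v pq by (simp add: frac_le)
      then have "cball (a i) (1 / v) \<subseteq> S" if "i \<in> I" for i
        using S(3)[OF that] by (meson dual_order.trans subset_cball)
      then have "indicator (cball (a i) (1 / v)) x = (0 :: ennreal)" if "i \<in> I" for i
        using False that by (metis indicator_simps(2) subsetD)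
      then have "f x = 0" unfolding f_def by simp
      then show ?thesis by simp
    qed auto
    have "(\<integral>\<^sup>+x. f x \<partial>lborel) = (\<Sum>i\<in>I. emeasure lborel (cball (a i) (1 / v)))"
      unfolding f_def by (subst nn_integral_sum) auto
    also have "\<dots> = ennreal (?n * ?\<beta> * (1 / v) ^ ?d)"
      using v0 by (simp add: emeasure_cball ennreal_of_nat_eq_real_of_nat mult.assoc flip: ennreal_mult)
    finally have int1: "(\<integral>\<^sup>+x. f x \<partial>lborel) = ennreal (?n * ?\<beta> * (1 / v) ^ ?d)" .
    have f2: "f x ^ 2 = (\<Sum>i\<in>I. \<Sum>j\<in>I. indicator (cball (a i) (1 / v) \<inter> cball (a j) (1 / v)) x)" for x
      by (simp add: f_def power2_eq_square sum_product indicator_inter_arith)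
    have int2: "(\<integral>\<^sup>+x. f x ^ 2 \<partial>lborel) = (\<Sum>i\<in>I. \<Sum>j\<in>I. ball_overlap (1 / v) (a i) (a j))"
      unfolding f2 ball_overlap_def by (subst nn_integral_sum, simp, subst nn_integral_sum) auto
    have "ennreal ((?n * ?\<beta> * (1 / v) ^ ?d)\<^sup>2) = (\<integral>\<^sup>+x. f x * indicator S x \<partial>lborel)\<^sup>2"
      using v0 \<beta> unfolding fS int1 by (simp add: ennreal_power)
    also have "\<dots> \<le> (\<integral>\<^sup>+x. f x ^ 2 \<partial>lborel) * (\<integral>\<^sup>+x. indicator S x ^ 2 \<partial>lborel)"
      using S(1) by (intro Cauchy_Schwarz_nn_integral) auto
    also have "\<dots> \<le> (\<integral>\<^sup>+x. f x ^ 2 \<partial>lborel) * ennreal V"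
    proof (rule mult_left_mono)
      have "(\<integral>\<^sup>+x. indicator S x ^ 2 \<partial>(lborel :: (real^'d) measure)) = (\<integral>\<^sup>+x. indicator S x \<partial>lborel)"
        by (intro nn_integral_cong) (auto split: split_indicator)
      then show "(\<integral>\<^sup>+x. indicator S x ^ 2 \<partial>(lborel :: (real^'d) measure)) \<le> ennreal V" using S by simp
    qed simp
    finally show ?thesis unfolding int2 by (simp add: mult.commute)
  qed
  have meas[measurable]: "(\<lambda>v. ball_overlap (1 / v) (a i) (a j) * indicator {p..q} v) \<in> borel_measurable borel" for i j
  proof -
    have eq: "(\<lambda>v. ball_overlap (1 / v) (a i) (a j) * indicator {p..q} v) =
       (\<lambda>v. ennreal ((1 / v) ^ ?d) * unit_overlap TYPE('d) (dist (a i) (a j) * v) * indicator {p..q} v)"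
      using pq by (auto simp: ball_overlap_eq fun_eq_iff split: split_indicator)
    show ?thesis unfolding eq by measurable
  qed
  have meas': "(\<lambda>v. ennreal (v ^ (2 * ?d - 1)) * ball_overlap (1 / v) (a i) (a j) * indicator {p..q} v)
      \<in> borel_measurable lborel" for i j
    unfolding mult.assoc by measurable
  \<comment> \<open>The weight turns the lower bound at scale 1 / v into a multiple of 1 / v, whose
    integral over [p, q] is ln (q / p).\<close>
  have "(\<integral>\<^sup>+v. ennreal (?n\<^sup>2 * ?\<beta>\<^sup>2 * (1 / v)) * indicator {p..q} v \<partial>lborel)
     \<le> (\<integral>\<^sup>+v. ennreal V * (\<Sum>i\<in>I. \<Sum>j\<in>I. ennreal (v ^ (2 * ?d - 1)) * ball_overlap (1 / v) (a i) (a j) * indicator {p..q} v) \<partial>lborel)"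
  proof (intro nn_integral_mono)
    fix v :: real
    show "ennreal (?n\<^sup>2 * ?\<beta>\<^sup>2 * (1 / v)) * indicator {p..q} v
      \<le> ennreal V * (\<Sum>i\<in>I. \<Sum>j\<in>I. ennreal (v ^ (2 * ?d - 1)) * ball_overlap (1 / v) (a i) (a j) * indicator {p..q} v)"
    proof (cases "v \<in> {p..q}")
      case True
      then have v: "v > 0" using pq by auto
      have "v * v ^ (2 * ?d - 1) = v ^ (2 * ?d)"
        using card_UNIV_pos[where 'd='d] by (simp add: power_eq_if)
      then have "v ^ (2 * ?d - 1) * (?n * ?\<beta> * (1 / v) ^ ?d)\<^sup>2 = ?n\<^sup>2 * ?\<beta>\<^sup>2 * (1 / v)"
        using v by (simp add: power_mult_distrib power_divide field_simps flip: power_mult)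
      then have "ennreal (?n\<^sup>2 * ?\<beta>\<^sup>2 * (1 / v)) = ennreal (v ^ (2 * ?d - 1)) * ennreal ((?n * ?\<beta> * (1 / v) ^ ?d)\<^sup>2)"
        using v by (metis ennreal_mult less_imp_le zero_le_power zero_le_power2)
      also have "\<dots> \<le> ennreal (v ^ (2 * ?d - 1)) * (ennreal V * (\<Sum>i\<in>I. \<Sum>j\<in>I. ball_overlap (1 / v) (a i) (a j)))"
        by (intro mult_left_mono scale True) auto
      also have "\<dots> = ennreal V * (\<Sum>i\<in>I. \<Sum>j\<in>I. ennreal (v ^ (2 * ?d - 1)) * ball_overlap (1 / v) (a i) (a j))"
        by (simp add: sum_distrib_left mult.left_commute)
      finally show ?thesis using True by simp
    qed auto
  qed
  also have "\<dots> = ennreal V * (\<Sum>i\<in>I. \<Sum>j\<in>I. ?T i j)"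
  proof -
    have m: "(\<lambda>v. \<Sum>i\<in>I. \<Sum>j\<in>I. ennreal (v ^ (2 * ?d - 1)) * ball_overlap (1 / v) (a i) (a j) * indicator {p..q} v)
        \<in> borel_measurable lborel"
      by (intro borel_measurable_sum meas')
    show ?thesis
      by (simp only: nn_integral_cmult[OF m] nn_integral_sum borel_measurable_sum meas')
  qed
  also have "(\<integral>\<^sup>+v. ennreal (?n\<^sup>2 * ?\<beta>\<^sup>2 * (1 / v)) * indicator {p..q} v \<partial>lborel)
      = ennreal (?n\<^sup>2 * ?\<beta>\<^sup>2 * ln q - ?n\<^sup>2 * ?\<beta>\<^sup>2 * ln p)"
    using pq by (intro nn_integral_FTC_Icc) (auto intro!: derivative_eq_intros)
  also have "?n\<^sup>2 * ?\<beta>\<^sup>2 * ln q - ?n\<^sup>2 * ?\<beta>\<^sup>2 * ln p = ?n\<^sup>2 * ?\<beta>\<^sup>2 * ln (q / p)"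
    using pq by (simp add: ln_div algebra_simps)
  finally have main: "ennreal (?n\<^sup>2 * ?\<beta>\<^sup>2 * ln (q / p)) \<le> ennreal V * (\<Sum>i\<in>I. \<Sum>j\<in>I. ?T i j)" .
  let ?E = "\<Sum>i\<in>I. \<Sum>j\<in>I - {i}. 1 / ennreal (dist (a i) (a j) ^ ?d)"
  \<comment> \<open>This includes distinct indices with coinciding points, for which the right side
    is \<infinity>.\<close>
  have off: "?T i j \<le> ennreal (?\<beta> / ?d) * (1 / ennreal (dist (a i) (a j) ^ ?d))" for i j
  proof (cases "a i = a j")
    case True
    then show ?thesis using less_imp_neq[OF \<beta>] by (simp add: zero_power ennreal_mult_top)
  next
    case False
    then show ?thesis by (rule truncated_riesz_le[OF pq(1)])
  qed
  have "(\<Sum>i\<in>I. \<Sum>j\<in>I. ?T i j) = (\<Sum>i\<in>I. ?T i i + (\<Sum>j\<in>I - {i}. ?T i j))"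
    using I by (intro sum.cong refl sum.remove) auto
  also have "\<dots> \<le> (\<Sum>i\<in>I. ennreal (?\<beta> / ?d * q ^ ?d) + (\<Sum>j\<in>I - {i}. ennreal (?\<beta> / ?d) * (1 / ennreal (dist (a i) (a j) ^ ?d))))"
    by (intro sum_mono add_mono off truncated_riesz_diag_le pq)
  also have "\<dots> = ennreal (?\<beta> / ?d) * ?E + of_nat (card I) * ennreal (?\<beta> / ?d * q ^ ?d)"
    by (simp add: sum.distrib sum_distrib_left add.commute)
  also have "of_nat (card I) * ennreal (?\<beta> / ?d * q ^ ?d) = ennreal (?\<beta> / ?d) * ennreal (?n * q ^ ?d)"
    using pq \<beta> by (simp add: ennreal_of_nat_eq_real_of_nat mult_ac flip: ennreal_mult)
  finally have "(\<Sum>i\<in>I. \<Sum>j\<in>I. ?T i j) \<le> ennreal (?\<beta> / ?d) * (?E + ennreal (?n * q ^ ?d))"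
    by (simp add: distrib_left)
  then have main2: "ennreal (?n\<^sup>2 * ?\<beta>\<^sup>2 * ln (q / p)) \<le> ennreal V * (ennreal (?\<beta> / ?d) * (?E + ennreal (?n * q ^ ?d)))"
    using main by (meson mult_left_mono order_trans zero_le)
  \<comment> \<open>Chosen to cancel the factor V \<beta> / d in front of the energy.\<close>
  define c where "c = real ?d / (V * ?\<beta>)"
  have c: "c > 0" using V \<beta> by (simp add: c_def)
  have "ennreal (?n\<^sup>2 * (real ?d * ?\<beta> * ln (q / p)) / V) = ennreal (c * (?n\<^sup>2 * ?\<beta>\<^sup>2 * ln (q / p)))"
    using \<beta> by (simp add: c_def power2_eq_square field_simps)
  also have "\<dots> = ennreal c * ennreal (?n\<^sup>2 * ?\<beta>\<^sup>2 * ln (q / p))"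
    using c pq by (intro ennreal_mult) (auto simp: ln_ge_zero)
  also have "\<dots> \<le> ennreal c * (ennreal V * (ennreal (?\<beta> / ?d) * (?E + ennreal (?n * q ^ ?d))))"
    by (intro mult_left_mono main2) auto
  also have "\<dots> = ennreal (c * V * (?\<beta> / ?d)) * (?E + ennreal (?n * q ^ ?d))"
  proof -
    have "ennreal (c * V * (?\<beta> / ?d)) = ennreal c * ennreal V * ennreal (?\<beta> / ?d)"
      using c V \<beta> by (simp only: ennreal_mult mult_nonneg_nonneg less_imp_le divide_nonneg_nonneg of_nat_0_le_iff)
    then show ?thesis by (simp only: mult.assoc)
  qed
  also have "c * V * (?\<beta> / ?d) = 1" using V less_imp_neq[OF \<beta>] by (simp add: c_def)
  finally show ?thesis by simp
qed


section \<open>Almost isometric pieces\<close>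

text \<open>The map \<open>\<psi>\<close> is the orthogonal projection onto the tangent space at \<open>y\<close>, identified isometrically
  with \<open>\<real>\<^sup>d\<close>.\<close>

lemma C1_manifold_chart:
  fixes W :: "(real^'m) set"
  assumes W: "C1_manifold TYPE('d::finite) W" and y: "y \<in> W" and e: "e > 0"
  obtains \<rho> and \<psi> :: "real^'m \<Rightarrow> real^'d"
  where "\<rho> > 0" "linear \<psi>" "\<And>x. norm (\<psi> x) \<le> norm x"
    "\<And>x x'. x \<in> W \<inter> ball y \<rho> \<Longrightarrow> x' \<in> W \<inter> ball y \<rho> \<Longrightarrow> norm (x - x') \<le> (1 + e) * norm (\<psi> x - \<psi> x')"
proof -
  obtain V and U :: "(real^'d) set" and f g and J :: "real^'d \<Rightarrow> real^'d^'m"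
    where V: "openin (top_of_set W) V" "y \<in> V" and U: "open U" and hom: "homeomorphism U V f g"
      and der: "\<And>x. x \<in> U \<Longrightarrow> (f has_derivative (\<lambda>h. J x *v h)) (at x)"
      and J: "continuous_on U J" "\<And>x. x \<in> U \<Longrightarrow> rank (J x) = CARD('d)"
    using W y unfolding C1_manifold_def by metis
  define u where "u = g y"
  have u: "u \<in> U" "f u = y" using hom V(2) by (auto simp: u_def homeomorphism_def)
  let ?T = "range ((*v) (J u))"
  have "inj ((*v) (J u))" using J(2)[OF u(1)] full_rank_injective by blast
  then obtain B where B: "B > 0" "\<And>h. B * norm h \<le> norm (J u *v h)"
    using linear_inj_bounded_below_pos[OF matrix_vector_mul_linear] by metis
  have "dim (UNIV :: (real^'d) set) = dim ?T"
    using J(2)[OF u(1)] by (simp add: rank_dim_range dim_UNIV)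
  then obtain q :: "real^'d \<Rightarrow> real^'m" where q: "linear q" "q ` UNIV = ?T" "\<And>x. norm (q x) = norm x"
    using isometries_subspaces[of "UNIV :: (real^'d) set" ?T]
    by (metis UNIV_I linear_subspace_image matrix_vector_mul_linear subspace_UNIV)
  \<comment> \<open>The adjoint of an isometric embedding is a left inverse of it and does not
    increase norms.\<close>
  define \<psi> where "\<psi> = adjoint q"
  have lin: "linear \<psi>" unfolding \<psi>_def by (rule adjoint_linear[OF q(1)])
  have \<psi>_norm: "norm (\<psi> x) \<le> norm x" for x
  proof (cases "norm (\<psi> x) = 0")
    case False
    have "norm (\<psi> x) ^ 2 = q (\<psi> x) \<bullet> x"
      using adjoint_works[OF q(1), of "\<psi> x" x] by (simp add: \<psi>_def power2_norm_eq_inner)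
    also have "\<dots> \<le> norm (\<psi> x) * norm x" using norm_cauchy_schwarz[of "q (\<psi> x)" x] by (simp add: q(3))
    finally show ?thesis using False by (simp add: power2_eq_square)
  qed simp
  have \<psi>q: "\<psi> (q h) = h" for h
  proof -
    have ip: "q x \<bullet> q z = x \<bullet> z" for x z
    proof -
      have "norm (q x + q z) = norm (x + z)" using q(3)[of "x + z"] by (simp add: linear_add[OF q(1)])
      then show ?thesis by (simp add: dot_norm q(3))
    qed
    have "x \<bullet> \<psi> (q h) = x \<bullet> h" for x
      unfolding \<psi>_def by (simp add: adjoint_works[OF q(1)] ip)
    then show ?thesis by (metis vector_eq_ldot)
  qed
  have \<psi>J: "norm (\<psi> (J u *v h)) = norm (J u *v h)" for h
  proof -
    obtain z where "J u *v h = q z" using q(2) by (metis rangeE rangeI)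
    then show ?thesis by (simp add: \<psi>q q(3))
  qed
  \<comment> \<open>\<eta> is the relative error allowed in replacing an increment of f by its
    linear part z. The increment has norm at most (1 + \<eta>) |z| and its projection at least (1 -
    \<eta>) |z|; this \<eta> makes the quotient of the two exactly 1 + e.\<close>
  define \<eta> where "\<eta> = e / (2 + e)"
  have \<eta>: "0 < \<eta>" "\<eta> < 1" "1 + \<eta> = (1 + e) * (1 - \<eta>)"
    using e by (auto simp: \<eta>_def field_simps)
  \<comment> \<open>The number of matrix entries, which is the price of bounding the operator norm
    by the largest entry.\<close>
  define K where "K = real CARD('m) * real CARD('d)"
  have K: "K > 0" by (simp add: K_def)
  obtain s where s: "s > 0" "ball u s \<subseteq> U" using U u(1) open_contains_ball by blast
  have "continuous (at u) J"
    using J(1) U u(1) continuous_on_eq_continuous_at by blast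
  moreover have "0 < \<eta> * B / K" using \<eta> B K by simp
  ultimately obtain t where t: "t > 0" "\<And>x. dist x u < t \<Longrightarrow> dist (J x) (J u) < \<eta> * B / K"
    unfolding continuous_at_eps_delta by blast
  define r where "r = min s t"
  have r: "r > 0" "ball u r \<subseteq> U" using s t by (auto simp: r_def)
  have Jr: "norm (J x - J u) \<le> \<eta> * B / K" if "x \<in> ball u r" for x
    using t(2)[of x] that by (auto simp: r_def dist_norm norm_minus_commute)
  have onorm: "onorm ((\<lambda>h. J x *v h) - (\<lambda>h. J u *v h)) \<le> \<eta> * B" if "x \<in> ball u r" for x
  proof -
    have "(\<lambda>h. J x *v h) - (\<lambda>h. J u *v h) = (*v) (J x - J u)"
      by (auto simp: fun_eq_iff matrix_vector_mult_diff_rdistrib)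
    moreover have "\<bar>(J x - J u) $ i $ j\<bar> \<le> \<eta> * B / K" for i j
      using Jr[OF that] component_le_norm_cart[of "(J x - J u) $ i" j] Finite_Cartesian_Product.norm_nth_le[of "J x - J u" i]
      by linarith
    ultimately have "onorm ((\<lambda>h. J x *v h) - (\<lambda>h. J u *v h)) \<le> real CARD('m) * real CARD('d) * (\<eta> * B / K)"
      using onorm_le_matrix_component[of "J x - J u" "\<eta> * B / K"] by simp
    then show ?thesis using K by (simp add: K_def)
  qed
  have est: "norm (f b - f a) \<le> (1 + e) * norm (\<psi> (f b) - \<psi> (f a))" if ab: "a \<in> ball u r" "b \<in> ball u r" for a b
  proof -
    have "norm (f b - f a - J u *v (b - a)) \<le> norm (b - a) * (\<eta> * B)"
    proof (rule differentiable_bound_linearization[where f' = "\<lambda>x h. J x *v h" and S = "ball u r" and ?x0.0 = u])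
      fix t :: real assume "t \<in> {0..1}"
      then have "a + t *\<^sub>R (b - a) = (1 - t) *\<^sub>R a + t *\<^sub>R b" "t \<ge> 0" "t \<le> 1"
        by (auto simp: algebra_simps)
      then show "a + t *\<^sub>R (b - a) \<in> ball u r"
        using convex_ball[of u r] ab by (auto simp: convex_alt)
    next
      fix x assume "x \<in> ball u r"
      then show "(f has_derivative (\<lambda>h. J x *v h)) (at x within ball u r)"
        using der r(2) has_derivative_at_withinI by blast
    qed (use onorm r(1) in auto)
    also have "\<dots> \<le> \<eta> * norm (J u *v (b - a))"
      using mult_left_mono[OF B(2)[of "b - a"], of \<eta>] \<eta> by (simp add: mult_ac)
    finally have err: "norm (f b - f a - J u *v (b - a)) \<le> \<eta> * norm (J u *v (b - a))" .
    define z where "z = J u *v (b - a)"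
    define w where "w = f b - f a - z"
    have w: "norm w \<le> \<eta> * norm z" "f b - f a = z + w" using err by (simp_all add: z_def w_def)
    have "norm (f b - f a) \<le> (1 + \<eta>) * norm z"
      unfolding w(2) using norm_triangle_ineq[of z w] w(1) by (simp add: algebra_simps)
    also have "\<dots> = (1 + e) * ((1 - \<eta>) * norm z)" by (simp add: \<eta>(3))
    also have "\<dots> \<le> (1 + e) * norm (\<psi> (f b) - \<psi> (f a))"
    proof (rule mult_left_mono)
      have "\<psi> (f b) - \<psi> (f a) = \<psi> z + \<psi> w"
        using w(2) by (simp flip: linear_diff[OF lin] linear_add[OF lin])
      moreover have "norm (\<psi> z) = norm z" by (simp add: z_def \<psi>J)
      moreover have "norm (\<psi> z) \<le> norm (\<psi> z + \<psi> w) + norm (\<psi> w)"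
        by (metis add_diff_cancel_right' norm_triangle_ineq4)
      ultimately show "(1 - \<eta>) * norm z \<le> norm (\<psi> (f b) - \<psi> (f a))"
        using \<psi>_norm[of w] w(1) by (simp add: algebra_simps)
    qed (use e in auto)
    finally show ?thesis .
  qed
  have "openin (top_of_set V) (V \<inter> g -` ball u r)"
    using hom by (intro continuous_openin_preimage_gen) (auto simp: homeomorphism_def)
  then have "openin (top_of_set W) (V \<inter> g -` ball u r)"
    using V(1) openin_trans by blast
  moreover have "y \<in> V \<inter> g -` ball u r" using V(2) r(1) by (simp add: u_def)
  ultimately obtain \<rho> where \<rho>: "\<rho> > 0" "ball y \<rho> \<inter> W \<subseteq> V \<inter> g -` ball u r"
    by (meson openin_contains_ball)
  show ?thesis
  proof (rule that[OF \<rho>(1) lin \<psi>_norm])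
    fix x x' assume "x \<in> W \<inter> ball y \<rho>" "x' \<in> W \<inter> ball y \<rho>"
    then have "x \<in> V" "x' \<in> V" "g x \<in> ball u r" "g x' \<in> ball u r" using \<rho>(2) by auto
    then show "norm (x - x') \<le> (1 + e) * norm (\<psi> x - \<psi> x')"
      using est[of "g x'" "g x"] hom by (auto simp: homeomorphism_def)
  qed
qed


section \<open>Almost isometries and measure\<close>

text \<open>Contraction is required on the whole space and not only on P, so that a ball with an
  arbitrary centre projects into a ball of the same radius;
  \<open>upper_regular_compact_subset\<close> relies on this.\<close>

definition almost_isometry :: "real \<Rightarrow> (real^'m \<Rightarrow> real^'d) \<Rightarrow> (real^'m) set \<Rightarrow> bool" where
  "almost_isometry e \<psi> P \<longleftrightarrow> linear \<psi> \<and> (\<forall>x. norm (\<psi> x) \<le> norm x) \<and>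
     (\<forall>x\<in>P. \<forall>y\<in>P. norm (x - y) \<le> (1 + e) * norm (\<psi> x - \<psi> y))"

lemma almost_isometry_subset: "almost_isometry e \<psi> P \<Longrightarrow> Q \<subseteq> P \<Longrightarrow> almost_isometry e \<psi> Q"
  unfolding almost_isometry_def by blast

lemma almost_isometry_inj_on: "almost_isometry e \<psi> P \<Longrightarrow> inj_on \<psi> P"
  unfolding almost_isometry_def by (intro inj_onI) fastforce

lemma almost_isometry_dist:
  "almost_isometry e \<psi> P \<Longrightarrow> dist (\<psi> x) (\<psi> y) \<le> dist x y"
  unfolding almost_isometry_def dist_norm by (metis linear_diff)

lemma almost_isometry_continuous_on: "almost_isometry e \<psi> P \<Longrightarrow> continuous_on S \<psi>"
  by (simp add: almost_isometry_def linear_continuous_on linear_linear)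

lemma emeasure_lborel_almost_isometry_le:
  fixes \<psi> :: "real^'m \<Rightarrow> real^'d::finite"
  assumes "almost_isometry e \<psi> Q" "P \<in> sets borel" "\<psi> ` P \<in> sets borel"
  shows "emeasure lborel (\<psi> ` P) \<le> emeasure (hausdorff_measure TYPE('d)) P"
proof -
  have "hausdorff_outer CARD('d) (\<psi> ` P) \<le> ennreal (1 ^ CARD('d)) * hausdorff_outer CARD('d) P"
    by (rule hausdorff_outer_lipschitz_image) (use almost_isometry_dist[OF assms(1)] in auto)
  then show ?thesis
    using assms by (simp add: emeasure_hausdorff_measure divide_right_mono_ennreal
        flip: emeasure_hausdorff_measure_eq_lborel)
qed

text \<open>The inverse of \<psi> on P is (1 + e)-Lipschitz. Measuring a Borel superset S of the
  image avoids the question whether the image itself is Borel.\<close>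

lemma emeasure_almost_isometry_le:
  fixes \<psi> :: "real^'m \<Rightarrow> real^'d::finite"
  assumes e: "e \<ge> 0" and \<psi>: "almost_isometry e \<psi> P" and P: "P \<in> sets borel"
    and S: "S \<in> sets borel" "\<psi> ` P \<subseteq> S"
  shows "emeasure (hausdorff_measure TYPE('d)) P \<le> ennreal ((1 + e) ^ CARD('d)) * emeasure lborel S"
proof -
  have inj: "inj_on \<psi> P" using almost_isometry_inj_on[OF \<psi>] .
  have "P = inv_into P \<psi> ` \<psi> ` P" using inj by (simp add: inv_into_image_cancel)
  then have "hausdorff_outer CARD('d) P = hausdorff_outer CARD('d) (inv_into P \<psi> ` \<psi> ` P)" by simp
  also have "\<dots> \<le> ennreal ((1 + e) ^ CARD('d)) * hausdorff_outer CARD('d) (\<psi> ` P)"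
  proof (rule hausdorff_outer_lipschitz_image)
    fix x y assume "x \<in> \<psi> ` P" "y \<in> \<psi> ` P"
    then obtain x' y' where "x' \<in> P" "y' \<in> P" "x = \<psi> x'" "y = \<psi> y'" by blast
    then show "dist (inv_into P \<psi> x) (inv_into P \<psi> y) \<le> (1 + e) * dist x y"
      using inj \<psi> by (simp add: almost_isometry_def dist_norm)
  qed (use e in simp)
  also have "\<dots> \<le> ennreal ((1 + e) ^ CARD('d)) * hausdorff_outer CARD('d) S"
    by (intro mult_left_mono hausdorff_outer_mono S) simp
  finally have "hausdorff_outer CARD('d) P / hausdorff_unit TYPE('d)
      \<le> ennreal ((1 + e) ^ CARD('d)) * hausdorff_outer CARD('d) S / hausdorff_unit TYPE('d)"
    by (rule divide_right_mono_ennreal)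
  then show ?thesis
    using P S(1) by (simp add: emeasure_hausdorff_measure ennreal_times_divide
        flip: emeasure_hausdorff_measure_eq_lborel)
qed

lemma outer_open_lborel:
  assumes B: "B \<in> sets borel" and \<epsilon>: "\<epsilon> > 0"
  shows "\<exists>G. open G \<and> B \<subseteq> G \<and> emeasure lborel G \<le> emeasure lborel B + ennreal \<epsilon>"
proof -
  obtain G where G: "open G" "B \<subseteq> G" "emeasure lborel (G - B) < \<epsilon>"
    by (rule outer_regular_lborel[OF B \<epsilon>]) (rule that; assumption)
  have "emeasure lborel G = emeasure lborel (B \<union> (G - B))"
    using G(2) by (simp add: Un_absorb1)
  also have "\<dots> \<le> emeasure lborel B + emeasure lborel (G - B)"
    using B G(1) by (intro emeasure_subadditive) auto
  also have "\<dots> \<le> emeasure lborel B + ennreal \<epsilon>"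
    using G(3) by (intro add_left_mono) simp
  finally show ?thesis using G by blast
qed

text \<open>An inequality, so that an empty family of pieces (n = 0, with division by 0) is
  included.\<close>

lemma of_nat_times_ennreal_divide_le: "\<epsilon> > 0 \<Longrightarrow> of_nat n * ennreal (\<epsilon> / real n) \<le> ennreal \<epsilon>"
  by (cases "n = 0") (auto simp: ennreal_of_nat_eq_real_of_nat simp flip: ennreal_mult)

section \<open>Decomposition into compact pieces\<close>

lemma UN_first_occurrence:
  fixes Q :: "nat \<Rightarrow> 'a set"
  shows "(\<Union>i<n. Q i - (\<Union>j<i. Q j)) = (\<Union>i<n. Q i)"
  by (induction n) (auto simp: lessThan_Suc)

lemma disjoint_family_first_occurrence:
  fixes Q :: "nat \<Rightarrow> 'a set"
  shows "disjoint_family_on (\<lambda>i. Q i - (\<Union>j<i. Q j)) I"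
  using disjoint_family_on_mono[OF subset_UNIV disjoint_family_disjointed[of Q]]
  by (simp add: disjointed_def[abs_def] atLeast0LessThan)

text \<open>The projection works on balls of twice the covering radius. This leaves room to enlarge
  the disjoint pieces to open sets without leaving its domain of validity.\<close>

lemma compact_manifold_cover:
  fixes B W :: "(real^'m) set"
  assumes W: "C1_manifold TYPE('d::finite) W" and B: "compact B" "B \<subseteq> W" and e: "e > 0"
  obtains n c r and \<psi> :: "nat \<Rightarrow> real^'m \<Rightarrow> real^'d"
  where "\<And>i. i < n \<Longrightarrow> r i > 0" "B \<subseteq> (\<Union>i<n. ball (c i) (r i))"
    "\<And>i. i < n \<Longrightarrow> almost_isometry e (\<psi> i) (B \<inter> ball (c i) (2 * r i))"
proof -
  have "\<exists>\<rho> (\<psi> :: real^'m \<Rightarrow> real^'d). \<rho> > 0 \<and> almost_isometry e \<psi> (B \<inter> ball y (2 * \<rho>))" if y: "y \<in> B" for y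
  proof -
    obtain \<rho> and \<psi> :: "real^'m \<Rightarrow> real^'d"
      where *: "\<rho> > 0" "linear \<psi>" "\<And>x. norm (\<psi> x) \<le> norm x"
      "\<And>x x'. x \<in> W \<inter> ball y \<rho> \<Longrightarrow> x' \<in> W \<inter> ball y \<rho> \<Longrightarrow> norm (x - x') \<le> (1 + e) * norm (\<psi> x - \<psi> x')"
      by (rule C1_manifold_chart[OF W subsetD[OF B(2) y] e]) (rule that; assumption)
    then have "almost_isometry e \<psi> (B \<inter> ball y (2 * (\<rho> / 2)))"
      unfolding almost_isometry_def using B(2) by (simp add: subset_iff)
    then show ?thesis using *(1) half_gt_zero by blast
  qed
  then obtain \<rho> and \<psi> :: "real^'m \<Rightarrow> real^'m \<Rightarrow> real^'d"
    where \<rho>: "\<And>y. y \<in> B \<Longrightarrow> \<rho> y > 0" "\<And>y. y \<in> B \<Longrightarrow> almost_isometry e (\<psi> y) (B \<inter> ball y (2 * \<rho> y))"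
    by metis
  obtain F where F: "F \<subseteq> B" "finite F" "B \<subseteq> (\<Union>y\<in>F. ball y (\<rho> y))"
  proof (rule compactE_image[OF B(1), of B "\<lambda>y. ball y (\<rho> y)"])
    show "B \<subseteq> (\<Union>y\<in>B. ball y (\<rho> y))" using \<rho>(1) by force
  qed auto
  obtain h where h: "bij_betw h {..<card F} F"
    using ex_bij_betw_nat_finite[OF F(2)] by (auto simp: atLeast0LessThan)
  then have hF: "h ` {..<card F} = F" by (simp add: bij_betw_def)
  then have hB: "h i \<in> B" if "i < card F" for i using F(1) that by blast
  show ?thesis
  proof (rule that[of "card F" "\<lambda>i. \<rho> (h i)" h "\<lambda>i. \<psi> (h i)"])
    have "(\<Union>i<card F. ball (h i) (\<rho> (h i))) = (\<Union>y\<in>h ` {..<card F}. ball y (\<rho> y))" by simp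
    then show "B \<subseteq> (\<Union>i<card F. ball (h i) (\<rho> (h i)))" using F(3) unfolding hF by simp
  qed (use hB \<rho> in auto)
qed

text \<open>The pieces cut out disjointly are only Borel; enlarging their images in \<open>\<real>\<^sup>d\<close> to open sets of
  nearly the same volume and shrinking by a Lebesgue number makes them compact again.\<close>

lemma compact_manifold_pieces:
  fixes B W :: "(real^'m) set"
  assumes W: "C1_manifold TYPE('d::finite) W" and B: "compact B" "B \<subseteq> W" and e: "e > 0" and \<epsilon>: "\<epsilon> > 0"
  obtains n P and \<psi> :: "nat \<Rightarrow> real^'m \<Rightarrow> real^'d"
  where "\<And>i. i < n \<Longrightarrow> compact (P i)" "\<And>i. i < n \<Longrightarrow> almost_isometry e (\<psi> i) (P i)"
    "B = (\<Union>i<n. P i)"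
    "(\<Sum>i<n. emeasure lborel (\<psi> i ` P i)) \<le> emeasure (hausdorff_measure TYPE('d)) B + ennreal \<epsilon>"
proof -
  let ?h = "emeasure (hausdorff_measure TYPE('d) :: (real^'m) measure)"
  obtain n c r and \<psi> :: "nat \<Rightarrow> real^'m \<Rightarrow> real^'d"
    where r: "\<And>i. i < n \<Longrightarrow> r i > 0" and cov: "B \<subseteq> (\<Union>i<n. ball (c i) (r i))"
      and ai: "\<And>i. i < n \<Longrightarrow> almost_isometry e (\<psi> i) (B \<inter> ball (c i) (2 * r i))"
    by (rule compact_manifold_cover[OF W B e]) (rule that; assumption)
  define Q where "Q i = B \<inter> cball (c i) (r i)" for i
  define D where "D i = Q i - (\<Union>j<i. Q j)" for i
  have Q: "compact (Q i)" for i using B(1) by (simp add: Q_def compact_Int_closed)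
  then have clUn: "closed (\<Union>j<i. Q j)" for i by (intro closed_UN ballI compact_imp_closed Q) simp
  have D[measurable]: "D i \<in> sets borel" for i
    unfolding D_def by (intro sets.Diff borel_closed clUn compact_imp_closed[OF Q])
  have sub: "D i \<subseteq> Q i" "Q i \<subseteq> B \<inter> ball (c i) (2 * r i)" if "i < n" for i
    using r[OF that] by (auto simp: D_def Q_def)
  \<comment> \<open>By injectivity on \<open>Q i\<close>, the image of the difference is a
    difference of compact sets.\<close>
  have \<psi>D: "\<psi> i ` D i \<in> sets borel" if i: "i < n" for i
  proof -
    have inj: "inj_on (\<psi> i) (Q i)"
      using almost_isometry_inj_on[OF ai[OF i]] sub(2)[OF i] inj_on_subset by blast
    have "D i = Q i - Q i \<inter> (\<Union>j<i. Q j)" by (auto simp: D_def)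
    then have "\<psi> i ` D i = \<psi> i ` Q i - \<psi> i ` (Q i \<inter> (\<Union>j<i. Q j))"
      using inj_on_image_set_diff[OF inj, of "Q i" "Q i \<inter> (\<Union>j<i. Q j)"] by auto
    moreover have "compact (\<psi> i ` Q i)" "compact (\<psi> i ` (Q i \<inter> (\<Union>j<i. Q j)))"
      using Q clUn by (auto intro!: compact_continuous_image almost_isometry_continuous_on[OF ai[OF i]] compact_Int_closed)
    ultimately show ?thesis by (metis sets.Diff borel_compact)
  qed
  have "\<exists>G. open G \<and> \<psi> i ` D i \<subseteq> G \<and> emeasure lborel G \<le> emeasure lborel (\<psi> i ` D i) + ennreal (\<epsilon> / real n)"
    if i: "i < n" for i
    using \<epsilon> i by (intro outer_open_lborel \<psi>D) auto
  then obtain G where G: "\<And>i. i < n \<Longrightarrow> open (G i)" "\<And>i. i < n \<Longrightarrow> \<psi> i ` D i \<subseteq> G i"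
    "\<And>i. i < n \<Longrightarrow> emeasure lborel (G i) \<le> emeasure lborel (\<psi> i ` D i) + ennreal (\<epsilon> / real n)"
    by metis
  \<comment> \<open>An open set of points where the i-th projection is still usable and lands in the
    enlarged image \<open>G i\<close>.\<close>
  define O' where "O' i = ball (c i) (2 * r i) \<inter> \<psi> i -` G i" for i
  have O': "open (O' i)" if "i < n" for i
    unfolding O'_def using G(1)[OF that] almost_isometry_continuous_on[OF ai[OF that], of UNIV]
    by (intro open_Int open_ball open_vimage) auto
  have "B = (\<Union>i<n. Q i)" using cov by (force simp: Q_def)
  then have BD: "B = (\<Union>i<n. D i)"
    unfolding D_def by (simp only: UN_first_occurrence)
  have covO: "B \<subseteq> \<Union>(O' ` {..<n})"
  proof -
    have "D i \<subseteq> O' i" if "i < n" for i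
      using sub[OF that] G(2)[OF that] by (auto simp: O'_def)
    then show ?thesis using BD by blast
  qed
  have "open T" if "T \<in> O' ` {..<n}" for T using that O' by auto
  from Heine_Borel_lemma[OF B(1) covO this] obtain \<delta>
    where \<delta>: "\<delta> > 0" "\<And>x. x \<in> B \<Longrightarrow> \<exists>T\<in>O' ` {..<n}. ball x \<delta> \<subseteq> T"
    by blast
  \<comment> \<open>The points of B at distance at least \<delta> from \<open>B - O' i\<close>. This
    is a closed condition, and since every ball of radius \<delta> centred in B lies in some
    \<open>O' i\<close>, the sets still cover B.\<close>
  define P where "P i = B \<inter> (\<Inter>z\<in>B - O' i. {x. \<delta> \<le> dist x z})" for i
  have PO: "P i \<subseteq> B \<inter> O' i" for i
  proof
    fix x assume x: "x \<in> P i"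
    then have "\<delta> \<le> dist x x" if "x \<notin> O' i" using that unfolding P_def by blast
    then show "x \<in> B \<inter> O' i" using x \<delta>(1) unfolding P_def by auto
  qed
  have disj: "disjoint_family_on D {..<n}"
    unfolding D_def[abs_def] by (rule disjoint_family_first_occurrence)
  show ?thesis
  proof (rule that)
    show "compact (P i)" if "i < n" for i
      unfolding P_def using B(1)
      by (intro compact_Int_closed closed_INT ballI closed_Collect_le continuous_intros)
    show "almost_isometry e (\<psi> i) (P i)" if "i < n" for i
      by (rule almost_isometry_subset[OF ai[OF that]]) (use PO in \<open>auto simp: O'_def\<close>)
    show "B = (\<Union>i<n. P i)"
    proof
      show "B \<subseteq> (\<Union>i<n. P i)"
      proof
        fix x assume x: "x \<in> B"
        then obtain i where i: "i < n" "ball x \<delta> \<subseteq> O' i" using \<delta>(2)[OF x] by auto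
        then have "x \<in> P i" using x by (force simp: P_def)
        then show "x \<in> (\<Union>i<n. P i)" using i by blast
      qed
    qed (auto simp: P_def)
    have "(\<Sum>i<n. emeasure lborel (\<psi> i ` P i)) \<le> (\<Sum>i<n. ?h (D i) + ennreal (\<epsilon> / real n))"
    proof (intro sum_mono)
      fix i assume "i \<in> {..<n}"
      then have i: "i < n" by simp
      have "emeasure lborel (\<psi> i ` P i) \<le> emeasure lborel (G i)"
        using PO[of i] G(1)[OF i] by (intro emeasure_mono) (auto simp: O'_def)
      also have "\<dots> \<le> emeasure lborel (\<psi> i ` D i) + ennreal (\<epsilon> / real n)" by (rule G(3)[OF i])
      also have "\<dots> \<le> ?h (D i) + ennreal (\<epsilon> / real n)"
        by (intro add_right_mono emeasure_lborel_almost_isometry_le[OF ai[OF i]] \<psi>D[OF i] D)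
      finally show "emeasure lborel (\<psi> i ` P i) \<le> ?h (D i) + ennreal (\<epsilon> / real n)" .
    qed
    also have "\<dots> = ?h B + of_nat n * ennreal (\<epsilon> / real n)"
      using disj D by (subst BD) (simp add: sum.distrib sum_emeasure image_subset_iff)
    also have "of_nat n * ennreal (\<epsilon> / real n) \<le> ennreal \<epsilon>"
      using \<epsilon> by (rule of_nat_times_ennreal_divide_le)
    finally show "(\<Sum>i<n. emeasure lborel (\<psi> i ` P i)) \<le> ?h B + ennreal \<epsilon>"
      by (simp add: add_left_mono)
  qed
qed

lemma disjoint_compact_separated:
  fixes K :: "nat \<Rightarrow> 'a::heine_borel set"
  assumes K: "\<And>i. i < n \<Longrightarrow> compact (K i)" and disj: "disjoint_family_on K {..<n}"
  obtains \<delta> where "\<delta> > 0" "\<And>i j x y. i < n \<Longrightarrow> j < n \<Longrightarrow> i \<noteq> j \<Longrightarrow> x \<in> K i \<Longrightarrow> y \<in> K j \<Longrightarrow> \<delta> \<le> dist x y"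
proof -
  let ?I = "{(i, j). i < n \<and> j < n \<and> i \<noteq> j}"
  have fin: "finite ?I" by (rule finite_subset[of _ "{..<n} \<times> {..<n}"]) auto
  have "\<exists>\<delta>>0. \<forall>x\<in>K i. \<forall>y\<in>K j. \<delta> \<le> dist x y" if "i < n" "j < n" "i \<noteq> j" for i j
  proof -
    have "K i \<inter> K j = {}" using disj that by (simp add: disjoint_family_on_def)
    then show ?thesis
      using separate_compact_closed[of "K i" "K j"] K that by (auto intro: compact_imp_closed)
  qed
  then obtain d where d: "\<And>i j. i < n \<Longrightarrow> j < n \<Longrightarrow> i \<noteq> j \<Longrightarrow> d i j > 0"
    "\<And>i j x y. i < n \<Longrightarrow> j < n \<Longrightarrow> i \<noteq> j \<Longrightarrow> x \<in> K i \<Longrightarrow> y \<in> K j \<Longrightarrow> d i j \<le> dist x y"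
    by metis
  define \<delta> where "\<delta> = Min (insert 1 ((\<lambda>(i, j). d i j) ` ?I))"
  have "\<delta> > 0" unfolding \<delta>_def using fin d(1) by (subst Min_gr_iff) auto
  moreover have "\<delta> \<le> d i j" if "i < n" "j < n" "i \<noteq> j" for i j
    unfolding \<delta>_def using fin that by (intro Min_le) auto
  ultimately show ?thesis using that d(2) order_trans by metis
qed

lemma finite_hausdorff_measure_pieces:
  fixes \<psi> :: "nat \<Rightarrow> real^'m \<Rightarrow> real^'d::finite"
  assumes "e \<ge> 0" "\<And>i. i < n \<Longrightarrow> compact (Q i)" "\<And>i. i < n \<Longrightarrow> almost_isometry e (\<psi> i) (Q i)"
  shows "emeasure (hausdorff_measure TYPE('d)) (\<Union>i<n. Q i) < top"
proof -
  have fin: "emeasure (hausdorff_measure TYPE('d)) (Q i) < top" if i: "i < n" for i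
  proof -
    have c: "compact (\<psi> i ` Q i)"
      using assms(2)[OF i] by (intro compact_continuous_image almost_isometry_continuous_on[OF assms(3)[OF i]])
    have "emeasure (hausdorff_measure TYPE('d)) (Q i) \<le> ennreal ((1 + e) ^ CARD('d)) * emeasure lborel (\<psi> i ` Q i)"
      using assms(2)[OF i] c
      by (intro emeasure_almost_isometry_le[OF assms(1) assms(3)[OF i]]) (auto intro: borel_compact)
    also have "\<dots> < top"
      using c emeasure_compact_finite[OF c] by (simp add: ennreal_mult_less_top)
    finally show ?thesis .
  qed
  have "emeasure (hausdorff_measure TYPE('d)) (\<Union>i<n. Q i) \<le> (\<Sum>i<n. emeasure (hausdorff_measure TYPE('d)) (Q i))"
    using assms(2) by (intro emeasure_subadditive_finite) (auto intro: borel_compact)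
  also have "\<dots> < top" using fin by simp
  finally show ?thesis .
qed

text \<open>The pieces of \<open>A \<inter> G\<close>, made disjoint, are exhausted from inside by
  compact sets, which then lie at mutual distance at least some \<delta> > 0. A ball of radius at
  most \<delta> / 3 has diameter below \<delta>, so it meets only one of them, and there a single
  projection compares its measure with the volume of a ball in R^d.\<close>

lemma upper_regular_compact_subset:
  fixes \<psi> :: "nat \<Rightarrow> real^'m \<Rightarrow> real^'d::finite"
  assumes e: "e \<ge> 0" and Q: "\<And>i. i < n \<Longrightarrow> compact (Q i)"
    and ai: "\<And>i. i < n \<Longrightarrow> almost_isometry e (\<psi> i) (Q i)"
    and A: "A = (\<Union>i<n. Q i)" and G: "open G" and \<epsilon>: "\<epsilon> > 0"
  obtains K \<rho> where "compact K" "K \<subseteq> A \<inter> G" "\<rho> > 0"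
    "emeasure (hausdorff_measure TYPE('d)) (A \<inter> G) \<le> emeasure (hausdorff_measure TYPE('d)) K + ennreal \<epsilon>"
    "\<And>x t. 0 \<le> t \<Longrightarrow> t \<le> \<rho> \<Longrightarrow> emeasure (hausdorff_measure TYPE('d)) (K \<inter> cball x t)
       \<le> ennreal ((1 + e) ^ CARD('d) * unit_ball_vol CARD('d) * t ^ CARD('d))"
proof -
  let ?H = "hausdorff_measure TYPE('d) :: (real^'m) measure"
  have Ab[measurable]: "A \<in> sets borel" unfolding A using Q by (auto intro!: borel_compact)
  define D where "D i = (Q i - (\<Union>j<i. Q j)) \<inter> G" for i
  have D: "D i \<in> sets borel" if "i < n" for i
  proof -
    have "closed (\<Union>j<i. Q j)" using Q that by (intro closed_UN) (auto intro!: compact_imp_closed)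
    then show ?thesis unfolding D_def using Q[OF that] G
      by (intro sets.Int sets.Diff borel_closed borel_open) (auto intro: compact_imp_closed)
  qed
  have AD: "A \<inter> G = (\<Union>i<n. D i)"
    unfolding A by (subst UN_first_occurrence[symmetric]) (auto simp: D_def)
  have disj: "disjoint_family_on D {..<n}"
    using disjoint_family_first_occurrence[of Q "{..<n}"] by (auto simp: D_def disjoint_family_on_def)
  \<comment> \<open>Restricting to A makes the measure finite, as inner regularity demands.\<close>
  define M where "M = density ?H (indicator A)"
  have M: "emeasure M X = emeasure ?H (A \<inter> X)" if "X \<in> sets borel" for X
    unfolding M_def using that by (simp add: emeasure_restricted)
  have finA: "emeasure ?H A < top"
    unfolding A by (rule finite_hausdorff_measure_pieces[OF e Q ai])
  have Mfin: "emeasure M (space M) \<noteq> \<infinity>" using finA M[of UNIV] by (simp add: M_def)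
  have Msets: "sets M = sets borel" by (simp add: M_def)
  have "\<exists>K. compact K \<and> K \<subseteq> D i \<and> emeasure ?H (D i) \<le> emeasure ?H K + ennreal (\<epsilon> / real n)" if i: "i < n" for i
  proof -
    have DA: "D i \<subseteq> A" using i by (auto simp: D_def A)
    have "emeasure M (D i) = (SUP K \<in> {K. K \<subseteq> D i \<and> compact K}. emeasure M K)"
      by (rule inner_regular[OF Msets Mfin D[OF i]])
    moreover have "emeasure M (D i) \<noteq> \<infinity>" using Mfin emeasure_space[of M "D i"] by (auto simp: top_unique)
    moreover have "0 < \<epsilon> / real n" using \<epsilon> i by simp
    moreover have "{K. K \<subseteq> D i \<and> compact K} \<noteq> {}" by (auto intro: exI[of _ "{}"])
    ultimately have "\<exists>K\<in>{K. K \<subseteq> D i \<and> compact K}. emeasure M (D i) < emeasure M K + ennreal (\<epsilon> / real n)"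
      by (intro SUP_approx_ennreal)
    then obtain K where K: "K \<subseteq> D i" "compact K" "emeasure M (D i) \<le> emeasure M K + ennreal (\<epsilon> / real n)"
      by (auto intro: less_imp_le)
    moreover have "A \<inter> K = K" "A \<inter> D i = D i" using K DA by auto
    ultimately show ?thesis using M[OF D[OF i]] M[of K] borel_compact[of K] by (intro exI[of _ K]) auto
  qed
  then obtain K where K: "\<And>i. i < n \<Longrightarrow> compact (K i)" "\<And>i. i < n \<Longrightarrow> K i \<subseteq> D i"
    "\<And>i. i < n \<Longrightarrow> emeasure ?H (D i) \<le> emeasure ?H (K i) + ennreal (\<epsilon> / real n)"
    by metis
  have disjK: "disjoint_family_on K {..<n}"
    using disj K(2) by (simp add: disjoint_family_on_def) blast
  obtain \<delta> where \<delta>: "\<delta> > 0"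
    "\<And>i j x y. i < n \<Longrightarrow> j < n \<Longrightarrow> i \<noteq> j \<Longrightarrow> x \<in> K i \<Longrightarrow> y \<in> K j \<Longrightarrow> \<delta> \<le> dist x y"
    by (rule disjoint_compact_separated[OF _ disjK]) (erule K(1) | (rule that; assumption))+
  show ?thesis
  proof (rule that[of "\<Union>i<n. K i" "\<delta> / 3"])
    show "compact (\<Union>i<n. K i)" using K(1) by (intro compact_UN) auto
    show "(\<Union>i<n. K i) \<subseteq> A \<inter> G" using K(2) AD by blast
    show "\<delta> / 3 > 0" using \<delta>(1) by simp
    have "emeasure ?H (A \<inter> G) = (\<Sum>i<n. emeasure ?H (D i))"
      unfolding AD using disj D by (intro sum_emeasure[symmetric]) auto
    also have "\<dots> \<le> (\<Sum>i<n. emeasure ?H (K i) + ennreal (\<epsilon> / real n))" by (intro sum_mono K(3)) simp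
    also have "\<dots> = emeasure ?H (\<Union>i<n. K i) + of_nat n * ennreal (\<epsilon> / real n)"
      using disjK K(1) by (simp add: sum.distrib sum_emeasure borel_compact image_subset_iff)
    also have "\<dots> \<le> emeasure ?H (\<Union>i<n. K i) + ennreal \<epsilon>"
      using \<epsilon> by (intro add_left_mono of_nat_times_ennreal_divide_le)
    finally show "emeasure ?H (A \<inter> G) \<le> emeasure ?H (\<Union>i<n. K i) + ennreal \<epsilon>" .
    fix x t assume t: "0 \<le> t" "t \<le> \<delta> / 3"
    show "emeasure ?H ((\<Union>i<n. K i) \<inter> cball x t) \<le> ennreal ((1 + e) ^ CARD('d) * unit_ball_vol CARD('d) * t ^ CARD('d))"
    proof (cases "(\<Union>i<n. K i) \<inter> cball x t = {}")
      case False
      then obtain k z where k: "k < n" "z \<in> K k" "dist x z \<le> t" by auto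
      have "(\<Union>i<n. K i) \<inter> cball x t \<subseteq> K k \<inter> cball x t"
      proof
        fix w assume "w \<in> (\<Union>i<n. K i) \<inter> cball x t"
        then obtain j where j: "j < n" "w \<in> K j" "dist x w \<le> t" by auto
        have "dist w z < \<delta>" using dist_triangle3[of w z x] j(3) k(3) t \<delta>(1) by linarith
        then have "j = k" using \<delta>(2)[OF j(1) k(1) _ j(2) k(2)] by fastforce
        then show "w \<in> K k \<inter> cball x t" using j by auto
      qed
      then have "emeasure ?H ((\<Union>i<n. K i) \<inter> cball x t) \<le> emeasure ?H (K k \<inter> cball x t)"
        using K(1)[OF k(1)] by (intro emeasure_mono) (auto intro: borel_compact)
      also have "\<dots> \<le> ennreal ((1 + e) ^ CARD('d)) * emeasure lborel (cball (\<psi> k x) t)"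
      proof (rule emeasure_almost_isometry_le[OF e])
        show "almost_isometry e (\<psi> k) (K k \<inter> cball x t)"
          by (rule almost_isometry_subset[OF ai[OF k(1)]]) (use K(2)[OF k(1)] in \<open>auto simp: D_def\<close>)
        show "\<psi> k ` (K k \<inter> cball x t) \<subseteq> cball (\<psi> k x) t"
          using almost_isometry_dist[OF ai[OF k(1)]] order_trans by fastforce
      qed (use K(1)[OF k(1)] in \<open>auto intro: borel_compact\<close>)
      also have "\<dots> = ennreal ((1 + e) ^ CARD('d) * unit_ball_vol CARD('d) * t ^ CARD('d))"
        using t e by (simp add: emeasure_cball mult.assoc flip: ennreal_mult)
      finally show ?thesis .
    qed simp
  qed
qed

text \<open>The null intersections make the measures of the \<open>B k\<close> add up to that of A,
  so each \<open>B k\<close> can be split separately with excess \<epsilon> / l.\<close>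

lemma manifold_union_pieces:
  fixes A :: "(real^'m) set" and B :: "nat \<Rightarrow> (real^'m) set"
  assumes A: "A = (\<Union>i\<in>{1..l}. B i)" and B: "\<And>i. i \<in> {1..l} \<Longrightarrow> compact (B i)"
    "\<And>i. i \<in> {1..l} \<Longrightarrow> \<exists>W. C1_manifold TYPE('d::finite) W \<and> B i \<subseteq> W"
    and null: "\<And>i j. 1 \<le> i \<Longrightarrow> i < j \<Longrightarrow> j \<le> l \<Longrightarrow> emeasure (hausdorff_measure TYPE('d)) (B i \<inter> B j) = 0"
    and e: "e > 0" and \<epsilon>: "\<epsilon> > 0"
  obtains n P and \<psi> :: "nat \<Rightarrow> real^'m \<Rightarrow> real^'d"
  where "\<And>i. i < n \<Longrightarrow> compact (P i)" "\<And>i. i < n \<Longrightarrow> almost_isometry e (\<psi> i) (P i)"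
    "A = (\<Union>i<n. P i)"
    "(\<Sum>i<n. emeasure lborel (\<psi> i ` P i)) \<le> emeasure (hausdorff_measure TYPE('d)) A + ennreal \<epsilon>"
proof -
  let ?H = "hausdorff_measure TYPE('d) :: (real^'m) measure"
  define \<Phi> where "\<Phi> k n P \<psi> \<longleftrightarrow> (\<forall>i<n. compact (P i) \<and> almost_isometry e (\<psi> i) (P i)) \<and>
    B k = (\<Union>i<n. P i) \<and> (\<Sum>i<n. emeasure lborel (\<psi> i ` P i)) \<le> emeasure ?H (B k) + ennreal (\<epsilon> / real l)"
    for k n P and \<psi> :: "nat \<Rightarrow> real^'m \<Rightarrow> real^'d"
  have "\<exists>n P \<psi>. \<Phi> k n P \<psi>" if k: "k \<in> {1..l}" for k
  proof -
    obtain W where W: "C1_manifold TYPE('d) W" "B k \<subseteq> W" using B(2)[OF k] by blast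
    have \<epsilon>': "\<epsilon> / real l > 0" using \<epsilon> k by simp
    obtain n P and \<psi> :: "nat \<Rightarrow> real^'m \<Rightarrow> real^'d"
      where "\<And>i. i < n \<Longrightarrow> compact (P i)" "\<And>i. i < n \<Longrightarrow> almost_isometry e (\<psi> i) (P i)"
        "B k = (\<Union>i<n. P i)"
        "(\<Sum>i<n. emeasure lborel (\<psi> i ` P i)) \<le> emeasure ?H (B k) + ennreal (\<epsilon> / real l)"
      by (rule compact_manifold_pieces[OF W(1) B(1)[OF k] W(2) e \<epsilon>']) (rule that; assumption)
    then have "\<Phi> k n P \<psi>" unfolding \<Phi>_def by blast
    then show ?thesis by blast
  qed
  then obtain n P \<psi> where "\<And>k. k \<in> {1..l} \<Longrightarrow> \<Phi> k (n k) (P k) (\<psi> k)" by metis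
  then have P: "\<And>k i. k \<in> {1..l} \<Longrightarrow> i < n k \<Longrightarrow> compact (P k i) \<and> almost_isometry e (\<psi> k i) (P k i)"
    "\<And>k. k \<in> {1..l} \<Longrightarrow> B k = (\<Union>i<n k. P k i)"
    "\<And>k. k \<in> {1..l} \<Longrightarrow> (\<Sum>i<n k. emeasure lborel (\<psi> k i ` P k i)) \<le> emeasure ?H (B k) + ennreal (\<epsilon> / real l)"
    unfolding \<Phi>_def by blast+
  \<comment> \<open>The pieces of all \<open>B k\<close> carry pairs of indices; h renumbers them
    consecutively.\<close>
  define F where "F = Sigma {1..l} (\<lambda>k. {..<n k})"
  have "finite F" by (simp add: F_def)
  then obtain h where h: "bij_betw h {..<card F} F"
    using ex_bij_betw_nat_finite[of F] by (auto simp: atLeast0LessThan)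
  then have hF: "h i \<in> F" if "i < card F" for i using that by (auto simp: bij_betw_def)
  have UNF: "(\<Union>x\<in>F. f x) = (\<Union>i<card F. f (h i))" for f :: "_ \<Rightarrow> (real^'m) set"
  proof -
    have "(\<Union>x\<in>h ` {..<card F}. f x) = (\<Union>i<card F. f (h i))" by simp
    then show ?thesis by (simp only: bij_betw_imp_surj_on[OF h])
  qed
  \<comment> \<open>Padding by empty sets fits the family to the index range of the first-occurrence
    lemmas.\<close>
  define B' where "B' i = (if i \<in> {1..l} then B i else {})" for i
  define D where "D i = B' i - (\<Union>j<i. B' j)" for i
  have B': "B' i \<in> sets borel" for i using B(1) by (auto simp: B'_def intro: borel_compact)
  have DB: "emeasure ?H (D i) = emeasure ?H (B' i)" for i
  proof -
    have "emeasure ?H (B' i \<inter> B' j) = 0" if "j < i" for j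
      using null[of j i] that by (auto simp: B'_def Int_commute)
    then have "(\<Union>j<i. B' i \<inter> B' j) \<in> null_sets ?H"
      using B' by (intro null_sets_UN') (auto simp: null_sets_def)
    moreover have "D i = B' i - (\<Union>j<i. B' i \<inter> B' j)" by (auto simp: D_def)
    ultimately show ?thesis using B' by (simp add: emeasure_Diff_null_set)
  qed
  have AB': "A = (\<Union>i<Suc l. B' i)" 
    unfolding A B'_def by (auto simp: less_Suc_eq_le Bex_def split: if_splits)
  have "emeasure ?H A = emeasure ?H (\<Union>i<Suc l. D i)"
    unfolding AB' D_def by (simp only: UN_first_occurrence)
  also have "\<dots> = (\<Sum>i<Suc l. emeasure ?H (D i))"
    using B' by (intro sum_emeasure[symmetric]) (auto simp: D_def disjoint_family_first_occurrence)
  also have "\<dots> = (\<Sum>i<Suc l. emeasure ?H (B' i))" by (simp only: DB)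
  also have "\<dots> = (\<Sum>k\<in>{1..l}. emeasure ?H (B k))"
    by (rule sum.mono_neutral_cong_right) (auto simp: B'_def)
  finally have HA: "emeasure ?H A = (\<Sum>k\<in>{1..l}. emeasure ?H (B k))" .
  let ?P = "\<lambda>i. P (fst (h i)) (snd (h i))" and ?\<psi> = "\<lambda>i. \<psi> (fst (h i)) (snd (h i))"
  show ?thesis
  proof (rule that[of "card F" "?P" "?\<psi>"])
    fix i assume "i < card F"
    then have "fst (h i) \<in> {1..l}" "snd (h i) < n (fst (h i))" using hF[of i] by (auto simp: F_def)
    then show "compact (?P i)"
      "almost_isometry e (?\<psi> i) (?P i)"
      using P(1) by blast+
  next
    have "A = (\<Union>x\<in>F. P (fst x) (snd x))"
      unfolding A F_def using P(2) by (force intro: rev_bexI)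
    then show "A = (\<Union>i<card F. ?P i)" by (simp only: UNF)
  next
    have "(\<Sum>i<card F. emeasure lborel (?\<psi> i ` ?P i))
      = (\<Sum>x\<in>F. emeasure lborel (\<psi> (fst x) (snd x) ` P (fst x) (snd x)))"
      by (rule sum.reindex_bij_betw[OF h])
    also have "\<dots> = (\<Sum>k\<in>{1..l}. \<Sum>i<n k. emeasure lborel (\<psi> k i ` P k i))"
      unfolding F_def by (simp add: sum.Sigma split_beta)
    also have "\<dots> \<le> (\<Sum>k\<in>{1..l}. emeasure ?H (B k) + ennreal (\<epsilon> / real l))"
      by (intro sum_mono P(3))
    also have "\<dots> = emeasure ?H A + of_nat l * ennreal (\<epsilon> / real l)"
      by (simp add: HA sum.distrib)
    also have "of_nat l * ennreal (\<epsilon> / real l) \<le> ennreal \<epsilon>"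
      using \<epsilon> by (rule of_nat_times_ennreal_divide_le)
    finally show "(\<Sum>i<card F. emeasure lborel (?\<psi> i ` ?P i))
      \<le> emeasure ?H A + ennreal \<epsilon>" by (simp add: add_left_mono)
  qed
qed


section \<open>Lower bound for the polarization constants\<close>

text \<open>A natural power replaces \<open>powr\<close>, with the same value \<infinity> at
  distance 0 when d > 0; \<open>polarization_eq\<close> translates.\<close>

definition riesz_kernel :: "nat \<Rightarrow> 'a::metric_space \<Rightarrow> 'a \<Rightarrow> ennreal" where
  "riesz_kernel d x y = 1 / ennreal (dist x y ^ d)"

text \<open>The sum runs over ordered pairs, so every interaction counts twice; hence the factors 2
  in the exchange argument below.\<close>

definition riesz_energy :: "nat \<Rightarrow> nat \<Rightarrow> (nat \<Rightarrow> 'a::metric_space) \<Rightarrow> ennreal" where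
  "riesz_energy d N x = (\<Sum>i<N. \<Sum>j\<in>{..<N} - {i}. riesz_kernel d (x i) (x j))"

lemma riesz_kernel_commute: "riesz_kernel d x y = riesz_kernel d y x"
  by (simp add: riesz_kernel_def dist_commute)

lemma riesz_kernel_finite: "x \<noteq> y \<Longrightarrow> riesz_kernel d x y < top"
  by (auto simp: riesz_kernel_def ennreal_divide_eq_top_iff simp flip: top.not_eq_extremum)

section \<open>Energy of configurations on the pieces\<close>

text \<open>Cauchy--Schwarz in the form obtained by summing 2 t a - t^2 v \<le> a^2 / v, with one t
  for all indices: the quotient of the sum of the a's by V.\<close>

lemma square_over_sum_le:
  fixes a v :: "'i \<Rightarrow> real"
  assumes "V > 0" "\<And>i. i \<in> I \<Longrightarrow> v i > 0" "(\<Sum>i\<in>I. v i) \<le> V"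
  shows "(\<Sum>i\<in>I. a i)\<^sup>2 / V \<le> (\<Sum>i\<in>I. (a i)\<^sup>2 / v i)"
proof -
  define t where "t = (\<Sum>i\<in>I. a i) / V"
  have "2 * t * a i - t\<^sup>2 * v i \<le> (a i)\<^sup>2 / v i" if "i \<in> I" for i
  proof -
    have "0 \<le> (a i - t * v i)\<^sup>2 / v i" using assms(2)[OF that] by simp
    also have "\<dots> = (a i)\<^sup>2 / v i - (2 * t * a i - t\<^sup>2 * v i)"
      using assms(2)[OF that] by (simp add: power2_eq_square field_simps)
    finally show ?thesis by simp
  qed
  then have "(\<Sum>i\<in>I. 2 * t * a i - t\<^sup>2 * v i) \<le> (\<Sum>i\<in>I. (a i)\<^sup>2 / v i)" by (rule sum_mono)
  moreover have "(\<Sum>i\<in>I. 2 * t * a i - t\<^sup>2 * v i) = 2 * t * (\<Sum>i\<in>I. a i) - t\<^sup>2 * (\<Sum>i\<in>I. v i)"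
    by (simp add: sum_subtractf sum_distrib_left)
  moreover have "t\<^sup>2 * (\<Sum>i\<in>I. v i) \<le> t\<^sup>2 * V" using assms(3) by (intro mult_left_mono) auto
  moreover have "2 * t * (\<Sum>i\<in>I. a i) - t\<^sup>2 * V = (\<Sum>i\<in>I. a i)\<^sup>2 / V"
    using assms(1) by (simp add: t_def power2_eq_square field_simps)
  ultimately show ?thesis by linarith
qed

text \<open>Outer regularity together with the positive distance from a compact set to the
  complement of an open neighbourhood. It leaves room for the balls in
  \<open>euclidean_energy_lower_bound\<close>.\<close>

lemma compact_parallel_volume:
  fixes E :: "(real^'d::finite) set"
  assumes E: "compact E" and \<epsilon>: "\<epsilon> > 0"
  obtains R G where "R > 0" "open G" "(\<Union>a\<in>E. cball a R) \<subseteq> G"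
    "emeasure lborel G \<le> ennreal (measure lborel E + \<epsilon>)"
proof -
  have Eb: "E \<in> sets borel" using E by (rule borel_compact)
  obtain G where G: "open G" "E \<subseteq> G" "emeasure lborel G \<le> emeasure lborel E + ennreal \<epsilon>"
    using outer_open_lborel[OF Eb \<epsilon>] by blast
  obtain R where R: "R > 0" "(\<Union>a\<in>E. cball a R) \<subseteq> G"
    by (rule compact_subset_open_imp_cball_epsilon_subset[OF E G(1,2)]) (rule that; assumption)
  note G(3)
  also have "emeasure lborel E = ennreal (measure lborel E)"
    using emeasure_compact_finite[OF E] by (intro emeasure_eq_ennreal_measure) auto
  also have "ennreal (measure lborel E) + ennreal \<epsilon> = ennreal (measure lborel E + \<epsilon>)"
    using \<epsilon> by (simp add: ennreal_plus)
  finally show ?thesis using R G(1) that by blast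
qed

text \<open>Each point is assigned to one piece containing it, and only interactions within a piece
  are kept. The Euclidean bound applies to their projections, and \<open>square_over_sum_le\<close>
  removes the dependence on the occupation numbers.\<close>

lemma riesz_energy_lower_bound:
  fixes \<psi> :: "nat \<Rightarrow> real^'m \<Rightarrow> real^'d::finite"
  assumes e: "e \<ge> 0" and P: "\<And>k. k < n \<Longrightarrow> compact (P k)"
    and ai: "\<And>k. k < n \<Longrightarrow> almost_isometry e (\<psi> k) (P k)"
    and V: "(\<Sum>k<n. emeasure lborel (\<psi> k ` P k)) < ennreal V"
  obtains R where "R > 0"
    "\<And>N x. 1 \<le> R * root CARD('d) (real N) \<Longrightarrow> x ` {..<N} \<subseteq> (\<Union>k<n. P k) \<Longrightarrow>
      ennreal ((real N)\<^sup>2 * (unit_ball_vol CARD('d) * (ln (real N) + real CARD('d) * ln R)) / V)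
      \<le> ennreal ((1 + e) ^ CARD('d)) * riesz_energy CARD('d) N x + ennreal ((real N)\<^sup>2)"
proof -
  let ?d = "CARD('d)"
  define v where "v k = measure lborel (\<psi> k ` P k)" for k
  have cE: "compact (\<psi> k ` P k)" if "k < n" for k
    using P[OF that] by (intro compact_continuous_image almost_isometry_continuous_on[OF ai[OF that]])
  have vE: "emeasure lborel (\<psi> k ` P k) = ennreal (v k)" if "k < n" for k
    unfolding v_def using emeasure_compact_finite[OF cE[OF that]] by (intro emeasure_eq_ennreal_measure) auto
  have v0: "v k \<ge> 0" for k by (simp add: v_def)
  have "(\<Sum>k<n. emeasure lborel (\<psi> k ` P k)) = ennreal (\<Sum>k<n. v k)"
    using v0 by (simp add: vE)
  then have sV: "(\<Sum>k<n. v k) < V" "V > 0"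
    using V v0 sum_nonneg[of "{..<n}" v] by (auto simp: ennreal_less_iff)
  \<comment> \<open>The spare volume is shared among the pieces, so that
    \<open>v k + \<epsilon>\<close> is positive even for a piece with projection of volume 0. The
    denominator n + 1 admits n = 0.\<close>
  define \<epsilon> where "\<epsilon> = (V - (\<Sum>k<n. v k)) / (real n + 1)"
  have \<epsilon>: "\<epsilon> > 0" using sV by (simp add: \<epsilon>_def)
  have "real n * \<epsilon> \<le> V - (\<Sum>k<n. v k)"
    using sV by (simp add: \<epsilon>_def field_simps)
  then have vV: "(\<Sum>k<n. v k + \<epsilon>) \<le> V" by (simp add: sum.distrib)
  have "\<exists>R G. R > 0 \<and> open G \<and> (\<Union>a\<in>\<psi> k ` P k. cball a R) \<subseteq> G \<and> emeasure lborel G \<le> ennreal (v k + \<epsilon>)"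
    if "k < n" for k
    by (rule compact_parallel_volume[OF cE[OF that] \<epsilon>]) (auto simp: v_def)
  then obtain R0 G where R0: "\<And>k. k < n \<Longrightarrow> R0 k > 0" and G: "\<And>k. k < n \<Longrightarrow> open (G k)"
    "\<And>k. k < n \<Longrightarrow> (\<Union>a\<in>\<psi> k ` P k. cball a (R0 k)) \<subseteq> G k"
    "\<And>k. k < n \<Longrightarrow> emeasure lborel (G k) \<le> ennreal (v k + \<epsilon>)"
    by metis
  define R where "R = Min (insert 1 (R0 ` {..<n}))"
  have R: "R > 0" "\<And>k. k < n \<Longrightarrow> R \<le> R0 k"
    unfolding R_def using R0 by (subst Min_gr_iff) auto
  show ?thesis
  proof (rule that[OF R(1)])
    fix N and x :: "nat \<Rightarrow> real^'m"
    assume N: "1 \<le> R * root ?d (real N)" and x: "x ` {..<N} \<subseteq> (\<Union>k<n. P k)"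
    have N0: "N > 0" using N by (cases "N = 0") auto
    \<comment> \<open>With q = N^(1/d) the diagonal costs N for each point, hence N^2 in all, and
      the window from 1 / R to q yields ln N + d ln R.\<close>
    define q where "q = root ?d (real N)"
    have q: "q > 0" "q ^ ?d = real N" "1 / R \<le> q"
      using N N0 R(1) by (auto simp: q_def field_simps)
    have lnq: "real ?d * ln (q / (1 / R)) = ln (real N) + real ?d * ln R"
    proof -
      have "ln (real N) = real ?d * ln q" using q by (simp flip: q(2) add: ln_realpow)
      then show ?thesis using q(1) R(1) by (simp add: ln_mult distrib_left)
    qed
    have ln0: "ln (real N) + real ?d * ln R \<ge> 0"
      unfolding lnq[symmetric] using q R(1) by (intro mult_nonneg_nonneg) (auto simp: field_simps)
    have "\<exists>k. i < N \<longrightarrow> k < n \<and> x i \<in> P k" for i using x by blast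
    then obtain \<kappa> where "\<And>i. i < N \<longrightarrow> \<kappa> i < n \<and> x i \<in> P (\<kappa> i)" by metis
    then have \<kappa>: "\<And>i. i < N \<Longrightarrow> \<kappa> i < n \<and> x i \<in> P (\<kappa> i)" by blast
    define I where "I k = {i \<in> {..<N}. \<kappa> i = k}" for k
    have fI: "finite (I k)" for k by (simp add: I_def)
    define K where "K i j = riesz_kernel ?d (x i) (x j)" for i j
    let ?c = "unit_ball_vol ?d * (ln (real N) + real ?d * ln R)"
    have c0: "?c \<ge> 0" using ln0 by simp
    have ceq: "real ?d * unit_ball_vol ?d * ln (q / (1 / R)) = ?c"
      unfolding lnq[symmetric] by (simp only: mult_ac)
    have piece: "ennreal ((real (card (I k)))\<^sup>2 * ?c / (v k + \<epsilon>))
       \<le> ennreal ((1 + e) ^ ?d) * (\<Sum>i\<in>I k. \<Sum>j\<in>I k - {i}. K i j) + ennreal (real (card (I k)) * real N)"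
      if k: "k < n" for k
    proof -
      have xP: "x i \<in> P k" if "i \<in> I k" for i using \<kappa>[of i] that by (auto simp: I_def)
      have "ennreal ((real (card (I k)))\<^sup>2 * (real ?d * unit_ball_vol ?d * ln (q / (1 / R))) / (v k + \<epsilon>))
       \<le> (\<Sum>i\<in>I k. \<Sum>j\<in>I k - {i}. 1 / ennreal (dist (\<psi> k (x i)) (\<psi> k (x j)) ^ ?d))
          + ennreal (real (card (I k)) * q ^ ?d)"
      proof (rule euclidean_energy_lower_bound[OF fI _ q(3)])
        show "emeasure lborel (G k) \<le> ennreal (v k + \<epsilon>)" by (rule G(3)[OF k])
        show "cball (\<psi> k (x i)) (1 / (1 / R)) \<subseteq> G k" if "i \<in> I k" for i
        proof -
          have "cball (\<psi> k (x i)) R \<subseteq> cball (\<psi> k (x i)) (R0 k)" using R(2)[OF k] by auto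
          also have "\<dots> \<subseteq> G k" using G(2)[OF k] xP[OF that] by blast
          finally show ?thesis by simp
        qed
        show "v k + \<epsilon> > 0" using v0[of k] \<epsilon> by simp
      qed (use G(1)[OF k] R(1) in auto)
      also have "\<dots> \<le> (\<Sum>i\<in>I k. \<Sum>j\<in>I k - {i}. ennreal ((1 + e) ^ ?d) * K i j) + ennreal (real (card (I k)) * q ^ ?d)"
      proof (intro add_right_mono sum_mono)
        fix i j assume "i \<in> I k" "j \<in> I k - {i}"
        then have le: "dist (x i) (x j) \<le> (1 + e) * dist (\<psi> k (x i)) (\<psi> k (x j))"
          using ai[OF k] xP by (auto simp: almost_isometry_def dist_norm)
        show "1 / ennreal (dist (\<psi> k (x i)) (\<psi> k (x j)) ^ ?d) \<le> ennreal ((1 + e) ^ ?d) * K i j"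
        proof (cases "x i = x j")
          case True
          then show ?thesis using e by (simp add: K_def riesz_kernel_def zero_power ennreal_mult_top less_imp_neq[symmetric])
        next
          case False
          then have pos: "dist (x i) (x j) > 0" by simp
          then have pos': "dist (\<psi> k (x i)) (\<psi> k (x j)) > 0"
            using le by (cases "\<psi> k (x i) = \<psi> k (x j)") auto
          have "dist (x i) (x j) ^ ?d \<le> (1 + e) ^ ?d * dist (\<psi> k (x i)) (\<psi> k (x j)) ^ ?d"
            using power_mono[OF le, of ?d] by (simp add: power_mult_distrib)
          then have "1 / dist (\<psi> k (x i)) (\<psi> k (x j)) ^ ?d \<le> (1 + e) ^ ?d * (1 / dist (x i) (x j) ^ ?d)"
            using pos pos' by (simp add: field_simps)
          then have "ennreal (1 / dist (\<psi> k (x i)) (\<psi> k (x j)) ^ ?d) \<le> ennreal ((1 + e) ^ ?d * (1 / dist (x i) (x j) ^ ?d))"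
            by (rule ennreal_leI)
          also have "\<dots> = ennreal ((1 + e) ^ ?d) * ennreal (1 / dist (x i) (x j) ^ ?d)"
            using e by (intro ennreal_mult) auto
          finally show ?thesis using pos pos'
            unfolding K_def riesz_kernel_def ennreal_1[symmetric] by (simp only: divide_ennreal zero_le_one zero_less_power)
        qed
      qed
      finally show ?thesis
        unfolding q(2) ceq by (simp only: sum_distrib_left)
    qed
    let ?S = "\<Sum>k<n. \<Sum>i\<in>I k. \<Sum>j\<in>I k - {i}. K i j"
    have cardI: "(\<Sum>k<n. card (I k)) = N"
    proof -
      have "(\<Sum>k<n. card (I k)) = card (\<Union>k\<in>{..<n}. I k)"
        by (intro card_UN_disjoint[symmetric]) (auto simp: I_def)
      also have "(\<Union>k\<in>{..<n}. I k) = {..<N}" using \<kappa> by (auto simp: I_def)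
      finally show ?thesis by simp
    qed
    have "ennreal ((real N)\<^sup>2 * ?c / V) \<le> ennreal (\<Sum>k<n. (real (card (I k)))\<^sup>2 * ?c / (v k + \<epsilon>))"
    proof (rule ennreal_leI)
      have "(real N)\<^sup>2 / V \<le> (\<Sum>k<n. (real (card (I k)))\<^sup>2 / (v k + \<epsilon>))"
        using square_over_sum_le[OF sV(2), of "{..<n}" "\<lambda>k. v k + \<epsilon>" "\<lambda>k. real (card (I k))"] vV v0 \<epsilon>
        by (simp add: cardI add_nonneg_pos flip: of_nat_sum)
      then have "?c * ((real N)\<^sup>2 / V) \<le> ?c * (\<Sum>k<n. (real (card (I k)))\<^sup>2 / (v k + \<epsilon>))"
        by (rule mult_left_mono[OF _ c0])
      then show "(real N)\<^sup>2 * ?c / V \<le> (\<Sum>k<n. (real (card (I k)))\<^sup>2 * ?c / (v k + \<epsilon>))"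
        by (simp add: sum_distrib_left mult_ac)
    qed
    also have "\<dots> = (\<Sum>k<n. ennreal ((real (card (I k)))\<^sup>2 * ?c / (v k + \<epsilon>)))"
      using ln0 v0 \<epsilon> by (intro sum_ennreal[symmetric] divide_nonneg_nonneg mult_nonneg_nonneg) (auto intro: add_nonneg_nonneg)
    also have "\<dots> \<le> (\<Sum>k<n. ennreal ((1 + e) ^ ?d) * (\<Sum>i\<in>I k. \<Sum>j\<in>I k - {i}. K i j) + ennreal (real (card (I k)) * real N))"
      by (intro sum_mono piece) simp
    also have "\<dots> = ennreal ((1 + e) ^ ?d) * ?S + ennreal ((real N)\<^sup>2)"
    proof -
      have "(\<Sum>k<n. ennreal (real (card (I k)) * real N)) = ennreal ((\<Sum>k<n. real (card (I k))) * real N)"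
        by (simp add: sum_distrib_right)
      also have "(\<Sum>k<n. real (card (I k))) = real N" using cardI by (simp flip: of_nat_sum)
      finally show ?thesis by (simp add: sum.distrib sum_distrib_left power2_eq_square)
    qed
    also have "?S \<le> riesz_energy ?d N x"
    proof -
      have "?S \<le> (\<Sum>k<n. \<Sum>i\<in>I k. \<Sum>j\<in>{..<N} - {i}. K i j)"
        by (intro sum_mono sum_mono2) (auto simp: I_def)
      also have "\<dots> = (\<Sum>i\<in>(\<Union>k\<in>{..<n}. I k). \<Sum>j\<in>{..<N} - {i}. K i j)"
        by (intro sum.UNION_disjoint[symmetric]) (auto simp: I_def)
      also have "(\<Union>k\<in>{..<n}. I k) = {..<N}" using \<kappa> by (auto simp: I_def)
      finally show ?thesis by (simp add: riesz_energy_def K_def)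
    qed
    finally show "ennreal ((real N)\<^sup>2 * ?c / V) \<le> ennreal ((1 + e) ^ ?d) * riesz_energy ?d N x + ennreal ((real N)\<^sup>2)"
      by (simp add: mult_left_mono add_right_mono)
  qed
qed

section \<open>From energy to polarization\<close>

lemma polarization_eq:
  assumes "d > 0"
  shows "polarization (real d) \<omega> A = (INF y\<in>A. \<Sum>x\<in>#\<omega>. riesz_kernel d y x)"
proof -
  have "dist y x powr real d = dist y x ^ d" for x y :: 'a
    using assms by (cases "x = y") (auto simp: powr_realpow)
  then show ?thesis by (simp add: polarization_def riesz_kernel_def)
qed

text \<open>Replacing the \<open>i\<close>th point of an almost minimal configuration by \<open>y\<close> cannot lower its energy
  by more than 1. Summing these inequalities over \<open>i\<close> bounds the potential at \<open>y\<close> from below.\<close>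

lemma riesz_energy_le_polarization:
  fixes A :: "'a::metric_space set"
  assumes A: "infinite A" and N: "N > 0"
  obtains x where "\<And>i. i < N \<Longrightarrow> x i \<in> A"
    "\<And>y. y \<in> A \<Longrightarrow> riesz_energy d N x \<le> of_nat N * (\<Sum>j<N. riesz_kernel d y (x j)) + of_nat N"
proof -
  define X where "X = {x :: nat \<Rightarrow> 'a. \<forall>i<N. x i \<in> A}"
  define E where "E = (INF x\<in>X. riesz_energy d N x)"
  \<comment> \<open>An injective sequence exists because A is infinite. Its energy is finite, so the
    infimum is finite and cancellation in \<open>ennreal\<close> becomes possible.\<close>
  obtain z :: "nat \<Rightarrow> 'a" where z: "inj z" "range z \<subseteq> A" using infinite_countable_subset[OF A] by blast
  have "riesz_energy d N z < top"
    unfolding riesz_energy_def using z(1) by (auto intro!: riesz_kernel_finite simp: inj_eq)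
  moreover have "E \<le> riesz_energy d N z" unfolding E_def using z by (intro INF_lower) (auto simp: X_def)
  ultimately have "E < top" by simp
  then have "\<exists>x\<in>X. riesz_energy d N x < E + ennreal 1"
    by (intro INF_approx_ennreal[OF _ E_def]) auto
  then obtain x where x: "x \<in> X" "riesz_energy d N x < E + 1" by auto
  have fin: "riesz_energy d N x < top" using x(2) \<open>E < top\<close> by (metis ennreal_add_less_top ennreal_one_less_top less_trans)
  show ?thesis
  proof (rule that)
    show "x i \<in> A" if "i < N" for i using x(1) that by (simp add: X_def)
    fix y assume y: "y \<in> A"
    let ?k = "riesz_kernel d"
    define U where "U i w = (\<Sum>j\<in>{..<N} - {i}. ?k w (x j))" for i w
    have step: "2 * U i (x i) \<le> 2 * U i y + 1" if i: "i < N" for i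
    proof -
      \<comment> \<open>The energy of the other points, which the exchange leaves unchanged; the
        exchanged point enters only through twice its potential.\<close>
      define F where "F = (\<Sum>a\<in>{..<N} - {i}. \<Sum>b\<in>{..<N} - {i} - {a}. ?k (x a) (x b))"
      have split: "riesz_energy d N (x(i := w)) = F + 2 * U i w" for w
      proof -
        let ?z = "x(i := w)"
        let ?F = "\<lambda>a. \<Sum>b\<in>{..<N} - {i} - {a}. ?k (x a) (x b)"
        have "riesz_energy d N ?z = (\<Sum>j\<in>{..<N} - {i}. ?k w (?z j))
          + (\<Sum>a\<in>{..<N} - {i}. \<Sum>b\<in>{..<N} - {a}. ?k (?z a) (?z b))"
          unfolding riesz_energy_def using i by (subst sum.remove[of "{..<N}" i]) auto
        also have "(\<Sum>a\<in>{..<N} - {i}. \<Sum>b\<in>{..<N} - {a}. ?k (?z a) (?z b))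
          = (\<Sum>a\<in>{..<N} - {i}. ?k (x a) w + ?F a)"
        proof (intro sum.cong refl)
          fix a assume a: "a \<in> {..<N} - {i}"
          have "(\<Sum>b\<in>{..<N} - {a}. ?k (?z a) (?z b))
            = ?k (x a) w + (\<Sum>b\<in>{..<N} - {a} - {i}. ?k (?z a) (?z b))"
            using a i by (subst sum.remove[of _ i]) auto
          also have "{..<N} - {a} - {i} = {..<N} - {i} - {a}" by auto
          also have "(\<Sum>b\<in>{..<N} - {i} - {a}. ?k (?z a) (?z b)) = ?F a"
            using a by (intro sum.cong) auto
          finally show "(\<Sum>b\<in>{..<N} - {a}. ?k (?z a) (?z b))
            = ?k (x a) w + ?F a" .
        qed
        also have "(\<Sum>j\<in>{..<N} - {i}. ?k w (?z j)) = U i w"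
          unfolding U_def by (intro sum.cong) auto
        also have "(\<Sum>a\<in>{..<N} - {i}. ?k (x a) w + ?F a) = U i w + F"
          by (simp add: sum.distrib U_def F_def riesz_kernel_commute[of d w])
        finally show ?thesis by (simp only: mult_2 add_ac)
      qed
      have xe: "riesz_energy d N x = F + 2 * U i (x i)" using split[of "x i"] by simp
      have "x(i := y) \<in> X" using x(1) y by (auto simp: X_def)
      then have "E \<le> F + 2 * U i y" unfolding split[symmetric] E_def by (rule INF_lower)
      then have "F + 2 * U i (x i) \<le> F + (2 * U i y + 1)"
        using x(2) unfolding xe by (metis add.assoc add_right_mono less_imp_le order_trans)
      moreover have "F \<noteq> top" using fin unfolding xe by auto
      ultimately show ?thesis by (simp add: ennreal_add_left_cancel_le)
    qed
    have "2 * riesz_energy d N x = (\<Sum>i<N. 2 * U i (x i))"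
      by (simp add: riesz_energy_def U_def sum_distrib_left)
    also have "\<dots> \<le> (\<Sum>i<N. 2 * U i y + 1)" by (intro sum_mono step) simp
    \<comment> \<open>Completing \<open>U i y\<close> by the missing i-th term gives the full
      potential at y; raising 1 to 2 lets the common factor 2 be cancelled.\<close>
    also have "\<dots> \<le> (\<Sum>i<N. 2 * (\<Sum>j<N. ?k y (x j)) + 2)"
      unfolding U_def by (intro sum_mono add_mono mult_left_mono sum_mono2) auto
    also have "\<dots> = 2 * (of_nat N * (\<Sum>j<N. ?k y (x j)) + of_nat N)"
      by (simp add: algebra_simps)
    finally show "riesz_energy d N x \<le> of_nat N * (\<Sum>j<N. ?k y (x j)) + of_nat N"
      by (subst (asm) ennreal_mult_le_mult_iff) auto
  qed
qed

text \<open>The preceding bound is evaluated at a y where the potential is within 1 of its infimum;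
  this accounts for the second \<open>of_nat N\<close>.\<close>

lemma riesz_energy_le_max_polarization:
  fixes A :: "'a::metric_space set"
  assumes A: "infinite A" and N: "N > 0" and d: "d > 0"
  obtains x where "\<And>i. i < N \<Longrightarrow> x i \<in> A"
    "riesz_energy d N x \<le> of_nat N * max_polarization (real d) N A + 2 * of_nat N"
proof -
  obtain x where x: "\<And>i. i < N \<Longrightarrow> x i \<in> A"
    "\<And>y. y \<in> A \<Longrightarrow> riesz_energy d N x \<le> of_nat N * (\<Sum>j<N. riesz_kernel d y (x j)) + of_nat N"
    by (rule riesz_energy_le_polarization[OF A N]) (rule that; assumption)
  define \<omega> where "\<omega> = image_mset x (mset_set {..<N})"
  have \<omega>: "(\<Sum>z\<in>#\<omega>. riesz_kernel d y z) = (\<Sum>j<N. riesz_kernel d y (x j))" for y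
    by (simp add: \<omega>_def image_mset.compositionality comp_def sum_unfold_sum_mset)
  have conf: "configuration N A \<omega>" using x(1) by (auto simp: configuration_def \<omega>_def)
  define p where "p = polarization (real d) \<omega> A"
  have pM: "p \<le> max_polarization (real d) N A"
    unfolding max_polarization_def p_def using conf by (intro SUP_upper) auto
  have "riesz_energy d N x \<le> of_nat N * p + 2 * of_nat N"
  proof (cases "p = top")
    case True
    then show ?thesis using N by (simp add: ennreal_mult_top)
  next
    case False
    then have "\<exists>y\<in>A. (\<Sum>j<N. riesz_kernel d y (x j)) < p + ennreal 1"
      using polarization_eq[OF d, of \<omega> A] by (intro INF_approx_ennreal) (auto simp: p_def \<omega>)
    then obtain y where y: "y \<in> A" "(\<Sum>j<N. riesz_kernel d y (x j)) \<le> p + 1" by (auto intro: less_imp_le)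
    have "riesz_energy d N x \<le> of_nat N * (\<Sum>j<N. riesz_kernel d y (x j)) + of_nat N" by (rule x(2)[OF y(1)])
    also have "\<dots> \<le> of_nat N * (p + 1) + of_nat N" by (intro add_right_mono mult_left_mono y) simp
    also have "\<dots> = of_nat N * p + 2 * of_nat N" by (simp add: distrib_left mult_2 add.assoc)
    finally show ?thesis .
  qed
  also have "\<dots> \<le> of_nat N * max_polarization (real d) N A + 2 * of_nat N"
    by (intro add_right_mono mult_left_mono pM) simp
  finally show ?thesis using x(1) that by blast
qed


lemma eventually_ln_ge: "eventually (\<lambda>N. b \<le> ln (real N)) sequentially"
proof -
  have "filterlim (\<lambda>N. ln (real N)) at_top sequentially"
    using ln_at_top filterlim_real_sequentially by (rule filterlim_compose)
  then show ?thesis by (simp add: filterlim_at_top)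
qed

text \<open>If the polarization were below c N ln N, the upper and lower energy bounds, divided by
  N^2, would leave s ln N bounded by a constant, with s = \<beta> / V - (1 + e)^d c > 0.\<close>

lemma max_polarization_lower:
  fixes \<psi> :: "nat \<Rightarrow> real^'m \<Rightarrow> real^'d::finite"
  assumes e: "e \<ge> 0" and P: "\<And>k. k < n \<Longrightarrow> compact (P k)"
    and ai: "\<And>k. k < n \<Longrightarrow> almost_isometry e (\<psi> k) (P k)"
    and A: "A = (\<Union>k<n. P k)" "infinite A"
    and V: "(\<Sum>k<n. emeasure lborel (\<psi> k ` P k)) < ennreal V" "V > 0"
    and c: "c \<ge> 0" "c * (1 + e) ^ CARD('d) * V < unit_ball_vol CARD('d)"
  shows "eventually (\<lambda>N. ennreal (c * (real N * ln (real N))) \<le> max_polarization (real CARD('d)) N A) sequentially"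
proof -
  let ?d = "CARD('d)"
  let ?\<beta> = "unit_ball_vol ?d"
  define a where "a = (1 + e) ^ ?d"
  have a: "a > 0" using e by (simp add: a_def)
  obtain R where R: "R > 0" and energy:
    "\<And>N x. 1 \<le> R * root ?d (real N) \<Longrightarrow> x ` {..<N} \<subseteq> (\<Union>k<n. P k) \<Longrightarrow>
      ennreal ((real N)\<^sup>2 * (?\<beta> * (ln (real N) + real ?d * ln R)) / V)
      \<le> ennreal ((1 + e) ^ ?d) * riesz_energy ?d N x + ennreal ((real N)\<^sup>2)"
    by (rule riesz_energy_lower_bound[OF e _ _ V(1)]) (erule P | erule ai | (rule that; assumption))+
  define s where "s = ?\<beta> / V - a * c"
  have s: "s > 0" using c(2) V(2) by (simp add: s_def a_def field_simps)
  \<comment> \<open>The contradictory inequality will read s ln N \<le> s t, so ln N \<ge> t + 1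
    excludes it.\<close>
  define t where "t = (1 + 2 * a - ?\<beta> * (real ?d * ln R) / V) / s"
  have "eventually (\<lambda>N. t + 1 \<le> ln (real N)) sequentially" by (rule eventually_ln_ge)
  moreover have "eventually (\<lambda>N. (1 / R) ^ ?d \<le> real N) sequentially"
    using filterlim_real_sequentially by (auto simp: filterlim_at_top)
  ultimately show ?thesis
    using eventually_gt_at_top[of 0]
  proof eventually_elim
    case (elim N)
    have N: "real N \<ge> 1" using elim(3) by simp
    have R1: "1 \<le> R * root ?d (real N)"
    proof -
      have "1 / R = root ?d ((1 / R) ^ ?d)" using R by (simp add: real_root_power_cancel)
      also have "\<dots> \<le> root ?d (real N)" using elim(2) by simp
      finally show ?thesis using R by (simp add: field_simps)
    qed
    obtain x where x: "\<And>i. i < N \<Longrightarrow> x i \<in> A"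
      "riesz_energy ?d N x \<le> of_nat N * max_polarization (real ?d) N A + 2 * of_nat N"
      by (rule riesz_energy_le_max_polarization[OF A(2) elim(3) card_UNIV_pos]) (rule that; assumption)
    show ?case
    proof (rule ccontr)
      assume "\<not> ?case"
      then have less: "max_polarization (real ?d) N A < ennreal (c * (real N * ln (real N)))" by simp
      define m where "m = enn2real (max_polarization (real ?d) N A)"
      have m: "max_polarization (real ?d) N A = ennreal m" "m \<ge> 0"
        using less by (auto simp: m_def less_top[symmetric] intro!: ennreal_enn2real[symmetric] dest: order.strict_trans[OF _ ennreal_less_top])
      have mle: "m \<le> c * (real N * ln (real N))"
        using less m c(1) N by (simp add: ennreal_less_iff)
      have "ennreal ((real N)\<^sup>2 * (?\<beta> * (ln (real N) + real ?d * ln R)) / V)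
        \<le> ennreal a * riesz_energy ?d N x + ennreal ((real N)\<^sup>2)"
        unfolding a_def using x(1) by (intro energy R1) (auto simp: A)
      also have "\<dots> \<le> ennreal a * (of_nat N * max_polarization (real ?d) N A + 2 * of_nat N) + ennreal ((real N)\<^sup>2)"
        by (intro add_right_mono mult_left_mono x) simp
      also have "\<dots> = ennreal (a * (real N * m + 2 * real N) + (real N)\<^sup>2)"
        using a m(2) unfolding m(1)
        by (simp add: ennreal_of_nat_eq_real_of_nat flip: ennreal_mult ennreal_plus ennreal_numeral)
      finally have "(real N)\<^sup>2 * (?\<beta> * (ln (real N) + real ?d * ln R)) / V \<le> a * (real N * m + 2 * real N) + (real N)\<^sup>2"
        using a m(2) by (subst (asm) ennreal_le_iff) auto
      also have "\<dots> \<le> a * (real N * (c * (real N * ln (real N))) + 2 * (real N)\<^sup>2) + (real N)\<^sup>2"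
        using a N mle by (intro add_right_mono mult_left_mono add_mono) (auto simp: power2_eq_square)
      also have "\<dots> = (real N)\<^sup>2 * (a * c * ln (real N) + 2 * a + 1)"
        by (simp add: power2_eq_square algebra_simps)
      finally have "(real N)\<^sup>2 * (?\<beta> * (ln (real N) + real ?d * ln R) / V) \<le> (real N)\<^sup>2 * (a * c * ln (real N) + 2 * a + 1)"
        by simp
      then have "?\<beta> * (ln (real N) + real ?d * ln R) / V \<le> a * c * ln (real N) + 2 * a + 1"
        using N by (subst (asm) mult_le_cancel_left_pos) auto
      then have "s * ln (real N) \<le> 1 + 2 * a - ?\<beta> * (real ?d * ln R) / V"
        by (simp add: s_def algebra_simps add_divide_distrib)
      moreover have "1 + 2 * a - ?\<beta> * (real ?d * ln R) / V < s * ln (real N)"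
        using elim(1) s less_le_trans[of t "t + 1" "ln (real N)"] by (simp add: t_def divide_less_eq mult.commute)
      ultimately show False by simp
    qed
  qed
qed

section \<open>Upper bound for the polarization of a configuration\<close>

lemma riesz_kernel_measurable [measurable]: "(\<lambda>y. riesz_kernel d y (x :: real^'m)) \<in> borel_measurable borel"
  unfolding riesz_kernel_def by measurable

text \<open>The layer cake formula \<open>s\<^bsup>-d\<^esup> = \<rho>\<^bsup>-d\<^esup> + \<integral>\<^bsub>s\<^esub>\<^bsup>\<rho>\<^esup> d t\<^bsup>-d-1\<^esup> dt\<close>.\<close>

lemma riesz_kernel_layer:
  assumes "0 < r" "r \<le> \<rho>" "d > 0" "r \<le> dist y x"
  shows "riesz_kernel d y x \<le> ennreal (1 / \<rho> ^ d) +
    (\<integral>\<^sup>+t. ennreal (real d / t ^ Suc d) * indicator {r..\<rho>} t * indicator {dist y x..} t \<partial>lborel)"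
proof -
  define s where "s = dist y x"
  have s: "s > 0" "r \<le> s" using assms by (auto simp: s_def)
  have k: "riesz_kernel d y x = ennreal (1 / s ^ d)"
    using s by (simp add: riesz_kernel_def s_def[symmetric] divide_ennreal flip: ennreal_1)
  show ?thesis
  proof (cases "s \<le> \<rho>")
    case False
    then have "1 / s ^ d \<le> 1 / \<rho> ^ d" using assms by (intro divide_left_mono power_mono) auto
    then show ?thesis unfolding k by (meson ennreal_leI le_iff_add order_trans)
  next
    case True
    have der: "((\<lambda>t. - 1 / t ^ d) has_real_derivative real d / t ^ Suc d) (at t)" if "s \<le> t" for t
    proof -
      have t: "t > 0" using s that by simp
      have "((\<lambda>t. - 1 / t ^ d) has_real_derivative real d * t ^ (d - 1) / (t ^ d * t ^ d)) (at t)"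
        using t by (auto intro!: derivative_eq_intros)
      moreover have "real d * t ^ (d - 1) / (t ^ d * t ^ d) = real d / t ^ Suc d"
        using t assms(3) by (cases d) (auto simp: field_simps)
      ultimately show ?thesis by simp
    qed
    have "(\<integral>\<^sup>+t. ennreal (real d / t ^ Suc d) * indicator {r..\<rho>} t * indicator {s..} t \<partial>lborel)
       = (\<integral>\<^sup>+t. ennreal (real d / t ^ Suc d) * indicator {s..\<rho>} t \<partial>lborel)"
      using s by (intro nn_integral_cong) (auto split: split_indicator)
    also have "\<dots> = ennreal (- 1 / \<rho> ^ d - (- 1 / s ^ d))"
      using s True by (intro nn_integral_FTC_Icc der) auto
    finally have "ennreal (1 / \<rho> ^ d) + (\<integral>\<^sup>+t. ennreal (real d / t ^ Suc d) * indicator {r..\<rho>} t * indicator {s..} t \<partial>lborel)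
      = ennreal (1 / \<rho> ^ d + (- 1 / \<rho> ^ d - (- 1 / s ^ d)))"
      using assms s True by (subst ennreal_plus) (auto simp: frac_le power_mono)
    then show ?thesis unfolding k s_def[symmetric] by simp
  qed
qed

text \<open>Fubini's theorem in the layer cake formula: the inner integral is the measure of a ball,
  at most C t^d, which leaves C d / t between r and \<rho>.\<close>

lemma riesz_potential_upper_bound:
  fixes M :: "(real^'m) measure"
  assumes M: "finite_measure M" "sets M = sets borel" and d: "d > 0" and C: "C \<ge> 0"
    and ball: "\<And>t. 0 \<le> t \<Longrightarrow> t \<le> \<rho> \<Longrightarrow> emeasure M (cball x t) \<le> ennreal (C * t ^ d)"
    and r: "0 < r" "r \<le> \<rho>"
  shows "(\<integral>\<^sup>+y. riesz_kernel d y x * indicator (- ball x r) y \<partial>M)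
    \<le> ennreal (C * (real d * ln (\<rho> / r)) + measure M UNIV / \<rho> ^ d)" (is "?I \<le> _")
proof -
  interpret finite_measure M by fact
  interpret P: pair_sigma_finite M lborel ..
  have sp: "space M = UNIV" using sets_eq_imp_space_eq[OF M(2)] by simp
  note [measurable_cong] = M(2)
  let ?w = "\<lambda>t. ennreal (real d / t ^ Suc d) * indicator {r..\<rho>} t"
  have "?I
     \<le> (\<integral>\<^sup>+y. ennreal (1 / \<rho> ^ d) + (\<integral>\<^sup>+t. ?w t * indicator {dist y x..} t \<partial>lborel) \<partial>M)"
  proof (intro nn_integral_mono)
    fix y
    show "riesz_kernel d y x * indicator (- ball x r) y \<le> ennreal (1 / \<rho> ^ d) + (\<integral>\<^sup>+t. ?w t * indicator {dist y x..} t \<partial>lborel)"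
      using riesz_kernel_layer[OF r d, of y x] by (auto simp: dist_commute split: split_indicator)
  qed
  also have "\<dots> = (\<integral>\<^sup>+y. ennreal (1 / \<rho> ^ d) \<partial>M) + (\<integral>\<^sup>+y. (\<integral>\<^sup>+t. ?w t * indicator {dist y x..} t \<partial>lborel) \<partial>M)"
    by (rule nn_integral_add) (auto simp: indicator_def[of "{dist _ _..}"])
  also have "(\<integral>\<^sup>+y. ennreal (1 / \<rho> ^ d) \<partial>M) = ennreal (measure M UNIV / \<rho> ^ d)"
    using r by (simp add: sp emeasure_eq_measure divide_inverse mult.commute ennreal_mult)
  also have "(\<integral>\<^sup>+y. (\<integral>\<^sup>+t. ?w t * indicator {dist y x..} t \<partial>lborel) \<partial>M)
     = (\<integral>\<^sup>+t. (\<integral>\<^sup>+y. ?w t * indicator {dist y x..} t \<partial>M) \<partial>lborel)"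
    by (rule P.Fubini'[symmetric]) (simp add: indicator_def[of "{dist _ _..}"])
  also have "\<dots> = (\<integral>\<^sup>+t. ?w t * emeasure M (cball x t) \<partial>lborel)"
  proof (intro nn_integral_cong)
    fix t :: real
    have "(\<integral>\<^sup>+y. ?w t * indicator {dist y x..} t \<partial>M) = (\<integral>\<^sup>+y. ?w t * indicator (cball x t) y \<partial>M)"
      by (intro nn_integral_cong) (auto simp: dist_commute split: split_indicator)
    also have "\<dots> = ?w t * emeasure M (cball x t)"
      by (rule nn_integral_cmult_indicator) (simp add: M(2))
    finally show "(\<integral>\<^sup>+y. ?w t * indicator {dist y x..} t \<partial>M) = ?w t * emeasure M (cball x t)" .
  qed
  also have "\<dots> \<le> (\<integral>\<^sup>+t. ennreal (C * real d * (1 / t)) * indicator {r..\<rho>} t \<partial>lborel)"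
  proof (intro nn_integral_mono)
    fix t :: real
    show "?w t * emeasure M (cball x t) \<le> ennreal (C * real d * (1 / t)) * indicator {r..\<rho>} t"
    proof (cases "t \<in> {r..\<rho>}")
      case True
      then have t: "t > 0" "t \<le> \<rho>" using r by auto
      have "?w t * emeasure M (cball x t) \<le> ennreal (real d / t ^ Suc d) * ennreal (C * t ^ d)"
        using True t by (auto intro!: mult_left_mono ball)
      also have "\<dots> = ennreal (real d / t ^ Suc d * (C * t ^ d))"
        using t C by (intro ennreal_mult[symmetric]) auto
      also have "real d / t ^ Suc d * (C * t ^ d) = C * real d * (1 / t)"
        using t by (simp add: field_simps)
      finally show ?thesis using True by simp
    qed auto
  qed
  also have "\<dots> = ennreal (C * real d * ln \<rho> - C * real d * ln r)"
    using r C by (intro nn_integral_FTC_Icc) (auto intro!: derivative_eq_intros)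
  also have "C * real d * ln \<rho> - C * real d * ln r = C * (real d * ln (\<rho> / r))"
    using r by (simp add: ln_div algebra_simps)
  finally have "?I
    \<le> ennreal (measure M UNIV / \<rho> ^ d) + ennreal (C * (real d * ln (\<rho> / r)))"
    by (simp add: add_left_mono)
  also have "\<dots> = ennreal (C * (real d * ln (\<rho> / r)) + measure M UNIV / \<rho> ^ d)"
    using r C by (subst ennreal_plus[symmetric]) (auto simp: add.commute)
  finally show ?thesis .
qed

text \<open>The potential is averaged over \<open>K\<close> minus small balls around the points; only points close to \<open>K\<close>
  contribute a logarithm.\<close>

lemma polarization_average_bound:
  fixes M :: "(real^'m) measure" and x :: "nat \<Rightarrow> real^'m"
  assumes M: "finite_measure M" "sets M = sets borel" and d: "d > 0" and C: "C \<ge> 0"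
    and ball: "\<And>x t. 0 \<le> t \<Longrightarrow> t \<le> \<rho> \<Longrightarrow> emeasure M (cball x t) \<le> ennreal (C * t ^ d)"
    and K: "K \<in> sets borel" "K \<subseteq> A" "emeasure M (- K) = 0"
    and r: "0 < r" "r \<le> \<rho>" and h: "h > 0"
    and J: "J \<subseteq> {..<N}" "\<And>i y. i < N \<Longrightarrow> i \<notin> J \<Longrightarrow> y \<in> K \<Longrightarrow> h \<le> dist y (x i)"
  shows "(INF y\<in>A. \<Sum>i<N. riesz_kernel d y (x i)) * ennreal (measure M UNIV - real N * (C * r ^ d))
    \<le> ennreal (real (card J) * (C * (real d * ln (\<rho> / r)) + measure M UNIV / \<rho> ^ d)
         + real N * (measure M UNIV / h ^ d))"
proof -
  interpret finite_measure M by fact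
  have sp: "space M = UNIV" using sets_eq_imp_space_eq[OF M(2)] by simp
  note [measurable_cong] = M(2)
  define p where "p = (INF y\<in>A. \<Sum>i<N. riesz_kernel d y (x i))"
  \<comment> \<open>Outside these balls every potential has a finite average, even if K contains
    points of the configuration.\<close>
  define D where "D = K - (\<Union>i<N. ball (x i) r)"
  have D[measurable]: "D \<in> sets borel" using K(1) unfolding D_def by (intro sets.Diff sets.finite_UN) auto
  let ?m = "measure M UNIV" and ?B = "C * (real d * ln (\<rho> / r)) + measure M UNIV / \<rho> ^ d"
  have B0: "?B \<ge> 0" using r C by (intro add_nonneg_nonneg mult_nonneg_nonneg) auto
  have mD: "?m - real N * (C * r ^ d) \<le> measure M D"
  proof -
    have "UNIV = D \<union> (- K \<union> (\<Union>i<N. cball (x i) r))" by (auto simp: D_def)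
    then have "?m \<le> measure M (D \<union> (- K \<union> (\<Union>i<N. cball (x i) r)))" by simp
    also have "\<dots> \<le> measure M D + (measure M (- K) + measure M (\<Union>i<N. cball (x i) r))"
      using K(1) by (intro order_trans[OF measure_Un_le] add_left_mono measure_Un_le) (auto simp: M(2) Compl_eq_Diff_UNIV)
    also have "measure M (- K) = 0" using K(3) by (simp add: measure_def)
    also have "measure M (\<Union>i<N. cball (x i) r) \<le> (\<Sum>i<N. measure M (cball (x i) r))"
      by (intro finite_measure_subadditive_finite) (auto simp: M(2))
    also have "\<dots> \<le> (\<Sum>i<N. C * r ^ d)"
    proof (intro sum_mono)
      fix i
      have "emeasure M (cball (x i) r) \<le> ennreal (C * r ^ d)" using r by (intro ball) auto
      then show "measure M (cball (x i) r) \<le> C * r ^ d"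
        using C r by (simp add: emeasure_eq_measure)
    qed
    finally show ?thesis by simp
  qed
  have "p * ennreal (?m - real N * (C * r ^ d)) \<le> p * emeasure M D"
    unfolding emeasure_eq_measure by (intro mult_left_mono ennreal_leI mD) simp
  also have "\<dots> = (\<integral>\<^sup>+y. p * indicator D y \<partial>M)" by (simp add: nn_integral_cmult_indicator M(2))
  also have "\<dots> \<le> (\<integral>\<^sup>+y. (\<Sum>i<N. riesz_kernel d y (x i) * indicator D y) \<partial>M)"
  proof (intro nn_integral_mono)
    fix y
    show "p * indicator D y \<le> (\<Sum>i<N. riesz_kernel d y (x i) * indicator D y)"
    proof (cases "y \<in> D")
      case True
      then have "y \<in> A" using K(2) by (auto simp: D_def)
      then have "p \<le> (\<Sum>i<N. riesz_kernel d y (x i))" unfolding p_def by (rule INF_lower)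
      then show ?thesis using True by simp
    qed simp
  qed
  also have "\<dots> = (\<Sum>i<N. \<integral>\<^sup>+y. riesz_kernel d y (x i) * indicator D y \<partial>M)"
    by (intro nn_integral_sum) measurable
  \<comment> \<open>The bound for far points is granted to every index; in total it is of order N
    and loses against N ln N.\<close>
  also have "\<dots> \<le> (\<Sum>i<N. ennreal ((if i \<in> J then ?B else 0) + ?m / h ^ d))"
  proof (intro sum_mono)
    fix i assume "i \<in> {..<N}"
    then have i: "i < N" by simp
    show "(\<integral>\<^sup>+y. riesz_kernel d y (x i) * indicator D y \<partial>M) \<le> ennreal ((if i \<in> J then ?B else 0) + ?m / h ^ d)"
    proof (cases "i \<in> J")
      case True
      have "(\<integral>\<^sup>+y. riesz_kernel d y (x i) * indicator D y \<partial>M) \<le> (\<integral>\<^sup>+y. riesz_kernel d y (x i) * indicator (- ball (x i) r) y \<partial>M)"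
        using i by (intro nn_integral_mono) (auto simp: D_def split: split_indicator)
      also have "\<dots> \<le> ennreal ?B" by (rule riesz_potential_upper_bound[OF M d C ball r])
      also have "\<dots> \<le> ennreal (?B + ?m / h ^ d)" using h by (intro ennreal_leI) simp
      finally show ?thesis using True by simp
    next
      case False
      have "(\<integral>\<^sup>+y. riesz_kernel d y (x i) * indicator D y \<partial>M) \<le> (\<integral>\<^sup>+y. ennreal (1 / h ^ d) \<partial>M)"
      proof (intro nn_integral_mono)
        fix y
        show "riesz_kernel d y (x i) * indicator D y \<le> ennreal (1 / h ^ d)"
        proof (cases "y \<in> D")
          case True
          then have le: "h \<le> dist y (x i)" using J(2)[OF i False] by (auto simp: D_def)
          then have "riesz_kernel d y (x i) = ennreal (1 / dist y (x i) ^ d)"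
            unfolding riesz_kernel_def ennreal_1[symmetric] using less_le_trans[OF h le] by (intro divide_ennreal) auto
          also have "\<dots> \<le> ennreal (1 / h ^ d)"
            using le h less_le_trans[OF h le]
            by (intro ennreal_leI divide_left_mono power_mono mult_pos_pos zero_less_power) auto
          finally show ?thesis using True by simp
        qed simp
      qed
      also have "\<dots> = ennreal (?m / h ^ d)"
        using h by (simp add: sp emeasure_eq_measure divide_inverse mult.commute ennreal_mult)
      finally show ?thesis using False by simp
    qed
  qed
  also have "\<dots> = ennreal (\<Sum>i<N. (if i \<in> J then ?B else 0) + ?m / h ^ d)"
    using B0 h by (intro sum_ennreal) auto
  also have "(\<Sum>i<N. (if i \<in> J then ?B else 0) + ?m / h ^ d) = real (card J) * ?B + real N * (?m / h ^ d)"
  proof -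
    have "{..<N} \<inter> J = J" using J(1) by auto
    then show ?thesis by (simp add: sum.distrib sum.If_cases Int_def[symmetric])
  qed
  finally show ?thesis unfolding p_def .
qed


section \<open>Counting the points in an open set\<close>

lemma multiset_indexed:
  obtains x where "\<omega> = image_mset x (mset_set {..<size \<omega>})"
proof -
  obtain xs where xs: "mset xs = \<omega>" using ex_mset by blast
  have "\<omega> = mset (map (nth xs) [0..<length xs])" by (simp add: map_nth xs)
  also have "\<dots> = image_mset (nth xs) (mset_set {..<size \<omega>})"
    by (simp add: atLeast0LessThan flip: xs)
  finally show ?thesis by (rule that)
qed

lemma polarization_indexed:
  assumes "d > 0"
  shows "polarization (real d) (image_mset x (mset_set {..<N})) A = (INF y\<in>A. \<Sum>i<N. riesz_kernel d y (x i))"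
  by (simp add: polarization_eq[OF assms] image_mset.compositionality comp_def sum_unfold_sum_mset)

text \<open>Of the loss \<delta> in a - \<delta>, one half pays for passing from
  \<open>A \<inter> G\<close> to the compact K and the other for the removed balls. The threshold
  for N does not depend on the configuration, so the bound survives the supremum over
  configurations.\<close>

lemma polarization_count_bound:
  fixes A G :: "(real^'m) set"
  assumes pieces: "\<And>e. e > 0 \<Longrightarrow> \<exists>n Q (\<psi> :: nat \<Rightarrow> real^'m \<Rightarrow> real^'d::finite).
      (\<forall>i<n. compact (Q i) \<and> almost_isometry e (\<psi> i) (Q i)) \<and> A = (\<Union>i<n. Q i)"
    and G: "open G" and \<delta>: "\<delta> > 0"
    and a: "emeasure (hausdorff_measure TYPE('d)) (A \<inter> G) = ennreal a" "a \<ge> 0"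
  shows "eventually (\<lambda>N. \<forall>x. x ` {..<N} \<subseteq> A \<longrightarrow>
    (INF y\<in>A. \<Sum>i<N. riesz_kernel CARD('d) y (x i)) * ennreal (a - \<delta>)
      \<le> ennreal (real N * ln (real N) *
          (unit_ball_vol CARD('d) * (1 + \<delta>) * (real (card {i\<in>{..<N}. x i \<in> G}) / real N) + \<delta>))) sequentially"
proof -
  let ?d = "CARD('d)" and ?\<beta> = "unit_ball_vol CARD('d)"
  let ?H = "hausdorff_measure TYPE('d) :: (real^'m) measure"
  \<comment> \<open>Makes the distortion (1 + e)^d equal to 1 + \<delta>.\<close>
  define e where "e = root ?d (1 + \<delta>) - 1"
  have e: "e > 0" "(1 + e) ^ ?d = 1 + \<delta>"
    using \<delta> by (auto simp: e_def real_root_gt_1_iff)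
  obtain n Q and \<psi> :: "nat \<Rightarrow> real^'m \<Rightarrow> real^'d"
    where Q: "\<forall>i<n. compact (Q i) \<and> almost_isometry e (\<psi> i) (Q i)" and A: "A = (\<Union>i<n. Q i)"
    using pieces[OF e(1)] by blast
  obtain K \<rho> where K: "compact K" "K \<subseteq> A \<inter> G" and \<rho>: "\<rho> > 0"
    and HK: "emeasure ?H (A \<inter> G) \<le> emeasure ?H K + ennreal (\<delta> / 2)"
    and ball: "\<And>x t. 0 \<le> t \<Longrightarrow> t \<le> \<rho> \<Longrightarrow> emeasure ?H (K \<inter> cball x t) \<le> ennreal ((1 + e) ^ ?d * ?\<beta> * t ^ ?d)"
  proof (rule upper_regular_compact_subset[of e n Q \<psi> A G "\<delta> / 2"])
    show "e \<ge> 0" using e by simp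
    show "compact (Q i)" "almost_isometry e (\<psi> i) (Q i)" if "i < n" for i using Q that by auto
    show "A = (\<Union>i<n. Q i)" by (rule A)
    show "open G" by (rule G)
    show "\<delta> / 2 > 0" using \<delta> by simp
  qed (rule that; assumption)
  have Kb: "K \<in> sets borel" using K(1) by (rule borel_compact)
  have Ab: "A \<in> sets borel" unfolding A using Q by (auto intro!: borel_compact)
  have HKa: "emeasure ?H K \<le> ennreal a"
    unfolding a(1)[symmetric] using K(2) Ab G by (intro emeasure_mono) auto
  define M where "M = density ?H (indicator K)"
  have Msets: "sets M = sets borel" by (simp add: M_def)
  have M: "emeasure M X = emeasure ?H (K \<inter> X)" if "X \<in> sets borel" for X
    unfolding M_def using that Kb by (simp add: emeasure_restricted)
  have Mfin: "finite_measure M"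
    using M[of UNIV] HKa by (intro finite_measureI) (auto simp: M_def top_unique)
  then interpret M: finite_measure M .
  define m where "m = measure M UNIV"
  have m: "m \<ge> 0" "a \<le> m + \<delta> / 2"
  proof -
    have "ennreal a \<le> ennreal m + ennreal (\<delta> / 2)"
      using HK M[of UNIV] unfolding a(1) by (simp add: m_def M.emeasure_eq_measure)
    also have "\<dots> = ennreal (m + \<delta> / 2)" using \<delta> by (simp add: m_def)
    finally show "a \<le> m + \<delta> / 2" using \<delta> by (subst (asm) ennreal_le_iff) (auto simp: m_def)
  qed (simp add: m_def)
  define C where "C = ?\<beta> * (1 + \<delta>)"
  have C: "C > 0" using \<delta> by (simp add: C_def)
  have Mball: "emeasure M (cball x t) \<le> ennreal (C * t ^ ?d)" if "0 \<le> t" "t \<le> \<rho>" for x t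
    using ball[OF that, of x] M[of "cball x t"] by (simp add: C_def e(2) mult_ac)
  \<comment> \<open>A point within distance h of K lies in G, so points outside G never need the
    logarithmic bound.\<close>
  obtain h where h: "h > 0" "(\<Union>y\<in>K. cball y h) \<subseteq> G"
  proof (rule compact_subset_open_imp_cball_epsilon_subset[OF K(1) G])
    show "K \<subseteq> G" using K(2) by blast
  qed (rule that; assumption)
  \<comment> \<open>N balls of radius r0 N^(-1/d) have total measure at most C r0^d, which is
    \<delta> / 2.\<close>
  define r0 where "r0 = root ?d (\<delta> / (2 * C))"
  have r0: "r0 > 0" "C * r0 ^ ?d = \<delta> / 2"
    using \<delta> C by (auto simp: r0_def real_root_gt_0_iff)
  \<comment> \<open>Per point, everything that does not carry ln N; for large N it is absorbed by
    \<delta> ln N.\<close>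
  define b where "b = \<bar>C * (real ?d * ln (\<rho> / r0))\<bar> + m / \<rho> ^ ?d + m / h ^ ?d"
  have "eventually (\<lambda>N. (r0 / \<rho>) ^ ?d \<le> real N) sequentially"
    using filterlim_real_sequentially by (auto simp: filterlim_at_top)
  then show ?thesis
    using eventually_ln_ge[of "b / \<delta>"] eventually_gt_at_top[of 0]
  proof eventually_elim
    case (elim N)
    have N: "real N > 0" using elim(3) by simp
    define q where "q = root ?d (real N)"
    have q: "q > 0" "q ^ ?d = real N" using N by (auto simp: q_def)
    have "r0 / \<rho> = root ?d ((r0 / \<rho>) ^ ?d)" using r0 \<rho> by (simp add: real_root_power_cancel)
    also have "\<dots> \<le> q" unfolding q_def using elim(1) by simp
    finally have rq: "r0 / q \<le> \<rho>" using \<rho> q by (simp add: field_simps)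
    have lnq: "real ?d * ln (\<rho> / (r0 / q)) = real ?d * ln (\<rho> / r0) + ln (real N)"
      using q \<rho> r0 by (simp add: ln_mult ln_div ln_realpow algebra_simps flip: q(2))
    have Nr: "real N * (C * (r0 / q) ^ ?d) = \<delta> / 2"
      using q r0 by (simp add: power_divide flip: q(2))
    show ?case
    proof (intro allI impI)
      fix x assume x: "x ` {..<N} \<subseteq> A"
      define J where "J = {i\<in>{..<N}. x i \<in> G}"
      define g where "g = real (card J)"
      have g: "0 \<le> g" "g \<le> real N"
        using card_mono[of "{..<N}" J] by (auto simp: g_def J_def)
      let ?p = "INF y\<in>A. \<Sum>i<N. riesz_kernel ?d y (x i)"
      have "?p * ennreal (a - \<delta>) \<le> ?p * ennreal (measure M UNIV - real N * (C * (r0 / q) ^ ?d))"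
        using m by (intro mult_left_mono ennreal_leI) (auto simp: Nr m_def[symmetric])
      also have "\<dots> \<le> ennreal (real (card J) * (C * (real ?d * ln (\<rho> / (r0 / q))) + measure M UNIV / \<rho> ^ ?d)
         + real N * (measure M UNIV / h ^ ?d))"
      proof (rule polarization_average_bound[OF Mfin Msets card_UNIV_pos _ Mball Kb _ _ _ rq h(1)])
        show "K \<subseteq> A" using K by blast
        show "emeasure M (- K) = 0" using M[of "- K"] Kb by (simp add: Compl_eq_Diff_UNIV)
        show "h \<le> dist y (x i)" if "i < N" "i \<notin> J" "y \<in> K" for i y
        proof (rule ccontr)
          assume "\<not> h \<le> dist y (x i)"
          then have "x i \<in> cball y h" by simp
          then have "x i \<in> G" using h(2) that(3) by blast
          then show False using that by (simp add: J_def)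
        qed
      qed (use C r0 q in \<open>auto simp: J_def\<close>)
      also have "\<dots> \<le> ennreal (real N * ln (real N) * (?\<beta> * (1 + \<delta>) * (g / real N) + \<delta>))"
      proof (rule ennreal_leI)
        have "g * (C * (real ?d * ln (\<rho> / r0)) + m / \<rho> ^ ?d) \<le> real N * (\<bar>C * (real ?d * ln (\<rho> / r0))\<bar> + m / \<rho> ^ ?d)"
          using g m \<rho> by (intro order_trans[OF mult_left_mono mult_right_mono]) auto
        then have "g * (C * (real ?d * ln (\<rho> / r0)) + m / \<rho> ^ ?d) + real N * (m / h ^ ?d) \<le> real N * b"
          by (simp add: b_def algebra_simps)
        also have "\<dots> \<le> real N * (\<delta> * ln (real N))"
          using elim(2) N \<delta> by (intro mult_left_mono) (auto simp: field_simps)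
        finally have "g * (C * (real ?d * ln (\<rho> / r0)) + m / \<rho> ^ ?d) + real N * (m / h ^ ?d) + g * (C * ln (real N))
           \<le> real N * (\<delta> * ln (real N)) + g * (C * ln (real N))" by simp
        moreover have "real N * ln (real N) * (?\<beta> * (1 + \<delta>) * (g / real N) + \<delta>)
           = real N * (\<delta> * ln (real N)) + g * (C * ln (real N))"
          using N by (simp add: C_def field_simps)
        ultimately show "real (card J) * (C * (real ?d * ln (\<rho> / (r0 / q))) + measure M UNIV / \<rho> ^ ?d)
         + real N * (measure M UNIV / h ^ ?d) \<le> real N * ln (real N) * (?\<beta> * (1 + \<delta>) * (g / real N) + \<delta>)"
          unfolding lnq g_def[symmetric] m_def[symmetric] by (simp add: algebra_simps)
      qed
      finally show "?p * ennreal (a - \<delta>) \<le> ennreal (real N * ln (real N) *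
          (?\<beta> * (1 + \<delta>) * (real (card {i\<in>{..<N}. x i \<in> G}) / real N) + \<delta>))"
        by (simp add: g_def J_def)
    qed
  qed
qed

section \<open>Weak convergence from lower bounds on open sets\<close>

lemma count_below:
  fixes z :: real
  assumes "0 \<le> z" "z \<le> real K"
  shows "z - 1 \<le> real (card {j\<in>{1..K}. real j < z})" "real (card {j\<in>{1..K}. real j < z}) \<le> z"
proof -
  have "{j\<in>{1..K}. real j < z} = {1..nat (\<lceil>z\<rceil> - 1)}"
  proof (intro set_eqI iffI)
    fix j assume "j \<in> {1..nat (\<lceil>z\<rceil> - 1)}"
    then have "1 \<le> j" "real j < z" by (auto simp: le_nat_iff) linarith
    then show "j \<in> {j\<in>{1..K}. real j < z}" using assms(2) by simp
  next
    fix j assume "j \<in> {j\<in>{1..K}. real j < z}"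
    then have "1 \<le> j" "real j < z" by auto
    then have "int j < \<lceil>z\<rceil>" by (simp add: less_ceiling_iff)
    then show "j \<in> {1..nat (\<lceil>z\<rceil> - 1)}" using \<open>1 \<le> j\<close> by auto
  qed
  then have "card {j\<in>{1..K}. real j < z} = nat (\<lceil>z\<rceil> - 1)" by simp
  then show "z - 1 \<le> real (card {j\<in>{1..K}. real j < z})" "real (card {j\<in>{1..K}. real j < z}) \<le> z"
    using assms(1) by linarith+
qed

text \<open>The number of integers j \<ge> 1 with j < n f, divided by n, is a step function at most
  1 / n below f on A. Its integral is the sum of the measures of superlevel sets, which are open
  when f is continuous.\<close>

lemma integral_layer_sums:
  fixes M :: "'a::topological_space measure" and f :: "'a \<Rightarrow> real"
  assumes M: "prob_space M" "sets M = sets borel" "AE y in M. y \<in> A"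
    and f: "f \<in> borel_measurable borel" "\<And>y. y \<in> A \<Longrightarrow> 0 \<le> f y \<and> f y \<le> real b" and n: "n > 0"
  shows "(\<Sum>j=1..n*b. measure M {y. real j < real n * f y}) / real n \<le> (\<integral>y. f y \<partial>M)"
    "(\<integral>y. f y \<partial>M) \<le> (\<Sum>j=1..n*b. measure M {y. real j < real n * f y}) / real n + 1 / real n"
proof -
  let ?S = "\<Sum>j=1..n*b. measure M {y. real j < real n * f y}"
  interpret prob_space M by fact
  note [measurable_cong] = M(2) note [measurable] = f(1)
  have sp: "space M = UNIV" using sets_eq_imp_space_eq[OF M(2)] by simp
  define s where "s y = (\<Sum>j=1..n*b. indicator {y. real j < real n * f y} y / real n :: real)" for y
  have G: "{y. real j < real n * f y} \<in> sets M" for j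
  proof -
    have "{y \<in> space borel. real j < real n * f y} \<in> sets borel" by measurable
    then show ?thesis by (simp add: M(2))
  qed
  have ints: "integrable M s" unfolding s_def using G
    by (intro Bochner_Integration.integrable_sum integrable_divide integrable_real_indicator) (auto simp: emeasure_eq_measure)
  have s: "(\<integral>y. s y \<partial>M) = ?S / real n"
    unfolding s_def using G
    by (subst Bochner_Integration.integral_sum)
      (auto intro!: integrable_divide integrable_real_indicator simp: emeasure_eq_measure sum_divide_distrib sp)
  have sy: "s y = real (card {j\<in>{1..n*b}. real j < real n * f y}) / real n" for y
    by (simp add: s_def indicator_def sum.If_cases Int_def flip: sum_divide_distrib)
  have bounds: "s y \<le> f y" "f y \<le> s y + 1 / real n" if "y \<in> A" for y
  proof -
    have "real n * f y \<le> real (n * b)" using f(2)[OF that] n by simp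
    note c = count_below[OF _ this]
    have "0 \<le> real n * f y" using f(2)[OF that] by simp
    from c[OF this] show "s y \<le> f y" "f y \<le> s y + 1 / real n"
      using n by (auto simp: sy field_simps)
  qed
  have intf: "integrable M f"
    using M(3) f(2) by (intro integrable_const_bound[of _ "real b"]) (auto elim!: eventually_mono)
  show "?S / real n \<le> (\<integral>y. f y \<partial>M)"
    unfolding s[symmetric] using M(3) bounds(1) by (intro integral_mono_AE ints intf) (auto elim!: eventually_mono)
  have "(\<integral>y. f y \<partial>M) \<le> (\<integral>y. s y + 1 / real n \<partial>M)"
    using M(3) bounds(2) by (intro integral_mono_AE intf Bochner_Integration.integrable_add ints) (auto elim!: eventually_mono)
  also have "\<dots> = (\<integral>y. s y \<partial>M) + 1 / real n" using ints by (simp add: prob_space)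
  finally show "(\<integral>y. f y \<partial>M) \<le> ?S / real n + 1 / real n"
    unfolding s .
qed

text \<open>The layer sums turn lower bounds on open sets into asymptotic lower bounds for integrals
  of functions nonnegative on A. Applied to b + f and b - f, they bound the integral of f from both
  sides. Only bounds on the compact A matter, so f may be unbounded elsewhere.\<close>

lemma integral_convergence_from_open_sets:
  fixes \<mu> :: "nat \<Rightarrow> 'a::metric_space measure" and f :: "'a \<Rightarrow> real"
  assumes A: "compact A"
    and \<mu>: "eventually (\<lambda>N. prob_space (\<mu> N) \<and> sets (\<mu> N) = sets borel \<and> (AE y in \<mu> N. y \<in> A)) sequentially"
    and \<nu>: "prob_space \<nu>" "sets \<nu> = sets borel" "AE y in \<nu>. y \<in> A"
    and G: "\<And>G \<eta>. open G \<Longrightarrow> \<eta> > 0 \<Longrightarrow> eventually (\<lambda>N. measure \<nu> G - \<eta> \<le> measure (\<mu> N) G) sequentially"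
    and f: "continuous_on UNIV f"
  shows "(\<lambda>N. \<integral>y. f y \<partial>\<mu> N) \<longlonglongrightarrow> (\<integral>y. f y \<partial>\<nu>)"
proof -
  have lower: "eventually (\<lambda>N. (\<integral>y. g y \<partial>\<nu>) - \<epsilon> \<le> (\<integral>y. g y \<partial>\<mu> N)) sequentially"
    if g: "continuous_on UNIV g" "\<And>y. y \<in> A \<Longrightarrow> 0 \<le> g y \<and> g y \<le> real b" and \<epsilon>: "\<epsilon> > 0" for g \<epsilon> b
  proof -
    have gm: "g \<in> borel_measurable borel" using g(1) by (rule borel_measurable_continuous_onI)
    obtain n where n: "n > 0" "1 / real n < \<epsilon> / 2"
      using \<epsilon> by (metis half_gt_zero nat_approx_posE zero_less_Suc)
    \<comment> \<open>The n b layers lose \<eta> each; after division by n this is b \<eta> \<le>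
      \<epsilon> / 2. The summand 1 covers b = 0.\<close>
    define \<eta> where "\<eta> = \<epsilon> / (2 * (real b + 1))"
    have \<eta>: "\<eta> > 0" "real b * \<eta> \<le> \<epsilon> / 2" using \<epsilon> by (auto simp: \<eta>_def field_simps)
    define S where "S j = {y. real j < real n * g y}" for j
    have "open (S j)" for j
      unfolding S_def using g(1) by (intro open_Collect_less continuous_intros)
    then have "eventually (\<lambda>N. \<forall>j\<in>{1..n*b}. measure \<nu> (S j) - \<eta> \<le> measure (\<mu> N) (S j)) sequentially"
      using G \<eta>(1) by (intro eventually_ball_finite) auto
    then show ?thesis using \<mu>
    proof eventually_elim
      case (elim N)
      have "(\<integral>y. g y \<partial>\<nu>) \<le> (\<Sum>j=1..n*b. measure \<nu> (S j)) / real n + 1 / real n"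
        unfolding S_def by (rule integral_layer_sums(2)[OF \<nu> gm g(2) n(1)])
      also have "(\<Sum>j=1..n*b. measure \<nu> (S j)) \<le> (\<Sum>j=1..n*b. measure (\<mu> N) (S j) + \<eta>)"
        using elim(1) by (intro sum_mono) (force simp: algebra_simps)
      also have "(\<Sum>j=1..n*b. measure (\<mu> N) (S j) + \<eta>) / real n + 1 / real n
         = (\<Sum>j=1..n*b. measure (\<mu> N) (S j)) / real n + (real b * \<eta> + 1 / real n)"
        using n(1) by (simp add: sum.distrib field_simps)
      also have "(\<Sum>j=1..n*b. measure (\<mu> N) (S j)) / real n \<le> (\<integral>y. g y \<partial>\<mu> N)"
        unfolding S_def using elim(2) by (intro integral_layer_sums(1)[OF _ _ _ gm g(2) n(1)]) auto
      finally show ?case using \<eta>(2) n by (simp add: divide_right_mono)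
    qed
  qed
  have "compact (f ` A)" using A f by (intro compact_continuous_image) (auto intro: continuous_on_subset)
  then obtain B where B: "\<And>y. y \<in> A \<Longrightarrow> \<bar>f y\<bar> \<le> B"
    using compact_imp_bounded by (fastforce simp: bounded_iff)
  obtain b :: nat where b: "B \<le> real b" using real_arch_simple by blast
  have fb: "\<bar>f y\<bar> \<le> real b" if "y \<in> A" for y using B[OF that] b by linarith
  have shift: "(\<integral>y. real b + f y \<partial>M) = real b + (\<integral>y. f y \<partial>M)" "(\<integral>y. real b - f y \<partial>M) = real b - (\<integral>y. f y \<partial>M)"
    if "prob_space M" "sets M = sets borel" "AE y in M. y \<in> A" for M
  proof -
    interpret prob_space M by fact
    note [measurable_cong] = that(2)
    have "f \<in> borel_measurable M" using f by (simp add: borel_measurable_continuous_onI measurable_cong_sets[OF that(2) refl])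
    then have "integrable M f"
      using that(3) fb by (intro integrable_const_bound[of _ "real b"]) (auto elim!: eventually_mono)
    then show "(\<integral>y. real b + f y \<partial>M) = real b + (\<integral>y. f y \<partial>M)" "(\<integral>y. real b - f y \<partial>M) = real b - (\<integral>y. f y \<partial>M)"
      by (simp_all add: prob_space)
  qed
  have cont: "continuous_on UNIV (\<lambda>y. real b + f y)" "continuous_on UNIV (\<lambda>y. real b - f y)"
    by (intro continuous_intros f)+
  have bnd: "0 \<le> real b + f y" "real b + f y \<le> 2 * real b" "0 \<le> real b - f y" "real b - f y \<le> 2 * real b"
    if "y \<in> A" for y
    using fb[OF that] by (auto simp: abs_le_iff)
  show ?thesis
  proof (rule tendstoI)
    fix \<epsilon> :: real assume \<epsilon>: "\<epsilon> > 0"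
    have "eventually (\<lambda>N. (\<integral>y. real b + f y \<partial>\<nu>) - \<epsilon> / 2 \<le> (\<integral>y. real b + f y \<partial>\<mu> N)) sequentially"
      by (rule lower[where b = "2 * b"]) (use cont bnd \<epsilon> in auto)
    moreover have "eventually (\<lambda>N. (\<integral>y. real b - f y \<partial>\<nu>) - \<epsilon> / 2 \<le> (\<integral>y. real b - f y \<partial>\<mu> N)) sequentially"
      by (rule lower[where b = "2 * b"]) (use cont bnd \<epsilon> in auto)
    ultimately show "eventually (\<lambda>N. dist (\<integral>y. f y \<partial>\<mu> N) (\<integral>y. f y \<partial>\<nu>) < \<epsilon>) sequentially"
      using \<mu>
    proof eventually_elim
      case (elim N)
      then show ?case
        using shift[OF \<nu>] shift[of "\<mu> N"] \<epsilon> by (auto simp: dist_real_def abs_less_iff)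
    qed
  qed
qed

section \<open>The normalized counting measure\<close>

lemma sets_normalized_counting_measure [simp]: "sets (normalized_counting_measure \<omega>) = sets borel"
  unfolding normalized_counting_measure_def
  using sets.sigma_sets_eq[of "borel :: (real^'a) measure"] by simp

lemma emeasure_normalized_counting_measure:
  fixes x :: "nat \<Rightarrow> real^'m"
  assumes N: "N > 0" and E: "E \<in> sets borel"
  shows "emeasure (normalized_counting_measure (image_mset x (mset_set {..<N}))) E
    = ennreal (real (card {i\<in>{..<N}. x i \<in> E}) / real N)"
proof -
  let ?f = "\<lambda>E. (\<Sum>i<N. emeasure (return borel (x i)) E) / of_nat N"
  have eq: "normalized_counting_measure (image_mset x (mset_set {..<N})) = measure_of UNIV (sets borel) ?f"
    by (simp add: normalized_counting_measure_def image_mset.compositionality comp_def sum_unfold_sum_mset)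
  have "emeasure (normalized_counting_measure (image_mset x (mset_set {..<N}))) E = ?f E"
    unfolding eq
  proof (rule emeasure_measure_of_sigma)
    show "sigma_algebra UNIV (sets (borel :: (real^'m) measure))"
      using sets.sigma_algebra_axioms[of "borel :: (real^'m) measure"] by simp
    show "positive (sets borel) ?f" by (simp add: positive_def)
    show "countably_additive (sets borel) ?f"
    proof (rule countably_additiveI)
      fix S :: "nat \<Rightarrow> (real^'m) set"
      assume S: "range S \<subseteq> sets borel" "disjoint_family S" "(\<Union>i. S i) \<in> sets borel"
      have "(\<Sum>n. ?f (S n)) = (\<Sum>n. \<Sum>i<N. emeasure (return borel (x i)) (S n)) / of_nat N" by simp
      also have "(\<Sum>n. \<Sum>i<N. emeasure (return borel (x i)) (S n)) = (\<Sum>i<N. \<Sum>n. emeasure (return borel (x i)) (S n))"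
        by (rule suminf_sum) simp
      also have "\<dots> = (\<Sum>i<N. emeasure (return borel (x i)) (\<Union>n. S n))"
        using S by (intro sum.cong refl suminf_emeasure) auto
      finally show "(\<Sum>n. ?f (S n)) = ?f (\<Union>n. S n)" .
    qed
  qed (rule E)
  also have "(\<Sum>i<N. emeasure (return borel (x i)) E) = of_nat (card {i\<in>{..<N}. x i \<in> E})"
    using E by (simp add: indicator_def sum.If_cases Int_def)
  also have "of_nat (card {i\<in>{..<N}. x i \<in> E}) / of_nat N = ennreal (real (card {i\<in>{..<N}. x i \<in> E}) / real N)"
    using N by (simp add: ennreal_of_nat_eq_real_of_nat divide_ennreal)
  finally show ?thesis .
qed


section \<open>Asymptotics of the polarization constants\<close>

lemma ennreal_le_divide_of_mult_le:
  assumes "p * ennreal q \<le> ennreal w" "q > 0" "w \<ge> 0"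
  shows "p \<le> ennreal (w / q)"
proof (cases p)
  case (real r)
  then have "r * q \<le> w" using assms by (simp flip: ennreal_mult)
  then show ?thesis using real assms by (simp add: field_simps ennreal_leI)
next
  case top
  then show ?thesis using assms by (simp add: ennreal_top_mult top_unique)
qed

text \<open>Equality can fail when m is 0 or \<infinity>; the inequality spares excluding these
  values of the maximal polarization.\<close>

lemma ennreal_divide_mult_le: "(p / m) * m \<le> (p :: ennreal)"
proof (cases "m = 0 \<or> m = top")
  case True
  then show ?thesis by (cases "p = top") (auto simp: ennreal_top_divide)
next
  case False
  then show ?thesis by (simp add: ennreal_divide_times less_top ennreal_divide_self)
qed

lemma ln_weight_pos: "N \<ge> 2 \<Longrightarrow> real N * ln (real N) > 0"
  by simp

context
  fixes A :: "(real^'m) set" and B :: "nat \<Rightarrow> (real^'m) set" and l :: nat and H :: real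
  assumes AB: "A = (\<Union>i\<in>{1..l}. B i)"
    and infA: "infinite A"
    and compB: "\<And>i. i \<in> {1..l} \<Longrightarrow> compact (B i)"
    and manB: "\<And>i. i \<in> {1..l} \<Longrightarrow> \<exists>W. C1_manifold TYPE('d::finite) W \<and> B i \<subseteq> W"
    and nullB: "\<And>i j. 1 \<le> i \<Longrightarrow> i < j \<Longrightarrow> j \<le> l \<Longrightarrow>
           emeasure (hausdorff_measure TYPE('d)) (B i \<inter> B j) = 0"
    and H: "emeasure (hausdorff_measure TYPE('d)) A = ennreal H" "H \<ge> 0"
begin

lemma pieces_exist:
  assumes "e > 0"
  shows "\<exists>n Q (\<psi> :: nat \<Rightarrow> real^'m \<Rightarrow> real^'d). (\<forall>i<n. compact (Q i) \<and> almost_isometry e (\<psi> i) (Q i)) \<and> A = (\<Union>i<n. Q i)"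
proof -
  obtain n P and \<psi> :: "nat \<Rightarrow> real^'m \<Rightarrow> real^'d"
    where "\<And>i. i < n \<Longrightarrow> compact (P i)" "\<And>i. i < n \<Longrightarrow> almost_isometry e (\<psi> i) (P i)" "A = (\<Union>i<n. P i)"
      "(\<Sum>i<n. emeasure lborel (\<psi> i ` P i)) \<le> emeasure (hausdorff_measure TYPE('d)) A + ennreal 1"
    by (rule manifold_union_pieces[OF AB _ _ _ assms zero_less_one])
      (erule compB | erule manB | (erule (2) nullB) | (rule that; assumption))+
  then show ?thesis by (intro exI[of _ n] exI[of _ P] exI[of _ \<psi>]) blast
qed

lemma max_polarization_ge:
  assumes c: "c \<ge> 0" "c * H < unit_ball_vol CARD('d)"
  shows "eventually (\<lambda>N. ennreal (c * (real N * ln (real N))) \<le> max_polarization (real CARD('d)) N A) sequentially"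
proof -
  have "((\<lambda>t. c * (1 + t) ^ CARD('d) * (H + t)) \<longlongrightarrow> c * (1 + 0) ^ CARD('d) * (H + 0)) (at_right 0)"
    by (intro tendsto_intros)
  then have "eventually (\<lambda>t. c * (1 + t) ^ CARD('d) * (H + t) < unit_ball_vol CARD('d)) (at_right 0)"
    using c(2) by (intro order_tendstoD(2)) auto
  then have "eventually (\<lambda>t. t > 0 \<and> c * (1 + t) ^ CARD('d) * (H + t) < unit_ball_vol CARD('d)) (at_right 0)"
    using eventually_at_right_less[of 0] by eventually_elim auto
  then obtain t :: real where t: "t > 0" "c * (1 + t) ^ CARD('d) * (H + t) < unit_ball_vol CARD('d)"
    using eventually_happens[of _ "at_right (0::real)"] by auto
  \<comment> \<open>Half of t is used in the decomposition, since
    \<open>max_polarization_lower\<close> wants the volumes strictly below H + t.\<close>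
  have t2: "t / 2 > 0" using t by simp
  obtain n P and \<psi> :: "nat \<Rightarrow> real^'m \<Rightarrow> real^'d"
    where P: "\<And>i. i < n \<Longrightarrow> compact (P i)" "\<And>i. i < n \<Longrightarrow> almost_isometry t (\<psi> i) (P i)" "A = (\<Union>i<n. P i)"
      "(\<Sum>i<n. emeasure lborel (\<psi> i ` P i)) \<le> emeasure (hausdorff_measure TYPE('d)) A + ennreal (t / 2)"
    by (rule manifold_union_pieces[OF AB _ _ _ t(1) t2])
      (erule compB | erule manB | (erule (2) nullB) | (rule that; assumption))+
  have "(\<Sum>i<n. emeasure lborel (\<psi> i ` P i)) \<le> ennreal (H + t / 2)"
    using P(4) H t by (simp add: ennreal_plus)
  also have "\<dots> < ennreal (H + t)" using H t by (simp add: ennreal_less_iff)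
  finally have V: "(\<Sum>i<n. emeasure lborel (\<psi> i ` P i)) < ennreal (H + t)" .
  show ?thesis
    by (rule max_polarization_lower[OF _ _ _ P(3) infA V _ c(1) t(2)]) (use t H P in auto)
qed

lemma polarization_count_bound_indexed:
  assumes "open G" "\<delta> > 0" "emeasure (hausdorff_measure TYPE('d)) (A \<inter> G) = ennreal a" "a \<ge> 0"
  shows "eventually (\<lambda>N. \<forall>x. x ` {..<N} \<subseteq> A \<longrightarrow>
    polarization (real CARD('d)) (image_mset x (mset_set {..<N})) A * ennreal (a - \<delta>)
      \<le> ennreal (real N * ln (real N) *
          (unit_ball_vol CARD('d) * (1 + \<delta>) * (real (card {i\<in>{..<N}. x i \<in> G}) / real N) + \<delta>))) sequentially"
  using polarization_count_bound[OF pieces_exist assms] by (simp add: polarization_indexed)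

text \<open>The count bound with G the whole space, where the fraction of points in G is 1.\<close>

lemma max_polarization_le:
  assumes "H > 0" and c: "unit_ball_vol CARD('d) < c * H"
  shows "eventually (\<lambda>N. max_polarization (real CARD('d)) N A \<le> ennreal (c * (real N * ln (real N)))) sequentially"
proof -
  let ?\<beta> = "unit_ball_vol CARD('d)"
  have "((\<lambda>t. ?\<beta> * (1 + t) + t - c * (H - t)) \<longlongrightarrow> ?\<beta> * (1 + 0) + 0 - c * (H - 0)) (at_right 0)"
    by (intro tendsto_intros)
  then have "eventually (\<lambda>t. ?\<beta> * (1 + t) + t - c * (H - t) < 0) (at_right 0)"
    using c by (intro order_tendstoD(2)) auto
  moreover have "eventually (\<lambda>t. t < H) (at_right 0)"
    using \<open>H > 0\<close> by (intro order_tendstoD(2)[OF tendsto_ident_at]) auto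
  ultimately have "eventually (\<lambda>t. t > 0 \<and> t < H \<and> ?\<beta> * (1 + t) + t - c * (H - t) < 0) (at_right 0)"
    using eventually_at_right_less[of 0] by eventually_elim auto
  then obtain \<delta> :: real where \<delta>: "\<delta> > 0" "\<delta> < H" "?\<beta> * (1 + \<delta>) + \<delta> - c * (H - \<delta>) < 0"
    using eventually_happens[of _ "at_right (0::real)"] by auto
  have HU: "emeasure (hausdorff_measure TYPE('d)) (A \<inter> UNIV) = ennreal H" using H by simp
  show ?thesis
    using polarization_count_bound_indexed[OF open_UNIV \<delta>(1) HU H(2)] eventually_ge_at_top[of 2]
  proof eventually_elim
    case (elim N)
    let ?w = "real N * ln (real N)"
    have w: "?w > 0" using elim(2) by (rule ln_weight_pos)
    show ?case
      unfolding max_polarization_def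
    proof (rule SUP_least)
      fix \<omega> assume "\<omega> \<in> {\<omega>. configuration N A \<omega>}"
      then have \<omega>: "set_mset \<omega> \<subseteq> A" "size \<omega> = N" by (auto simp: configuration_def)
      obtain x where "\<omega> = image_mset x (mset_set {..<size \<omega>})" by (rule multiset_indexed)
      then have x: "\<omega> = image_mset x (mset_set {..<N})" using \<omega>(2) by simp
      then have "x ` {..<N} \<subseteq> A" using \<omega>(1) by simp
      then have "polarization (real CARD('d)) \<omega> A * ennreal (H - \<delta>)
        \<le> ennreal (?w * (?\<beta> * (1 + \<delta>) * (real (card {i\<in>{..<N}. x i \<in> UNIV}) / real N) + \<delta>))"
        unfolding x using elim(1) by blast
      also have "real (card {i\<in>{..<N}. x i \<in> UNIV}) / real N = 1" using elim(2) by simp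
      finally have "polarization (real CARD('d)) \<omega> A \<le> ennreal (?w * (?\<beta> * (1 + \<delta>) * 1 + \<delta>) / (H - \<delta>))"
        using \<delta> w by (intro ennreal_le_divide_of_mult_le) auto
      also have "\<dots> \<le> ennreal (c * ?w)"
      proof (rule ennreal_leI)
        have "?w * (?\<beta> * (1 + \<delta>) * 1 + \<delta>) \<le> ?w * (c * (H - \<delta>))"
          using \<delta>(3) w by (intro mult_left_mono) auto
        then show "?w * (?\<beta> * (1 + \<delta>) * 1 + \<delta>) / (H - \<delta>) \<le> c * ?w"
          using \<delta>(2) by (simp add: pos_divide_le_eq mult_ac)
      qed
      finally show "polarization (real CARD('d)) \<omega> A \<le> ennreal (c * ?w)" .
    qed
  qed
qed

lemma max_polarization_limit:
  "(\<lambda>N. max_polarization (real CARD('d)) N A / ennreal (real N * ln (real N)))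
     \<longlonglongrightarrow> (if H = 0 then \<infinity> else ennreal (unit_ball_vol CARD('d) / H))"
    (is "_ \<longlonglongrightarrow> ?L")
proof (rule order_tendstoI)
  fix a assume "a < ?L"
  then obtain b where b: "a < b" "b < ?L" using dense by blast
  then obtain c where c: "b = ennreal c" "c \<ge> 0" by (cases b) auto
  have "c * H < unit_ball_vol CARD('d)"
  proof (cases "H = 0")
    case False
    then have "c < unit_ball_vol CARD('d) / H" using b(2) c by (simp add: ennreal_less_iff)
    then show ?thesis using False H(2) by (simp add: field_simps)
  qed simp
  then have "eventually (\<lambda>N. ennreal (c * (real N * ln (real N))) \<le> max_polarization (real CARD('d)) N A) sequentially"
    by (rule max_polarization_ge[OF c(2)])
  then show "eventually (\<lambda>N. a < max_polarization (real CARD('d)) N A / ennreal (real N * ln (real N))) sequentially"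
    using eventually_ge_at_top[of 2]
  proof eventually_elim
    case (elim N)
    let ?w = "real N * ln (real N)"
    have w: "?w > 0" using elim(2) by (rule ln_weight_pos)
    have "ennreal (c * ?w) / ennreal ?w = ennreal (c * ?w / ?w)" using c w by (intro divide_ennreal) auto
    also have "c * ?w / ?w = c" using less_imp_neq[OF w, symmetric] by (rule nonzero_mult_div_cancel_right)
    finally have "b = ennreal (c * ?w) / ennreal ?w" using c by simp
    also have "\<dots> \<le> max_polarization (real CARD('d)) N A / ennreal ?w"
      by (rule divide_right_mono_ennreal[OF elim(1)])
    finally show ?case using b(1) by (rule less_le_trans[rotated])
  qed
next
  fix u assume u: "?L < u"
  \<comment> \<open>For H = 0 the limit is \<infinity> and nothing lies above it.\<close>
  then have H0: "H > 0" using H(2) by (cases "H = 0") auto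
  obtain b where b: "?L < b" "b < u" using u dense by blast
  then obtain c where c: "b = ennreal c" "c \<ge> 0" by (cases b) auto
  have "unit_ball_vol CARD('d) / H < c" using b(1) c H0 by (simp add: ennreal_less_iff)
  then have "unit_ball_vol CARD('d) < c * H" using H0 by (simp add: field_simps)
  from max_polarization_le[OF H0 this]
  show "eventually (\<lambda>N. max_polarization (real CARD('d)) N A / ennreal (real N * ln (real N)) < u) sequentially"
    using eventually_ge_at_top[of 2]
  proof eventually_elim
    case (elim N)
    let ?w = "real N * ln (real N)"
    have w: "?w > 0" using elim(2) by (rule ln_weight_pos)
    have "max_polarization (real CARD('d)) N A / ennreal ?w \<le> ennreal (c * ?w) / ennreal ?w"
      by (rule divide_right_mono_ennreal[OF elim(1)])
    also have "\<dots> = ennreal (c * ?w / ?w)" using c w by (intro divide_ennreal) auto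
    also have "c * ?w / ?w = c" using less_imp_neq[OF w, symmetric] by (rule nonzero_mult_div_cancel_right)
    also have "ennreal c = b" using c by simp
    finally show ?case using b(2) by (rule le_less_trans)
  qed
qed

text \<open>A constant c' strictly between c and \<beta> / H splits the loss: the ratio to the
  maximum eventually exceeds c / c', and the maximum eventually reaches c' N ln N.\<close>

lemma asymptotically_optimal_ge:
  assumes "asymptotically_optimal (real CARD('d)) A \<omega>" and H0: "H > 0"
    and c: "c \<ge> 0" "c * H < unit_ball_vol CARD('d)"
  shows "eventually (\<lambda>N. ennreal (c * (real N * ln (real N))) \<le> polarization (real CARD('d)) (\<omega> N) A) sequentially"
proof -
  have "c < unit_ball_vol CARD('d) / H" using c H0 by (simp add: field_simps)
  then obtain c' where c': "c < c'" "c' < unit_ball_vol CARD('d) / H" using dense by blast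
  then have c'H: "c' * H < unit_ball_vol CARD('d)" "c' > 0" using H0 c by (auto simp: field_simps)
  have "ennreal (c / c') < 1"
    using c' c c'H by (simp add: ennreal_less_one_iff)
  moreover have "(\<lambda>N. polarization (real CARD('d)) (\<omega> N) A / max_polarization (real CARD('d)) N A) \<longlonglongrightarrow> 1"
    using assms(1) by (simp add: asymptotically_optimal_def)
  ultimately have "eventually (\<lambda>N. ennreal (c / c') <
      polarization (real CARD('d)) (\<omega> N) A / max_polarization (real CARD('d)) N A) sequentially"
    by (intro order_tendstoD(1))
  moreover have "eventually (\<lambda>N. ennreal (c' * (real N * ln (real N))) \<le> max_polarization (real CARD('d)) N A) sequentially"
    by (rule max_polarization_ge) (use c'H in auto)
  ultimately show ?thesis using eventually_ge_at_top[of 2]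
  proof eventually_elim
    case (elim N)
    let ?w = "real N * ln (real N)" and ?M = "max_polarization (real CARD('d)) N A"
      and ?p = "polarization (real CARD('d)) (\<omega> N) A"
    have w: "?w > 0" using elim(3) by (rule ln_weight_pos)
    have "ennreal (c * ?w) = ennreal (c / c') * ennreal (c' * ?w)"
      using c c'H w by (subst ennreal_mult[symmetric]) auto
    also have "\<dots> \<le> ?p / ?M * ?M" using elim by (intro mult_mono) auto
    also have "\<dots> \<le> ?p" by (rule ennreal_divide_mult_le)
    finally show ?case .
  qed
qed

text \<open>For open G with a the measure of \<open>A \<inter> G\<close>, near-optimality and the
  count bound give c (a - \<delta>) \<le> \<beta> (1 + \<delta>) \<gamma> + \<delta>, where \<gamma>
  is the fraction of points in G and c = \<beta> / H - \<delta>. For small \<delta> this says that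
  \<gamma> is at least a / H up to any prescribed error.\<close>

lemma asymptotically_optimal_weak_star:
  assumes opt: "asymptotically_optimal (real CARD('d)) A \<omega>" and H0: "H > 0"
  shows "weak_star_conv (\<lambda>N. normalized_counting_measure (\<omega> N)) (uniform_measure (hausdorff_measure TYPE('d)) A)"
  unfolding weak_star_conv_def
proof (intro allI impI)
  fix f :: "real^'m \<Rightarrow> real" assume f: "continuous_on UNIV f"
  let ?\<beta> = "unit_ball_vol CARD('d)" and ?HM = "hausdorff_measure TYPE('d) :: (real^'m) measure"
  let ?\<mu> = "\<lambda>N. normalized_counting_measure (\<omega> N)" and ?\<nu> = "uniform_measure ?HM A"
  have A: "compact A" unfolding AB using compB by (intro compact_UN) auto
  have Ab: "A \<in> sets borel" using A by (rule borel_compact)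
  have "\<exists>x. \<omega> N = image_mset x (mset_set {..<size (\<omega> N)})" for N
    by (rule multiset_indexed) blast
  then obtain x where x: "\<And>N. \<omega> N = image_mset (x N) (mset_set {..<size (\<omega> N)})" by metis
  \<comment> \<open>For N = 0 the definition of \<open>asymptotically_optimal\<close> says nothing
    about the configuration.\<close>
  have conf: "set_mset (\<omega> N) \<subseteq> A" "size (\<omega> N) = N" if "N \<ge> 1" for N
    using opt that by (auto simp: asymptotically_optimal_def configuration_def)
  have \<omega>x: "\<omega> N = image_mset (x N) (mset_set {..<N})" if "N \<ge> 1" for N
    using x[of N] conf(2)[OF that] by simp
  have xA: "x N ` {..<N} \<subseteq> A" if "N \<ge> 1" for N
    using conf(1)[OF that] unfolding \<omega>x[OF that] by simp
  have \<mu>: "emeasure (?\<mu> N) E = ennreal (real (card {i\<in>{..<N}. x N i \<in> E}) / real N)"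
    if "N \<ge> 1" "E \<in> sets borel" for N E
    unfolding \<omega>x[OF that(1)] using that by (intro emeasure_normalized_counting_measure) auto
  have \<nu>: "prob_space ?\<nu>" using H H0 by (intro prob_space_uniform_measure) auto
  show "(\<lambda>N. \<integral>y. f y \<partial>?\<mu> N) \<longlonglongrightarrow> (\<integral>y. f y \<partial>?\<nu>)"
  proof (rule integral_convergence_from_open_sets[OF A _ \<nu> _ _ _ f])
    show "sets ?\<nu> = sets borel" by simp
    show "AE y in ?\<nu>. y \<in> A"
      using Ab H by (intro AE_uniform_measureI) auto
    show "eventually (\<lambda>N. prob_space (?\<mu> N) \<and> sets (?\<mu> N) = sets borel \<and> (AE y in ?\<mu> N. y \<in> A)) sequentially"
      using eventually_ge_at_top[of 1]
    proof eventually_elim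
      case (elim N)
      have sp: "space (?\<mu> N) = UNIV"
        using sets_eq_imp_space_eq[OF sets_normalized_counting_measure[of "\<omega> N"]] by simp
      have "prob_space (?\<mu> N)"
        using elim \<mu>[OF elim, of UNIV] by (intro prob_spaceI) (simp add: sp)
      moreover have "AE y in ?\<mu> N. y \<in> A"
      proof (rule AE_I)
        show "{y \<in> space (?\<mu> N). y \<notin> A} \<subseteq> - A" by auto
        have "{i\<in>{..<N}. x N i \<in> - A} = {}" using xA[OF elim] by auto
        then show "emeasure (?\<mu> N) (- A) = 0" using \<mu>[OF elim, of "- A"] Ab by (simp add: Compl_eq_Diff_UNIV)
        show "- A \<in> sets (?\<mu> N)" using Ab by (simp add: Compl_eq_Diff_UNIV)
      qed
      ultimately show ?case by simp
    qed
    fix G :: "(real^'m) set" and \<eta> :: real assume G: "open G" and \<eta>: "\<eta> > 0"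
    define a where "a = measure ?HM (A \<inter> G)"
    have "emeasure ?HM (A \<inter> G) \<le> emeasure ?HM A" using Ab by (intro emeasure_mono) auto
    then have "emeasure ?HM (A \<inter> G) \<noteq> top" using H by (auto simp: top_unique)
    then have a: "emeasure ?HM (A \<inter> G) = ennreal a" "a \<ge> 0"
      by (auto simp: a_def emeasure_eq_ennreal_measure)
    have \<nu>G: "measure ?\<nu> G = a / H"
    proof -
      have "emeasure ?\<nu> G = ennreal (a / H)"
        using Ab G a H H0 by (simp add: divide_ennreal)
      then show ?thesis using a H0 by (simp add: measure_def)
    qed
    \<comment> \<open>The expression is the lower bound for \<gamma> solved from the final
      inequality, with t in place of \<delta>.\<close>
    have "((\<lambda>t. ((?\<beta> / H - t) * (a - t) - t) / (?\<beta> * (1 + t))) \<longlongrightarrow> ((?\<beta> / H - 0) * (a - 0) - 0) / (?\<beta> * (1 + 0))) (at_right 0)"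
      by (intro tendsto_intros) (auto simp: less_imp_neq[symmetric])
    moreover have "((?\<beta> / H - 0) * (a - 0) - 0) / (?\<beta> * (1 + 0)) = a / H"
      using less_imp_neq[OF unit_ball_vol_pos[of "real CARD('d)"]] by simp
    ultimately have "eventually (\<lambda>t. a / H - \<eta> < ((?\<beta> / H - t) * (a - t) - t) / (?\<beta> * (1 + t))) (at_right 0)"
      using \<eta> by (intro order_tendstoD(1)) auto
    moreover have "eventually (\<lambda>t. t < ?\<beta> / H) (at_right 0)"
      using H0 by (intro order_tendstoD(2)[OF tendsto_ident_at]) auto
    ultimately have "eventually (\<lambda>t. t > 0 \<and> t < ?\<beta> / H \<and>
        a / H - \<eta> < ((?\<beta> / H - t) * (a - t) - t) / (?\<beta> * (1 + t))) (at_right 0)"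
      using eventually_at_right_less[of 0] by eventually_elim auto
    then obtain \<delta> :: real where \<delta>: "\<delta> > 0" "\<delta> < ?\<beta> / H"
      "a / H - \<eta> < ((?\<beta> / H - \<delta>) * (a - \<delta>) - \<delta>) / (?\<beta> * (1 + \<delta>))"
      using eventually_happens[of _ "at_right (0::real)"] by auto
    define c where "c = ?\<beta> / H - \<delta>"
    have c: "c \<ge> 0" "c * H < ?\<beta>" using \<delta> H0 by (auto simp: c_def algebra_simps)
    show "eventually (\<lambda>N. measure ?\<nu> G - \<eta> \<le> measure (?\<mu> N) G) sequentially"
      using polarization_count_bound_indexed[OF G \<delta>(1) a] asymptotically_optimal_ge[OF opt H0 c] eventually_ge_at_top[of 2]
    proof eventually_elim
      case (elim N)
      let ?w = "real N * ln (real N)" and ?p = "polarization (real CARD('d)) (\<omega> N) A"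
      define \<gamma> where "\<gamma> = real (card {i\<in>{..<N}. x N i \<in> G}) / real N"
      have w: "?w > 0" using elim(3) by (rule ln_weight_pos)
      have N: "N \<ge> 1" using elim(3) by simp
      have \<gamma>: "measure (?\<mu> N) G = \<gamma>" "\<gamma> \<ge> 0"
        using \<mu>[OF N, of G] G by (auto simp: measure_def \<gamma>_def)
      have "c * (a - \<delta>) \<le> ?\<beta> * (1 + \<delta>) * \<gamma> + \<delta>"
      proof (cases "a \<le> \<delta>")
        \<comment> \<open>Here \<open>ennreal (a - \<delta>)\<close> is 0, so the count bound
          carries no information, but the claim is trivial.\<close>
        case True
        then have "c * (a - \<delta>) \<le> 0" using c by (simp add: mult_nonneg_nonpos)
        also have "\<dots> \<le> ?\<beta> * (1 + \<delta>) * \<gamma> + \<delta>" using \<delta> \<gamma> by simp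
        finally show ?thesis .
      next
        case False
        have "ennreal (c * ?w * (a - \<delta>)) = ennreal (c * ?w) * ennreal (a - \<delta>)"
          using c w False by (intro ennreal_mult) auto
        also have "\<dots> \<le> ?p * ennreal (a - \<delta>)" by (intro mult_right_mono elim(2)) simp
        also have "\<dots> \<le> ennreal (?w * (?\<beta> * (1 + \<delta>) * \<gamma> + \<delta>))"
          using elim(1) xA[OF N] unfolding \<gamma>_def \<omega>x[OF N] by blast
        finally have "c * ?w * (a - \<delta>) \<le> ?w * (?\<beta> * (1 + \<delta>) * \<gamma> + \<delta>)"
          using w \<delta> \<gamma> by (subst (asm) ennreal_le_iff) auto
        then have "?w * (c * (a - \<delta>)) \<le> ?w * (?\<beta> * (1 + \<delta>) * \<gamma> + \<delta>)" by (simp add: mult_ac)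
        then show ?thesis using w by (subst (asm) mult_le_cancel_left_pos) auto
      qed
      then have "(c * (a - \<delta>) - \<delta>) / (?\<beta> * (1 + \<delta>)) \<le> \<gamma>"
        using \<delta> by (simp add: pos_divide_le_eq mult_ac)
      then show ?case using \<delta>(3) unfolding \<nu>G \<gamma>(1) c_def by linarith
    qed
  qed
qed

end

theorem theorem3p1:
  fixes A :: "(real^'m) set" and B :: "nat \<Rightarrow> (real^'m) set" and l :: nat
  assumes "CARD('d::finite) \<le> CARD('m)"
    and "A = (\<Union>i\<in>{1..l}. B i)"
    and "infinite A"
    and "\<And>i. i \<in> {1..l} \<Longrightarrow> compact (B i)"
    and "\<And>i. i \<in> {1..l} \<Longrightarrow> \<exists>W. C1_manifold TYPE('d) W \<and> B i \<subseteq> W"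
    and "\<And>i j. 1 \<le> i \<Longrightarrow> i < j \<Longrightarrow> j \<le> l \<Longrightarrow>
           emeasure (hausdorff_measure TYPE('d)) (B i \<inter> B j) = 0"
  shows "(\<lambda>N. max_polarization (real CARD('d)) N A / ennreal (real N * ln (real N)))
           \<longlonglongrightarrow> (if emeasure (hausdorff_measure TYPE('d)) A = 0 then \<infinity>
               else ennreal (measure lborel (ball (0 :: real^'d) 1))
                      / emeasure (hausdorff_measure TYPE('d)) A)
         \<and> (emeasure (hausdorff_measure TYPE('d)) A > 0 \<longrightarrow>
              (\<forall>\<omega>. asymptotically_optimal (real CARD('d)) A \<omega> \<longrightarrow>
                 weak_star_conv (\<lambda>N. normalized_counting_measure (\<omega> N))
                   (uniform_measure (hausdorff_measure TYPE('d)) A)))"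
proof -
  let ?HM = "hausdorff_measure TYPE('d) :: (real^'m) measure"
  define H where "H = measure ?HM A"
  \<comment> \<open>A decomposition with the arbitrary distortion 1, only to see that A has finite
    measure.\<close>
  obtain n P and \<psi> :: "nat \<Rightarrow> real^'m \<Rightarrow> real^'d"
    where P: "\<And>i. i < n \<Longrightarrow> compact (P i)" "\<And>i. i < n \<Longrightarrow> almost_isometry 1 (\<psi> i) (P i)" "A = (\<Union>i<n. P i)"
      "(\<Sum>i<n. emeasure lborel (\<psi> i ` P i)) \<le> emeasure ?HM A + ennreal 1"
    by (rule manifold_union_pieces[OF assms(2) _ _ _ zero_less_one zero_less_one])
      (erule assms(4) | erule assms(5) | (erule (2) assms(6)) | (rule that; assumption))+
  have "emeasure ?HM A < top"
    unfolding P(3) by (rule finite_hausdorff_measure_pieces[OF zero_le_one]) (use P in auto)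
  then have H: "emeasure ?HM A = ennreal H" "H \<ge> 0"
    by (auto simp: H_def emeasure_eq_ennreal_measure)
  have lim: "(\<lambda>N. max_polarization (real CARD('d)) N A / ennreal (real N * ln (real N)))
     \<longlonglongrightarrow> (if H = 0 then \<infinity> else ennreal (unit_ball_vol CARD('d) / H))"
    by (rule max_polarization_limit[OF assms(2,3) _ _ _ H]) (erule assms(4) | erule assms(5) | (erule (2) assms(6)))+
  have L: "(if emeasure ?HM A = 0 then \<infinity> else ennreal (measure lborel (ball (0 :: real^'d) 1)) / emeasure ?HM A)
    = (if H = 0 then \<infinity> else ennreal (unit_ball_vol CARD('d) / H))"
    using H by (simp add: content_ball divide_ennreal)
  show ?thesis
  proof (intro conjI impI allI)
    show "(\<lambda>N. max_polarization (real CARD('d)) N A / ennreal (real N * ln (real N)))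
           \<longlonglongrightarrow> (if emeasure ?HM A = 0 then \<infinity>
               else ennreal (measure lborel (ball (0 :: real^'d) 1)) / emeasure ?HM A)"
      unfolding L by (rule lim)
    fix \<omega> assume "emeasure ?HM A > 0" and opt: "asymptotically_optimal (real CARD('d)) A \<omega>"
    then have "H > 0" using H by simp
    show "weak_star_conv (\<lambda>N. normalized_counting_measure (\<omega> N)) (uniform_measure ?HM A)"
      by (rule asymptotically_optimal_weak_star[OF assms(2,3) _ _ _ H opt \<open>H > 0\<close>])
        (erule assms(4) | erule assms(5) | (erule (2) assms(6)))+
  qed
qed


end
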